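(* Let $f:\mathbb{R}^n\to\mathbb{R}^m$ be an asymptotically flat map and let $M^n=\{(x,f(x)) : x\in\mathbb{R}^n\}\subset\mathbb{R}^{n+m}$ be its graph endowed with its natural metric $g=g_{ij}\,dx^i\otimes dx^j$. Then the ADM mass of $M$ satisfies $$m_{ADM}=\frac{1}{2(n-1)\omega_{n-1}}\int_M (S+S^\perp)\,\frac{1}{\sqrt{G}}\,dM,$$ where $G=\det(g_{ij})$.
   Context: Here $n\ge 2$, $m\ge 1$; repeated indices are summed, with $i,j,k,\dots\in\{1,\dots,n\}$ and $\alpha,\beta,\dots\in\{1,\dots,m\}$; $\omega_{n-1}$ is the volume of the unit sphere in $\mathbb{R}^n$. Asymptotically flat map: a $C^2$ map $f=(f^1,\dots,f^m):\mathbb{R}^n\setminus\Omega\to\mathbb{R}^m$ ($\Omega\subset\mathbb{R}^n$ a subset, here $\Omega=\emptyset$) is asymptotically flat if the scalar curvature $S$ of its graph with the natural metric, viewed as a function of $x$, is integrable over the domain of $f$, and there is a constant $p>\frac{n-2}{2}$ such that $f^\alpha_i=\partial f^\alpha/\partial x_i=O(|x|^{-p/2})$ and $f^\alpha_{ij}=\partial^2 f^\alpha/\partial x_i\partial x_j=O(|x|^{-p/2-1})$ at infinity, for all $\alpha,i,j$. Natural metric: the metric induced from $\mathbb{R}^{n+m}$; in the graph coordinates $x$, $g_{ij}=\delta_{ij}+f^\alpha_i f^\alpha_j$. $dM$ is its volume element. Functions on the domain of $f$ and on $M$ are identified via the projection $(x,f(x))\mapsto x$. ADM mass (computed in the graph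 coordinates $x$): $$m_{ADM}=\lim_{r\to\infty}\frac{1}{2(n-1)\omega_{n-1}}\int_{S_r}(g_{iji}-g_{iij})\,\nu_j\,d\mu,$$ where $g_{ijk}=\partial g_{ij}/\partial x_k$, $S_r=\{|x|=r\}$, $\nu=x/r$, and $d\mu$ is the Euclidean area element of $S_r$. Function $S^\perp$: let $\eta^\alpha=(-Df^\alpha,e_\alpha)$, where $Df^\alpha$ is the Euclidean gradient and $e_\alpha$ the canonical basis of $\mathbb{R}^m$ (these $\eta^\alpha$ form a basis of the normal bundle of $M$), and let $\nabla f^\alpha$ be the gradient of $f^\alpha$ on $(M,g)$. Then $S^\perp=\langle R^\perp(\nabla f^\alpha,\nabla f^\beta)\eta^\beta,\eta^\alpha\rangle$ (summed over $\alpha,\beta$), where $R^\perp$ is the normal curvature tensor of $M\subset\mathbb{R}^{n+m}$, $R^\perp(X,Y)\xi=\nabla^\perp_X\nabla^\perp_Y\xi-\nabla^\perp_Y\nabla^\perp_X\xi-\nabla^\perp_{[X,Y]}\xi$. By Ricci's equation, equivalently $S^\perp=g(A^\alpha\nabla f^\alpha,A^\beta\nabla f^\beta)-g(A^\alpha\nabla f^\beta,A^\beta\nabla f^\alpha)$, where $A^\alpha$ is the shape operator in the direction $\eta^\alpha$ (this makes sense for $C^2$ maps). *)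

theory Defs
  imports "HOL-Analysis.Analysis" "HOL-Library.Landau_Symbols"
begin

section \<open>Partial derivatives and maps of class $C^k$\<close>

definition partial :: "'n::finite \<Rightarrow> (real^'n \<Rightarrow> 'b::real_normed_vector) \<Rightarrow> real^'n \<Rightarrow> 'b" where
  "partial i \<phi> x = frechet_derivative \<phi> (at x) (axis i 1)"

definition C1_map :: "(real^'n::finite \<Rightarrow> 'b::real_normed_vector) \<Rightarrow> bool" where
  "C1_map \<phi> \<longleftrightarrow> (\<forall>x. \<phi> differentiable (at x)) \<and> (\<forall>i. continuous_on UNIV (partial i \<phi>))"

definition C2_map :: "(real^'n::finite \<Rightarrow> 'b::real_normed_vector) \<Rightarrow> bool" where
  "C2_map \<phi> \<longleftrightarrow> C1_map \<phi> \<and> (\<forall>i. C1_map (partial i \<phi>))"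


section \<open>Geometry of the graph of \<open>f\<close>, in the graph coordinates \<open>x\<close>\<close>

text \<open>
  The ambient space $R^{n+m}$ is \<open>(real^'n) \<times> (real^'m)\<close> with its Euclidean inner product.  Objects on
  the graph are functions of \<open>x\<close>, through the identification of \<open>(x, f x)\<close> with \<open>x\<close>.
\<close>

definition graph_map :: "(real^'n::finite \<Rightarrow> real^'m::finite) \<Rightarrow> real^'n \<Rightarrow> (real^'n) \<times> (real^'m)" where
  "graph_map f x = (x, f x)"

definition tangent_frame ::
    "(real^'n::finite \<Rightarrow> real^'m::finite) \<Rightarrow> 'n \<Rightarrow> real^'n \<Rightarrow> (real^'n) \<times> (real^'m)" where
  "tangent_frame f i = partial i (graph_map f)"

definition induced_metric :: "(real^'n::finite \<Rightarrow> real^'m::finite) \<Rightarrow> real^'n \<Rightarrow> real^'n^'n" where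
  "induced_metric f x = (\<chi> i j. tangent_frame f i x \<bullet> tangent_frame f j x)"

text \<open>The inverse matrix $g^{ij}$.\<close>

definition inverse_metric :: "(real^'n::finite \<Rightarrow> real^'n^'n) \<Rightarrow> 'n \<Rightarrow> 'n \<Rightarrow> real^'n \<Rightarrow> real" where
  "inverse_metric g i j x = matrix_inv (g x) $ i $ j"

text \<open>The normal component of the ambient derivative $\partial_i \partial_j (x, f(x))$.\<close>

definition second_fundamental_form ::
    "(real^'n::finite \<Rightarrow> real^'m::finite) \<Rightarrow> 'n \<Rightarrow> 'n \<Rightarrow> real^'n \<Rightarrow> (real^'n) \<times> (real^'m)" where
  "second_fundamental_form f i j x =
     partial i (tangent_frame f j) x -
     (\<Sum>k\<in>UNIV. \<Sum>l\<in>UNIV.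
        (inverse_metric (induced_metric f) k l x * (partial i (tangent_frame f j) x \<bullet> tangent_frame f l x))
          *\<^sub>R tangent_frame f k x)"

text \<open>
  For a $C^2$ map the induced metric is only $C^1$, so the curvature tensor of the graph has to be
  read through the Gauss equation: the value below is $g(R(\partial_i,\partial_j)\partial_k,\partial_l)$.
  The theorem \<open>scalar_curvature_eq_intrinsic\<close> at the end of this theory shows that for $C^3$ maps the
  resulting scalar curvature is the one computed from the metric alone.
\<close>

definition curvature_tensor ::
    "(real^'n::finite \<Rightarrow> real^'m::finite) \<Rightarrow> 'n \<Rightarrow> 'n \<Rightarrow> 'n \<Rightarrow> 'n \<Rightarrow> real^'n \<Rightarrow> real" where
  "curvature_tensor f i j k l x =
     second_fundamental_form f i l x \<bullet> second_fundamental_form f j k x -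
     second_fundamental_form f i k x \<bullet> second_fundamental_form f j l x"

definition scalar_curvature :: "(real^'n::finite \<Rightarrow> real^'m::finite) \<Rightarrow> real^'n \<Rightarrow> real" where
  "scalar_curvature f x =
     (\<Sum>i\<in>UNIV. \<Sum>j\<in>UNIV. \<Sum>k\<in>UNIV. \<Sum>l\<in>UNIV.
        inverse_metric (induced_metric f) i l x * inverse_metric (induced_metric f) j k x
          * curvature_tensor f i j k l x)"

text \<open>The normal vectors $\eta^\alpha = (-Df^\alpha, e_\alpha)$.\<close>

definition normal_frame ::
    "(real^'n::finite \<Rightarrow> real^'m::finite) \<Rightarrow> 'm \<Rightarrow> real^'n \<Rightarrow> (real^'n) \<times> (real^'m)" where
  "normal_frame f \<alpha> x = (- (\<chi> i. partial i f x $ \<alpha>), axis \<alpha> 1)"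

text \<open>
  Tangent vectors are given by their components in the frame $\partial_1,\dots,\partial_n$.
  The shape operator is the matrix of $A^\alpha$ with $g(A^\alpha X, Y) = \langle B(X,Y), \eta^\alpha\rangle$,
  $B$ being the second fundamental form.
\<close>

definition shape_operator ::
    "(real^'n::finite \<Rightarrow> real^'m::finite) \<Rightarrow> 'm \<Rightarrow> real^'n \<Rightarrow> real^'n^'n" where
  "shape_operator f \<alpha> x =
     (\<chi> k j. \<Sum>i\<in>UNIV. inverse_metric (induced_metric f) k i x
                        * (second_fundamental_form f i j x \<bullet> normal_frame f \<alpha> x))"

definition metric_gradient ::
    "(real^'n::finite \<Rightarrow> real^'m::finite) \<Rightarrow> 'm \<Rightarrow> real^'n \<Rightarrow> real^'n" where
  "metric_gradient f \<alpha> x =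
     (\<chi> i. \<Sum>j\<in>UNIV. inverse_metric (induced_metric f) i j x * partial j f x $ \<alpha>)"

definition metric_inner :: "(real^'n::finite \<Rightarrow> real^'n^'n) \<Rightarrow> real^'n \<Rightarrow> real^'n \<Rightarrow> real^'n \<Rightarrow> real" where
  "metric_inner g x v w = (\<Sum>i\<in>UNIV. \<Sum>j\<in>UNIV. g x $ i $ j * v $ i * w $ j)"

text \<open>
  The sum over $\alpha,\beta$ of $\langle R^\perp(\nabla f^\alpha,\nabla f^\beta)\eta^\beta,\eta^\alpha\rangle$,
  the normal curvature being expressed by Ricci's equation, which makes sense for $C^2$ maps.
\<close>

definition S_perp :: "(real^'n::finite \<Rightarrow> real^'m::finite) \<Rightarrow> real^'n \<Rightarrow> real" where
  "S_perp f x =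
     (\<Sum>\<alpha>\<in>UNIV. \<Sum>\<beta>\<in>UNIV.
        metric_inner (induced_metric f) x
          (shape_operator f \<alpha> x *v metric_gradient f \<alpha> x) (shape_operator f \<beta> x *v metric_gradient f \<beta> x)
      - metric_inner (induced_metric f) x
          (shape_operator f \<alpha> x *v metric_gradient f \<beta> x) (shape_operator f \<beta> x *v metric_gradient f \<alpha> x))"

definition graph_volume :: "(real^'n::finite \<Rightarrow> real^'m::finite) \<Rightarrow> (real^'n) measure" where
  "graph_volume f = density lborel (\<lambda>x. ennreal (sqrt (det (induced_metric f x))))"


section \<open>Asymptotic flatness\<close>

definition asymptotically_flat :: "(real^'n::finite \<Rightarrow> real^'m::finite) \<Rightarrow> bool" where
  "asymptotically_flat f \<longleftrightarrow>
     C2_map f \<and>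
     integrable lborel (scalar_curvature f) \<and>
     (\<exists>p > (real CARD('n) - 2) / 2.
        (\<forall>\<alpha> i. (\<lambda>x. partial i f x $ \<alpha>) \<in> O[at_infinity](\<lambda>x. norm x powr (- p / 2))) \<and>
        (\<forall>\<alpha> i j. (\<lambda>x. partial j (partial i f) x $ \<alpha>) \<in> O[at_infinity](\<lambda>x. norm x powr (- p / 2 - 1))))"


section \<open>Area measure of spheres and the ADM mass\<close>

text \<open>
  The area of a Borel subset \<open>A\<close> of the sphere of radius \<open>r\<close> is \<open>n / r\<close> times the volume of the cone
  \<open>{t *\<^sub>R x |t x. x \<in> A \<and> 0 < t \<and> t \<le> 1}\<close> over it.  Accordingly, the area measure is \<open>n / r\<close> times
  the image of Lebesgue measure on the ball under the radial projection onto the sphere.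
\<close>

definition sphere_area :: "real \<Rightarrow> (real^'n::finite) measure" where
  "sphere_area r =
     distr (density lborel (\<lambda>x. ennreal (real CARD('n) / r) * indicator (cball 0 r) x)) borel
       (\<lambda>x. (r / norm x) *\<^sub>R x)"

text \<open>The dimension is passed by a type argument: the value is $\omega_{n-1}$ for \<open>n = CARD('n)\<close>.\<close>

definition unit_sphere_vol :: "'n::finite itself \<Rightarrow> real" where
  "unit_sphere_vol _ = measure (sphere_area 1 :: (real^'n) measure) (sphere 0 1)"

lemma unit_sphere_vol_eq: "unit_sphere_vol TYPE('n::finite) = real CARD('n) * unit_ball_vol (real CARD('n))"
proof -
  let ?n = "real CARD('n)" and ?c = "cball 0 1 :: (real^'n) set"
  have m: "(\<lambda>x::real^'n. (1 / norm x) *\<^sub>R x) \<in> borel_measurable borel"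
    by measurable
  let ?A = "(\<lambda>x::real^'n. (1 / norm x) *\<^sub>R x) -` sphere 0 1"
  have A: "?A = - {0}"
    by auto
  have "emeasure (sphere_area 1) (sphere (0::real^'n) 1) =
      emeasure (density lborel (\<lambda>x. ennreal ?n * indicator ?c x)) (- {0})"
    unfolding sphere_area_def using m by (subst emeasure_distr) (simp_all add: A)
  also have "\<dots> = (\<integral>\<^sup>+x. ennreal ?n * indicator (?c - {0}) x \<partial>lborel)"
    by (subst emeasure_density) (auto intro!: nn_integral_cong borel_measurable_times_ennreal borel_measurable_indicator split: split_indicator)
  also have "\<dots> = ennreal ?n * emeasure lborel ?c"
    using emeasure_Diff_null_set[of "{0}" lborel ?c]
    by (simp add: nn_integral_cmult_indicator null_sets_def)
  also have "\<dots> = ennreal (?n * unit_ball_vol ?n)"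
    by (simp add: emeasure_cball ennreal_mult)
  finally show ?thesis
    by (simp add: unit_sphere_vol_def measure_def)
qed

definition adm_flux :: "(real^'n::finite \<Rightarrow> real^'n^'n) \<Rightarrow> real \<Rightarrow> real" where
  "adm_flux g r =
     1 / (2 * (real CARD('n) - 1) * unit_sphere_vol TYPE('n)) *
     (LINT x:sphere 0 r|sphere_area r.
        \<Sum>i\<in>UNIV. \<Sum>j\<in>UNIV.
          (partial i (\<lambda>y. g y $ i $ j) x - partial j (\<lambda>y. g y $ i $ i) x) * (x $ j / r))"

definition adm_mass :: "(real^'n::finite \<Rightarrow> real^'n^'n) \<Rightarrow> real" where
  "adm_mass g = Lim at_top (adm_flux g)"


section \<open>The scalar curvature of the graph of a \<open>C\<^sup>3\<close> map is that of its metric\<close>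

definition christoffel :: "(real^'n::finite \<Rightarrow> real^'n^'n) \<Rightarrow> 'n \<Rightarrow> 'n \<Rightarrow> 'n \<Rightarrow> real^'n \<Rightarrow> real" where
  "christoffel g k i j x =
     (\<Sum>l\<in>UNIV. inverse_metric g k l x *
        ((partial i (\<lambda>y. g y $ j $ l) x + partial j (\<lambda>y. g y $ i $ l) x - partial l (\<lambda>y. g y $ i $ j) x) / 2))"

text \<open>The coefficient of $\partial_l$ in $R(\partial_i,\partial_j)\partial_k$.\<close>

definition intrinsic_curvature ::
    "(real^'n::finite \<Rightarrow> real^'n^'n) \<Rightarrow> 'n \<Rightarrow> 'n \<Rightarrow> 'n \<Rightarrow> 'n \<Rightarrow> real^'n \<Rightarrow> real" where
  "intrinsic_curvature g l i j k x =
     partial i (christoffel g l j k) x - partial j (christoffel g l i k) x +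
     (\<Sum>p\<in>UNIV. christoffel g l i p x * christoffel g p j k x - christoffel g l j p x * christoffel g p i k x)"

definition intrinsic_scalar_curvature :: "(real^'n::finite \<Rightarrow> real^'n^'n) \<Rightarrow> real^'n \<Rightarrow> real" where
  "intrinsic_scalar_curvature g x =
     (\<Sum>i\<in>UNIV. \<Sum>j\<in>UNIV. \<Sum>k\<in>UNIV. inverse_metric g j k x * intrinsic_curvature g i i j k x)"

lemma partial_eqI:
  assumes "(\<phi> has_derivative \<phi>') (at x)"
  shows "partial i \<phi> x = \<phi>' (axis i 1)"
  unfolding partial_def using frechet_derivative_at[OF assms] by simp

lemma has_derivative_partial:
  assumes "\<phi> differentiable (at x)"
  shows "(\<phi> has_derivative frechet_derivative \<phi> (at x)) (at x)"
  using assms frechet_derivative_works by blast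

lemma partial_inner:
  fixes \<phi> \<psi> :: "real^'n::finite \<Rightarrow> 'b::real_inner"
  assumes "\<phi> differentiable (at x)" "\<psi> differentiable (at x)"
  shows "partial i (\<lambda>y. \<phi> y \<bullet> \<psi> y) x = \<phi> x \<bullet> partial i \<psi> x + partial i \<phi> x \<bullet> \<psi> x"
  by (subst partial_eqI[OF has_derivative_inner[OF has_derivative_partial[OF assms(1)] has_derivative_partial[OF assms(2)]]])
     (simp add: partial_def)

lemma partial_inner_const:
  fixes \<phi> :: "real^'n::finite \<Rightarrow> 'b::real_inner"
  assumes "\<phi> differentiable (at x)"
  shows "partial i (\<lambda>y. \<phi> y \<bullet> b) x = partial i \<phi> x \<bullet> b"
  by (subst partial_eqI[OF has_derivative_inner_left[OF has_derivative_partial[OF assms]]])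
     (simp add: partial_def)

lemma partial_sum_mult:
  fixes u v :: "'k \<Rightarrow> real^'n::finite \<Rightarrow> real"
  assumes "\<And>k. u k differentiable (at x)" "\<And>k. v k differentiable (at x)"
  shows "partial i (\<lambda>y. \<Sum>k\<in>K. u k y * v k y) x = (\<Sum>k\<in>K. u k x * partial i (v k) x + partial i (u k) x * v k x)"
proof -
  have "((\<lambda>y. \<Sum>k\<in>K. u k y * v k y) has_derivative
     (\<lambda>h. \<Sum>k\<in>K. u k x * frechet_derivative (v k) (at x) h + frechet_derivative (u k) (at x) h * v k x)) (at x)"
    by (intro has_derivative_sum has_derivative_mult has_derivative_partial assms)
  then show ?thesis
    by (subst partial_eqI, assumption) (simp add: partial_def)
qed

lemma partial_Pair_const:
  fixes \<phi> :: "real^'n::finite \<Rightarrow> 'b::real_normed_vector"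
  assumes "\<phi> differentiable (at x)"
  shows "partial i (\<lambda>y. (c, \<phi> y)) x = (0, partial i \<phi> x)"
  by (subst partial_eqI[OF has_derivative_Pair[OF has_derivative_const has_derivative_partial[OF assms]]])
     (simp add: partial_def)

lemma C1_map_Pair_const:
  fixes \<phi> :: "real^'n::finite \<Rightarrow> 'b::real_normed_vector" and c :: "'c::real_normed_vector"
  assumes "C1_map \<phi>"
  shows "C1_map (\<lambda>y. (c, \<phi> y))"
proof -
  have d: "\<phi> differentiable (at x)" for x
    using assms by (simp add: C1_map_def)
  have "(\<lambda>y. (c, \<phi> y)) differentiable (at x)" for x
    using has_derivative_Pair[OF has_derivative_const has_derivative_partial[OF d]] differentiable_def by blast
  moreover have "partial i (\<lambda>y. (c, \<phi> y)) = (\<lambda>x. (0, partial i \<phi> x))" for i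
    using partial_Pair_const[OF d] by blast
  ultimately show ?thesis
    using assms by (auto simp: C1_map_def intro!: continuous_on_Pair)
qed

lemma C1_map_inner_const:
  fixes \<phi> :: "real^'n::finite \<Rightarrow> 'b::real_inner"
  assumes "C1_map \<phi>"
  shows "C1_map (\<lambda>y. \<phi> y \<bullet> b)"
proof -
  have d: "\<phi> differentiable (at x)" for x
    using assms by (simp add: C1_map_def)
  have "(\<lambda>y. \<phi> y \<bullet> b) differentiable (at x)" for x
    using has_derivative_inner_left[OF has_derivative_partial[OF d]] differentiable_def by blast
  moreover have "partial i (\<lambda>y. \<phi> y \<bullet> b) = (\<lambda>x. partial i \<phi> x \<bullet> b)" for i
    using partial_inner_const[OF d] by blast
  ultimately show ?thesis
    using assms by (auto simp: C1_map_def intro!: continuous_intros)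
qed

lemma has_real_derivative_along_axis:
  fixes \<phi> :: "real^'n::finite \<Rightarrow> real"
  assumes "\<And>y. \<phi> differentiable (at y)"
  shows "((\<lambda>t. \<phi> (a + t *\<^sub>R axis i 1)) has_real_derivative partial i \<phi> (a + t *\<^sub>R axis i 1)) (at t)"
proof -
  have "((\<lambda>t. \<phi> (a + t *\<^sub>R axis i 1)) has_derivative
      (\<lambda>h. frechet_derivative \<phi> (at (a + t *\<^sub>R axis i 1)) (h *\<^sub>R axis i 1))) (at t)"
    by (rule has_derivative_compose[OF _ has_derivative_partial[OF assms]])
       (auto intro!: derivative_eq_intros)
  moreover have "linear (frechet_derivative \<phi> (at (a + t *\<^sub>R axis i 1)))"
    using has_derivative_partial[OF assms] has_derivative_linear by blast
  ultimately show ?thesis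
    by (simp add: has_field_derivative_def partial_def linear_scale mult_commute_abs)
qed

lemma second_difference:
  fixes \<phi> :: "real^'n::finite \<Rightarrow> real"
  assumes "C2_map \<phi>" "h > 0"
  shows "\<exists>s t. 0 < s \<and> s < h \<and> 0 < t \<and> t < h \<and>
    \<phi> (x + h *\<^sub>R axis i 1 + h *\<^sub>R axis j 1) - \<phi> (x + h *\<^sub>R axis i 1) - \<phi> (x + h *\<^sub>R axis j 1) + \<phi> x
      = h * h * partial j (partial i \<phi>) (x + s *\<^sub>R axis i 1 + t *\<^sub>R axis j 1)"
proof -
  let ?e = "axis i 1 :: real^'n" and ?e' = "axis j 1 :: real^'n"
  have d: "\<And>y. \<phi> differentiable (at y)" and d': "\<And>y. partial i \<phi> differentiable (at y)"
    using assms(1) by (auto simp: C2_map_def C1_map_def)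
  define u where "u = (\<lambda>s. \<phi> ((x + h *\<^sub>R ?e') + s *\<^sub>R ?e) - \<phi> (x + s *\<^sub>R ?e))"
  have "(u has_real_derivative
      partial i \<phi> ((x + h *\<^sub>R ?e') + s *\<^sub>R ?e) - partial i \<phi> (x + s *\<^sub>R ?e)) (at s)" for s
    unfolding u_def by (intro derivative_intros has_real_derivative_along_axis d)
  from MVT2[OF assms(2), of u, OF this] obtain s where s: "0 < s" "s < h"
    "u h - u 0 = h * (partial i \<phi> ((x + h *\<^sub>R ?e') + s *\<^sub>R ?e) - partial i \<phi> (x + s *\<^sub>R ?e))"
    by auto
  from MVT2[OF assms(2), of "\<lambda>t. partial i \<phi> ((x + s *\<^sub>R ?e) + t *\<^sub>R ?e')",
      OF has_real_derivative_along_axis[OF d']]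
  obtain t where t: "0 < t" "t < h"
    "partial i \<phi> ((x + s *\<^sub>R ?e) + h *\<^sub>R ?e') - partial i \<phi> (x + s *\<^sub>R ?e)
       = h * partial j (partial i \<phi>) ((x + s *\<^sub>R ?e) + t *\<^sub>R ?e')"
    by auto
  show ?thesis
    using s t by (intro exI[of _ s] exI[of _ t]) (simp add: u_def algebra_simps)
qed

lemma partial_commute_real:
  fixes \<phi> :: "real^'n::finite \<Rightarrow> real"
  assumes "C2_map \<phi>"
  shows "partial i (partial j \<phi>) x = partial j (partial i \<phi>) x"
proof -
  have lim: "\<exists>S. (S \<longlongrightarrow> partial b (partial a \<phi>) x) (at_right 0) \<and>
      (\<forall>h>0. \<phi> (x + h *\<^sub>R axis a 1 + h *\<^sub>R axis b 1) - \<phi> (x + h *\<^sub>R axis a 1) - \<phi> (x + h *\<^sub>R axis b 1) + \<phi> x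
        = h * h * S h)" for a b
  proof -
    obtain s t where st: "\<And>h. h > 0 \<Longrightarrow> 0 < s h \<and> s h < h \<and> 0 < t h \<and> t h < h \<and>
       \<phi> (x + h *\<^sub>R axis a 1 + h *\<^sub>R axis b 1) - \<phi> (x + h *\<^sub>R axis a 1) - \<phi> (x + h *\<^sub>R axis b 1) + \<phi> x
      = h * h * partial b (partial a \<phi>) (x + s h *\<^sub>R axis a 1 + t h *\<^sub>R axis b 1)"
      using second_difference[OF assms, of _ x a b] by metis
    have id0: "((\<lambda>h::real. h) \<longlongrightarrow> 0) (at_right 0)"
      by (rule tendsto_ident_at)
    have "(s \<longlongrightarrow> 0) (at_right 0)" "(t \<longlongrightarrow> 0) (at_right 0)"
      by (rule tendsto_sandwich[OF _ _ tendsto_const id0];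
          use st in \<open>force simp: eventually_at_filter intro: always_eventually\<close>)+
    then have "((\<lambda>h. x + s h *\<^sub>R axis a 1 + t h *\<^sub>R axis b 1) \<longlongrightarrow> x + 0 *\<^sub>R axis a 1 + 0 *\<^sub>R axis b 1) (at_right 0)"
      by (intro tendsto_intros)
    moreover have "isCont (partial b (partial a \<phi>)) x"
      using assms by (auto simp: C2_map_def C1_map_def continuous_on_eq_continuous_at)
    ultimately have "((\<lambda>h. partial b (partial a \<phi>) (x + s h *\<^sub>R axis a 1 + t h *\<^sub>R axis b 1))
        \<longlongrightarrow> partial b (partial a \<phi>) x) (at_right 0)"
      using isCont_tendsto_compose by fastforce
    then show ?thesis using st by blast
  qed
  obtain S where S: "(S \<longlongrightarrow> partial j (partial i \<phi>) x) (at_right 0)"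
    "\<And>h. h > 0 \<Longrightarrow> \<phi> (x + h *\<^sub>R axis i 1 + h *\<^sub>R axis j 1) - \<phi> (x + h *\<^sub>R axis i 1) - \<phi> (x + h *\<^sub>R axis j 1) + \<phi> x
        = h * h * S h"
    using lim[where a=i and b=j] by blast
  obtain T where T: "(T \<longlongrightarrow> partial i (partial j \<phi>) x) (at_right 0)"
    "\<And>h. h > 0 \<Longrightarrow> \<phi> (x + h *\<^sub>R axis j 1 + h *\<^sub>R axis i 1) - \<phi> (x + h *\<^sub>R axis j 1) - \<phi> (x + h *\<^sub>R axis i 1) + \<phi> x
        = h * h * T h"
    using lim[where a=j and b=i] by blast
  have "S h = T h" if "h > 0" for h
  proof -
    have "h * h * S h = h * h * T h"
      using S(2)[OF that] T(2)[OF that] by (simp add: algebra_simps)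
    then show ?thesis using that by simp
  qed
  then have "\<forall>\<^sub>F h in at_right 0. T h = S h"
    by (auto simp: eventually_at_filter)
  then have "(S \<longlongrightarrow> partial i (partial j \<phi>) x) (at_right 0)"
    using T(1) tendsto_cong by blast
  then show ?thesis
    using S(1) tendsto_unique trivial_limit_at_right_real by blast
qed

lemma partial_commute:
  fixes \<phi> :: "real^'n::finite \<Rightarrow> 'b::real_inner"
  assumes "C2_map \<phi>"
  shows "partial i (partial j \<phi>) x = partial j (partial i \<phi>) x"
proof -
  have d: "\<And>y. \<phi> differentiable (at y)" and d': "\<And>k y. partial k \<phi> differentiable (at y)"
    and c: "C1_map \<phi>" "\<And>k. C1_map (partial k \<phi>)"
    using assms by (auto simp: C2_map_def C1_map_def)
  have p: "partial k (\<lambda>y. \<phi> y \<bullet> b) = (\<lambda>y. partial k \<phi> y \<bullet> b)" for k b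
    using partial_inner_const[OF d] by blast
  have "partial i (partial j \<phi>) x \<bullet> b = partial j (partial i \<phi>) x \<bullet> b" for b
  proof -
    have "C2_map (\<lambda>y. \<phi> y \<bullet> b)"
      unfolding C2_map_def p using C1_map_inner_const c by blast
    from partial_commute_real[OF this, of i j x] show ?thesis
      by (simp add: p partial_inner_const d')
  qed
  then show ?thesis by (metis vector_eq_rdot)
qed

lemma partial_graph_map:
  assumes "f differentiable (at x)"
  shows "partial i (graph_map f) x = (axis i 1, partial i f x)"
  unfolding graph_map_def
  by (subst partial_eqI[OF has_derivative_Pair[OF has_derivative_ident has_derivative_partial[OF assms]]])
     (simp add: partial_def)

lemma induced_metric_eq:
  fixes f :: "real^'n::finite \<Rightarrow> real^'m::finite"
  assumes "f differentiable (at x)"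
  shows "induced_metric f x $ i $ j =
    (if i = j then 1 else 0) + (\<Sum>\<alpha>\<in>UNIV. partial i f x $ \<alpha> * partial j f x $ \<alpha>)"
  by (simp add: induced_metric_def tangent_frame_def partial_graph_map[OF assms] inner_axis_axis
      inner_vec_def[of "partial i f x"])

lemma invertible_induced_metric:
  fixes f :: "real^'n::finite \<Rightarrow> real^'m::finite"
  assumes "f differentiable (at x)"
  shows "invertible (induced_metric f x)"
proof -
  let ?g = "induced_metric f x"
  have "v = 0" if "?g *v v = 0" for v
  proof -
    have "0 = v \<bullet> (?g *v v)" using that by simp
    also have "\<dots> = (\<Sum>i\<in>UNIV. v $ i *\<^sub>R tangent_frame f i x) \<bullet> (\<Sum>j\<in>UNIV. v $ j *\<^sub>R tangent_frame f j x)"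
      by (simp add: inner_vec_def matrix_vector_mult_def induced_metric_def inner_sum_left inner_sum_right
          sum_distrib_left mult_ac inner_commute)
    finally have "(\<Sum>i\<in>UNIV. v $ i *\<^sub>R tangent_frame f i x) = 0" by simp
    then have "(\<Sum>i\<in>UNIV. v $ i *\<^sub>R (axis i 1 :: real^'n)) = 0"
      by (simp add: tangent_frame_def partial_graph_map[OF assms] prod_eq_iff fst_sum)
    then show "v = 0"
      using basis_expansion[of v] by (simp add: scalar_mult_eq_scaleR)
  qed
  then show ?thesis
    using matrix_left_invertible_ker invertible_left_inverse by blast
qed

lemma matrix_inv_props:
  fixes A :: "real^'n::finite^'n"
  assumes "invertible A"
  shows "A ** matrix_inv A = mat 1" "matrix_inv A ** A = mat 1"
  using someI_ex[of "\<lambda>B. A ** B = mat 1 \<and> B ** A = mat 1"] assms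
  unfolding invertible_def matrix_inv_def by auto

lemma det_differentiable:
  fixes A :: "real^'k::finite \<Rightarrow> real^'n::finite^'n"
  assumes "\<And>i j. (\<lambda>y. A y $ i $ j) differentiable (at x)"
  shows "(\<lambda>y. det (A y)) differentiable (at x)"
  unfolding det_def
  by (intro differentiable_sum ballI differentiable_mult differentiable_const)
     (auto intro!: has_derivative_prod[THEN differentiableI] has_derivative_partial assms)

theorem scalar_curvature_eq_intrinsic:
  fixes f :: "real^'n::finite \<Rightarrow> real^'m::finite"
  assumes "C2_map f" and "\<And>i. C2_map (partial i f)"
  shows "scalar_curvature f x = intrinsic_scalar_curvature (induced_metric f) x"
proof -
  let ?g = "induced_metric f"
  let ?ginv = "inverse_metric ?g"
  let ?\<Gamma> = "christoffel ?g"
  define E where "E = tangent_frame f"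
  define D where "D = (\<lambda>i j. partial i (E j))"
  have C1: "C1_map f" "\<And>i. C1_map (partial i f)" "\<And>i j. C1_map (partial i (partial j f))"
    using assms by (auto simp: C2_map_def)
  then have d: "\<And>y. f differentiable (at y)" "\<And>i y. partial i f differentiable (at y)"
    by (auto simp: C1_map_def)
  have E: "E j = (\<lambda>y. (axis j 1, partial j f y))" for j
    using partial_graph_map[OF d(1)] by (auto simp: E_def tangent_frame_def)
  have D: "D i j = (\<lambda>y. (0, partial i (partial j f) y))" for i j
    unfolding D_def E using partial_Pair_const[OF d(2)] by blast
  have C2E: "C2_map (E j)" for j
  proof -
    have "partial i (E j) = D i j" for i
      by (simp add: D_def)
    then show ?thesis
      unfolding C2_map_def by (simp add: D) (simp add: E C1_map_Pair_const C1)
  qed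
  have dE: "\<And>i y. E i differentiable (at y)" and dD: "\<And>i j y. D i j differentiable (at y)"
    using C2E by (auto simp: C2_map_def C1_map_def D_def)
  have D_sym: "D i j = D j i" for i j
    unfolding D using partial_commute[OF assms(1)] by blast
  have DD: "partial i (D j k) y = partial j (D i k) y" for i j k y
    unfolding D_def using partial_commute[OF C2E] .
  have g: "?g y $ i $ j = E i y \<bullet> E j y" for i j y
    by (simp add: induced_metric_def E_def)
  have dg: "(\<lambda>y. ?g y $ i $ j) differentiable (at y)" for i j y
    unfolding g using dE by (intro differentiable_inner)
  have pg: "partial k (\<lambda>y. ?g y $ i $ j) y = D k i y \<bullet> E j y + E i y \<bullet> D k j y" for i j k y
    unfolding g by (simp add: partial_inner dE D_def)
  have inv: "invertible (?g y)" for y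
    using invertible_induced_metric d(1) by blast
  have ginv_left: "(\<Sum>k\<in>UNIV. ?ginv i k y * ?g y $ k $ j) = (if i = j then 1 else 0)" for i j y
    using arg_cong[OF matrix_inv_props(2)[OF inv, of y], of "\<lambda>A. A $ i $ j"]
    by (simp add: matrix_matrix_mult_def mat_def inverse_metric_def)
  have ginv_right: "(\<Sum>k\<in>UNIV. ?g y $ i $ k * ?ginv k j y) = (if i = j then 1 else 0)" for i j y
    using arg_cong[OF matrix_inv_props(1)[OF inv, of y], of "\<lambda>A. A $ i $ j"]
    by (simp add: matrix_matrix_mult_def mat_def inverse_metric_def)
  have dginv: "?ginv i j differentiable (at y)" for i j y
  proof -
    have det: "det (?g z) \<noteq> 0" for z
      using inv invertible_det_nz by blast
    have "?g z *v (\<chi> k. ?ginv k j z) = axis j 1" for z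
      using ginv_right by (simp add: matrix_vector_mult_def vec_eq_iff axis_def)
    then have "?ginv i j z = det (\<chi> a b. if b = i then axis j 1 $ a else ?g z $ a $ b) / det (?g z)" for z
      using cramer[OF det, of z "\<chi> k. ?ginv k j z" "axis j 1"] by (simp add: vec_eq_iff)
    then have "?ginv i j =
        (\<lambda>z. det (\<chi> a b. if b = i then axis j 1 $ a else ?g z $ a $ b) / det (?g z))"
      by blast
    moreover have "(\<lambda>z. det (\<chi> a b. if b = i then axis j 1 $ a else ?g z $ a $ b) / det (?g z))
        differentiable (at y)"
    proof (intro differentiable_divide det_differentiable det dg)
      show "(\<lambda>z. (\<chi> a b. if b = i then axis j 1 $ a else ?g z $ a $ b) $ k $ l) differentiable (at y)" for k l
        using dg by (cases "l = i") simp_all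
    qed
    ultimately show ?thesis by simp
  qed
  have \<Gamma>_eq: "?\<Gamma> k i j y = (\<Sum>l\<in>UNIV. ?ginv k l y * (D i j y \<bullet> E l y))" for k i j y
  proof -
    have "(D i j y \<bullet> E l y + E j y \<bullet> D i l y + (D j i y \<bullet> E l y + E i y \<bullet> D j l y)
        - (D l i y \<bullet> E j y + E i y \<bullet> D l j y)) / 2 = D i j y \<bullet> E l y" for l
      by (simp add: D_sym[of j i] D_sym[of l i] D_sym[of l j] inner_commute)
    then show ?thesis
      unfolding christoffel_def pg by (simp only:)
  qed
  have d\<Gamma>: "?\<Gamma> k i j differentiable (at y)" for i j k y
    unfolding \<Gamma>_eq[abs_def]
    by (intro differentiable_sum ballI differentiable_mult dginv differentiable_inner dD dE) simp
  have lower: "(\<Sum>k\<in>UNIV. ?g y $ a $ k * ?\<Gamma> k i j y) = D i j y \<bullet> E a y" for a i j y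
  proof -
    have "(\<Sum>k\<in>UNIV. ?g y $ a $ k * ?\<Gamma> k i j y)
        = (\<Sum>k\<in>UNIV. \<Sum>l\<in>UNIV. ?g y $ a $ k * ?ginv k l y * (D i j y \<bullet> E l y))"
      by (simp add: \<Gamma>_eq sum_distrib_left mult.assoc)
    also have "\<dots> = (\<Sum>l\<in>UNIV. (\<Sum>k\<in>UNIV. ?g y $ a $ k * ?ginv k l y) * (D i j y \<bullet> E l y))"
      by (subst sum.swap) (simp add: sum_distrib_right)
    also have "\<dots> = D i j y \<bullet> E a y"
      by (simp add: ginv_right if_distrib[of "\<lambda>c. c * _"] cong: if_cong)
    finally show ?thesis .
  qed
  have lower_diff: "(\<Sum>k\<in>UNIV. ?g x $ a $ k * partial m (?\<Gamma> k i j) x)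
      = partial m (D i j) x \<bullet> E a x + D i j x \<bullet> D m a x
        - (\<Sum>k\<in>UNIV. (D m a x \<bullet> E k x + E a x \<bullet> D m k x) * ?\<Gamma> k i j x)" for a i j m
  proof -
    have "partial m (\<lambda>y. \<Sum>k\<in>UNIV. ?g y $ a $ k * ?\<Gamma> k i j y) x
        = (\<Sum>k\<in>UNIV. ?g x $ a $ k * partial m (?\<Gamma> k i j) x
             + partial m (\<lambda>y. ?g y $ a $ k) x * ?\<Gamma> k i j x)"
      by (rule partial_sum_mult) (auto intro: dg d\<Gamma>)
    moreover have "partial m (\<lambda>y. \<Sum>k\<in>UNIV. ?g y $ a $ k * ?\<Gamma> k i j y) x
        = D i j x \<bullet> D m a x + partial m (D i j) x \<bullet> E a x"
      unfolding lower using partial_inner[OF dD dE, of m i j a x] by (simp add: D_def)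
    ultimately show ?thesis
      by (simp add: pg sum.distrib)
  qed
  let ?B = "second_fundamental_form f"
  have B: "?B i j y = D i j y - (\<Sum>p\<in>UNIV. ?\<Gamma> p i j y *\<^sub>R E p y)" for i j y
    by (simp add: second_fundamental_form_def \<Gamma>_eq D_def E_def scaleR_sum_left)
  have B_normal: "?B i j y \<bullet> E a y = 0" for i j a y
    using lower[of y a i j]
    by (simp add: B inner_diff_left inner_sum_left g inner_commute[of "E a y" "E _ y"] mult.commute)
  have BB: "?B i j y \<bullet> ?B k l y = D i j y \<bullet> D k l y - (\<Sum>p\<in>UNIV. (D k l y \<bullet> E p y) * ?\<Gamma> p i j y)" for i j k l y
  proof -
    have "?B i j y \<bullet> ?B k l y = ?B i j y \<bullet> D k l y"
      by (subst B[of k l]) (simp add: inner_diff_right inner_sum_right B_normal)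
    also have "\<dots> = D i j y \<bullet> D k l y - (\<Sum>p\<in>UNIV. (D k l y \<bullet> E p y) * ?\<Gamma> p i j y)"
      by (simp add: B inner_diff_left inner_sum_left inner_commute[of "D k l y" "E _ y"] mult.commute)
    finally show ?thesis .
  qed
  have gauss: "(\<Sum>l\<in>UNIV. ?g x $ a $ l * intrinsic_curvature ?g l i j k x) = curvature_tensor f i j k a x"
    for a i j k
  proof -
    have quad: "(\<Sum>l\<in>UNIV. ?g x $ a $ l * (\<Sum>p\<in>UNIV. ?\<Gamma> l i p x * ?\<Gamma> p j k x - ?\<Gamma> l j p x * ?\<Gamma> p i k x))
       = (\<Sum>p\<in>UNIV. (E a x \<bullet> D i p x) * ?\<Gamma> p j k x) - (\<Sum>p\<in>UNIV. (E a x \<bullet> D j p x) * ?\<Gamma> p i k x)"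
    proof -
      have "(\<Sum>l\<in>UNIV. ?g x $ a $ l * (\<Sum>p\<in>UNIV. ?\<Gamma> l i p x * ?\<Gamma> p j k x - ?\<Gamma> l j p x * ?\<Gamma> p i k x))
          = (\<Sum>p\<in>UNIV. \<Sum>l\<in>UNIV. ?g x $ a $ l * ?\<Gamma> l i p x * ?\<Gamma> p j k x - ?g x $ a $ l * ?\<Gamma> l j p x * ?\<Gamma> p i k x)"
        by (subst sum.swap) (simp add: sum_distrib_left right_diff_distrib mult.assoc)
      also have "\<dots> = (\<Sum>p\<in>UNIV. (\<Sum>l\<in>UNIV. ?g x $ a $ l * ?\<Gamma> l i p x) * ?\<Gamma> p j k x
                          - (\<Sum>l\<in>UNIV. ?g x $ a $ l * ?\<Gamma> l j p x) * ?\<Gamma> p i k x)"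
        by (simp add: sum_subtractf sum_distrib_right)
      finally show ?thesis
        by (simp add: lower sum_subtractf inner_commute)
    qed
    have "(\<Sum>l\<in>UNIV. ?g x $ a $ l * intrinsic_curvature ?g l i j k x)
      = (\<Sum>l\<in>UNIV. ?g x $ a $ l * partial i (?\<Gamma> l j k) x) - (\<Sum>l\<in>UNIV. ?g x $ a $ l * partial j (?\<Gamma> l i k) x)
        + (\<Sum>l\<in>UNIV. ?g x $ a $ l * (\<Sum>p\<in>UNIV. ?\<Gamma> l i p x * ?\<Gamma> p j k x - ?\<Gamma> l j p x * ?\<Gamma> p i k x))"
      by (simp add: intrinsic_curvature_def distrib_left right_diff_distrib sum.distrib sum_subtractf)
    moreover have "curvature_tensor f i j k a x = ?B j k x \<bullet> ?B i a x - ?B i k x \<bullet> ?B j a x"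
      unfolding curvature_tensor_def by (simp only: inner_commute[of "?B i a x"])
    ultimately show ?thesis
      unfolding quad lower_diff BB
      by (simp add: DD[of i j k] sum.distrib distrib_right inner_commute)
  qed
  have raise: "intrinsic_curvature ?g l i j k x = (\<Sum>a\<in>UNIV. ?ginv l a x * curvature_tensor f i j k a x)" for l i j k
  proof -
    have "(\<Sum>a\<in>UNIV. ?ginv l a x * curvature_tensor f i j k a x)
        = (\<Sum>a\<in>UNIV. \<Sum>m\<in>UNIV. ?ginv l a x * ?g x $ a $ m * intrinsic_curvature ?g m i j k x)"
      by (simp add: gauss[symmetric] sum_distrib_left mult.assoc)
    also have "\<dots> = (\<Sum>m\<in>UNIV. (\<Sum>a\<in>UNIV. ?ginv l a x * ?g x $ a $ m) * intrinsic_curvature ?g m i j k x)"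
      by (subst sum.swap) (simp add: sum_distrib_right)
    also have "\<dots> = intrinsic_curvature ?g l i j k x"
      by (simp add: ginv_left if_distrib[of "\<lambda>c. c * _"] cong: if_cong)
    finally show ?thesis by simp
  qed
  show ?thesis
    by (simp add: scalar_curvature_def intrinsic_scalar_curvature_def raise sum_distrib_left mult_ac)
qed

end

theory Submission
  imports Defs
begin

text \<open>
  Write $G = g^{-1}$, let $Df^\alpha$ and $H^\alpha$ be the Euclidean gradient and Hessian of
  $f^\alpha$, and $\nabla f^\alpha = G\,Df^\alpha$.  The proof rests on the vector field
  $$Y^j = \sum_{\alpha,i,k} (G^{ik} \nabla^j f^\alpha - G^{jk} \nabla^i f^\alpha) f^\alpha_{ik}.$$
  The coefficient in brackets depends on first derivatives of $f$ only and is antisymmetric in $i,j$.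
  Hence the third derivatives of $f$ drop out of the divergence of $Y$.  What is left is quadratic in
  the Hessians, and expanding it gives exactly $S + S^\perp$ (\<open>divergence_algebra\<close>,
  \<open>divergence_eq_curvatures\<close>).  Since $dM / \sqrt G = dx$, the right-hand side of the mass formula is
  the integral of the divergence of $Y$ over $R^n$, that is, the limit of the fluxes of $Y$ through
  large spheres.

  The density in the ADM flux is obtained from $Y$ by replacing $G$ by the identity and $\nabla f$ by
  $Df$.  Both replacements cost $O(|Df|^2)$ relative to the term they act on, so that the two fields
  differ by $O(|Df|^3 |D^2 f|) = O(|x|^{-2p-1})$, while the area of the sphere of radius $r$ is of order
  $r^{n-1}$.  As $2p > n - 2$, the two fluxes have the same limit (\<open>flux_difference_bound\<close>,
  \<open>flux_tendsto\<close>).  The same exponents give $S^\perp = O(|x|^{-2p-2})$, which is integrable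
  (\<open>S_perp_integrable\<close>).

  For a map of class $C^2$ the field $Y$ is only continuous, so its divergence and the divergence
  theorem must be read weakly.  The cancellation of third derivatives becomes the identity
  $\int \partial_j\psi\, \partial_i u = \int \partial_i\psi\, \partial_j u$ for $u$ of class $C^1$ and $\psi$ Lipschitz with compact
  support (\<open>weak_cross_derivatives_eq\<close>): difference quotients commute exactly and can be moved from one
  factor to the other by translation invariance of Lebesgue measure, and one passes to the limit by
  dominated convergence.  Taking for $\psi$ the coefficient times a radial cutoff that falls linearly from
  1 to 0 on a shell, and letting the thickness of the shell tend to 0, turns this into the divergence
  theorem on balls (\<open>flux_antisymmetric_eq_integral_cball\<close>).
\<close>

section \<open>Difference quotients and the weak commutation of derivatives\<close>

lemma integrable_compact_support:
  fixes F :: "'a::euclidean_space \<Rightarrow> real"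
  assumes "continuous_on UNIV F" and supp: "\<And>x. F x \<noteq> 0 \<Longrightarrow> norm x \<le> R"
  shows "integrable lborel F"
proof -
  have "integrable lborel (\<lambda>x. indicator (cball 0 R) x *\<^sub>R F x)"
    using assms(1) by (intro borel_integrable_compact) (auto intro: continuous_on_subset)
  moreover have "(\<lambda>x. indicator (cball 0 R) x *\<^sub>R F x) = F"
    using supp by (force split: split_indicator)
  ultimately show ?thesis by simp
qed

lemma lborel_integral_translate:
  fixes F :: "'a::euclidean_space \<Rightarrow> real"
  assumes "F \<in> borel_measurable borel"
  shows "(\<integral>x. F (d + x) \<partial>lborel) = (\<integral>x. F x \<partial>lborel)"
  using integral_distr[of "(+) d" lborel borel F] assms by (simp add: lborel_distr_plus)

text \<open>
  Summation by parts for differences: the term with a shifted \<open>\<psi>\<close> is brought back by translating the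
  integration variable.  The point is the right-hand side, which is symmetric in \<open>c\<close> and \<open>d\<close>.
\<close>

lemma integral_difference_mult_difference:
  fixes \<psi> u :: "'a::euclidean_space \<Rightarrow> real"
  assumes \<psi>: "continuous_on UNIV \<psi>" and u: "continuous_on UNIV u"
    and supp: "\<And>x. \<psi> x \<noteq> 0 \<Longrightarrow> norm x \<le> R"
  shows "(\<integral>x. (\<psi> x - \<psi> (x - d)) * (u (x + c) - u x) \<partial>lborel)
    = (\<integral>x. \<psi> x * (u (x + c) + u (x + d) - u x - u (x + c + d)) \<partial>lborel)"
proof -
  have c': "continuous_on UNIV (\<lambda>x. \<psi> (g x))" "continuous_on UNIV (\<lambda>x. u (g x))"
    if "continuous_on UNIV g" for g
    using continuous_on_compose2[OF \<psi> that] continuous_on_compose2[OF u that] by auto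
  have i1: "integrable lborel (\<lambda>x. \<psi> x * (u (x + c) - u x))"
    by (rule integrable_compact_support[of _ R]) (auto intro!: continuous_intros c' supp)
  have i2: "integrable lborel (\<lambda>x. \<psi> (x - d) * (u (x + c) - u x))"
  proof (rule integrable_compact_support[of _ "R + norm d"])
    show "continuous_on UNIV (\<lambda>x. \<psi> (x - d) * (u (x + c) - u x))"
      by (intro continuous_intros c')
    fix x assume "\<psi> (x - d) * (u (x + c) - u x) \<noteq> 0"
    then have "norm (x - d) \<le> R" using supp by auto
    then show "norm x \<le> R + norm d" using norm_triangle_sub[of x d] by simp
  qed
  have i3: "integrable lborel (\<lambda>x. \<psi> x * (u (x + c + d) - u (x + d)))"
    by (rule integrable_compact_support[of _ R]) (auto intro!: continuous_intros c' supp)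
  have m: "(\<lambda>x. \<psi> (x - d) * (u (x + c) - u x)) \<in> borel_measurable borel"
    using i2 by (simp add: borel_measurable_integrable)
  have shift: "(\<integral>x. \<psi> (x - d) * (u (x + c) - u x) \<partial>lborel)
      = (\<integral>x. \<psi> x * (u (x + c + d) - u (x + d)) \<partial>lborel)"
    using lborel_integral_translate[OF m, of d] by (simp add: add_ac)
  have "(\<integral>x. (\<psi> x - \<psi> (x - d)) * (u (x + c) - u x) \<partial>lborel)
      = (\<integral>x. \<psi> x * (u (x + c) - u x) \<partial>lborel) - (\<integral>x. \<psi> x * (u (x + c + d) - u (x + d)) \<partial>lborel)"
    unfolding shift[symmetric] Bochner_Integration.integral_diff[OF i1 i2, symmetric]
    by (simp add: algebra_simps)
  also have "\<dots> = (\<integral>x. \<psi> x * (u (x + c) + u (x + d) - u x - u (x + c + d)) \<partial>lborel)"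
    unfolding Bochner_Integration.integral_diff[OF i1 i3, symmetric] by (simp add: algebra_simps)
  finally show ?thesis .
qed

lemma tendsto_difference_quotient:
  fixes w :: "'a::real_normed_vector \<Rightarrow> real"
  assumes "((\<lambda>t. w (x + t *\<^sub>R e)) has_real_derivative d) (at 0)" and "h \<longlonglongrightarrow> 0" "\<And>k. h k \<noteq> (0::real)"
  shows "(\<lambda>k. (w (x + h k *\<^sub>R e) - w x) / h k) \<longlonglongrightarrow> d"
proof -
  have "(\<lambda>t. (w (x + t *\<^sub>R e) - w x) / t) \<midarrow>0\<rightarrow> d"
    using assms(1) by (simp add: has_field_derivative_iff)
  moreover have "filterlim h (at 0) sequentially"
    using assms(2,3) by (simp add: filterlim_at)
  ultimately show ?thesis
    by (rule filterlim_compose)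
qed

text \<open>
  The Lipschitz bounds on \<open>\<psi>\<close> and, near the support of \<open>\<psi>\<close>, on \<open>u\<close> make all the products of
  difference quotients bounded by one multiple of the indicator of a ball.
\<close>

lemma difference_quotients_converge:
  fixes \<psi> u :: "'a::euclidean_space \<Rightarrow> real" and h :: "nat \<Rightarrow> real"
  assumes \<psi>: "L-lipschitz_on UNIV \<psi>" and supp: "\<And>x. \<psi> x \<noteq> 0 \<Longrightarrow> norm x \<le> R"
    and \<psi>b: "AE x in lborel. ((\<lambda>t. \<psi> (x + t *\<^sub>R b)) has_real_derivative \<psi>b x) (at 0)"
    and \<psi>b_m: "\<psi>b \<in> borel_measurable borel"
    and u: "continuous_on UNIV u" "\<And>r. \<exists>K. K-lipschitz_on (cball 0 r) u"
    and ua: "\<And>x. ((\<lambda>t. u (x + t *\<^sub>R a)) has_real_derivative ua x) (at 0)"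
    and ua_m: "ua \<in> borel_measurable borel"
    and h: "h \<longlonglongrightarrow> 0" "\<And>k. 0 < h k" "\<And>k. h k \<le> 1"
  shows "(\<lambda>k. \<integral>x. (\<psi> x - \<psi> (x - h k *\<^sub>R b)) / h k * ((u (x + h k *\<^sub>R a) - u x) / h k) \<partial>lborel)
          \<longlonglongrightarrow> (\<integral>x. \<psi>b x * ua x \<partial>lborel)"
proof -
  let ?s = "\<lambda>k x. (\<psi> x - \<psi> (x - h k *\<^sub>R b)) / h k * ((u (x + h k *\<^sub>R a) - u x) / h k)"
  \<comment> \<open>For steps of length at most 1, the shifted function is supported in this larger ball.\<close>
  define R' where "R' = R + norm b"
  obtain K where K: "K-lipschitz_on (cball 0 (R' + norm a)) u" using u(2) by blast
  have K0: "0 \<le> K" and L0: "0 \<le> L" using K \<psi> by (auto simp: lipschitz_on_def)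
  have "continuous_on UNIV \<psi>" using \<psi> by (rule lipschitz_on_continuous_on)
  then have m: "\<psi> \<in> borel_measurable borel" "u \<in> borel_measurable borel"
    using u(1) by (auto intro: borel_measurable_continuous_onI)
  define w where "w = (\<lambda>x. indicator (cball (0::'a) R') x * (L * norm b * (K * norm a)) :: real)"
  have w: "integrable lborel w"
    unfolding w_def using emeasure_lborel_cball_finite[of "0::'a" R']
    by (intro integrable_mult_left) (auto simp: integrable_indicator_iff)
  have s_m: "?s k \<in> borel_measurable lborel" for k
    using m by measurable
  have bound: "norm (?s k x) \<le> w x" for k x
  proof (cases "\<psi> x = 0 \<and> \<psi> (x - h k *\<^sub>R b) = 0")
    case True
    then show ?thesis using K0 L0 by (simp add: w_def)
  next
    case False
    have hb: "norm (h k *\<^sub>R c) \<le> norm c" for c :: 'a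
      using h(2,3)[of k] by (simp add: mult_left_le_one_le)
    have xR: "norm x \<le> R'"
    proof (cases "\<psi> x = 0")
      case True
      with False have "norm (x - h k *\<^sub>R b) \<le> R" using supp by blast
      then show ?thesis using hb[of b] norm_triangle_sub[of x "h k *\<^sub>R b"] by (simp add: R'_def)
    next
      case False
      then show ?thesis using supp[of x] by (simp add: R'_def add_increasing2)
    qed
    have "norm (x + h k *\<^sub>R a) \<le> R' + norm a"
      using xR hb[of a] norm_triangle_ineq[of x "h k *\<^sub>R a"] by linarith
    then have "dist (u (x + h k *\<^sub>R a)) (u x) \<le> K * dist (x + h k *\<^sub>R a) x"
      using xR by (intro lipschitz_onD[OF K]) (auto simp: add_increasing2)
    then have 2: "\<bar>(u (x + h k *\<^sub>R a) - u x) / h k\<bar> \<le> K * norm a"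
      using h(2)[of k] by (simp add: dist_norm field_simps abs_if split: if_splits)
    have "dist (\<psi> x) (\<psi> (x - h k *\<^sub>R b)) \<le> L * dist x (x - h k *\<^sub>R b)"
      by (intro lipschitz_onD[OF \<psi>]) auto
    then have 1: "\<bar>(\<psi> x - \<psi> (x - h k *\<^sub>R b)) / h k\<bar> \<le> L * norm b"
      using h(2)[of k] by (simp add: dist_norm field_simps abs_if split: if_splits)
    have "norm (?s k x) \<le> (L * norm b) * (K * norm a)"
      unfolding real_norm_def abs_mult by (rule mult_mono[OF 1 2]) (use L0 in auto)
    then show ?thesis using xR by (simp add: w_def)
  qed
  have lim: "AE x in lborel. (\<lambda>k. ?s k x) \<longlonglongrightarrow> \<psi>b x * ua x"
    using \<psi>b
  proof eventually_elim
    case (elim x)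
    have "(\<lambda>k. (\<psi> (x + (- h k) *\<^sub>R b) - \<psi> x) / (- h k)) \<longlonglongrightarrow> \<psi>b x"
    proof (rule tendsto_difference_quotient[OF elim])
      show "(\<lambda>k. - h k) \<longlonglongrightarrow> 0" using tendsto_minus[OF h(1)] by simp
      show "- h k \<noteq> 0" for k using h(2)[of k] by simp
    qed
    moreover have "(\<psi> (x + (- h k) *\<^sub>R b) - \<psi> x) / (- h k) = (\<psi> x - \<psi> (x - h k *\<^sub>R b)) / h k" for k
      by (simp add: diff_divide_distrib)
    ultimately have "(\<lambda>k. (\<psi> x - \<psi> (x - h k *\<^sub>R b)) / h k) \<longlonglongrightarrow> \<psi>b x"
      by simp
    moreover have "(\<lambda>k. (u (x + h k *\<^sub>R a) - u x) / h k) \<longlonglongrightarrow> ua x"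
    proof (rule tendsto_difference_quotient[OF ua h(1)])
      show "h k \<noteq> 0" for k using h(2)[of k] by simp
    qed
    ultimately show ?case by (rule tendsto_mult)
  qed
  have lm: "(\<lambda>x. \<psi>b x * ua x) \<in> borel_measurable lborel"
    using \<psi>b_m ua_m by simp
  show ?thesis by (rule integral_dominated_convergence[OF lm s_m w lim]) (use bound in auto)
qed

text \<open>
  The weak form of the symmetry of second derivatives: both sides would equal minus the integral of
  \<open>\<psi>\<close> times the mixed second derivative of \<open>u\<close>, which need not exist.  The discrete counterparts of the
  two sides agree for every step length, by \<open>integral_difference_mult_difference\<close>.
\<close>

lemma weak_cross_derivatives_eq:
  fixes \<psi> u :: "'a::euclidean_space \<Rightarrow> real"
  assumes \<psi>: "L-lipschitz_on UNIV \<psi>" and supp: "\<And>x. \<psi> x \<noteq> 0 \<Longrightarrow> norm x \<le> R"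
    and \<psi>a: "AE x in lborel. ((\<lambda>t. \<psi> (x + t *\<^sub>R a)) has_real_derivative \<psi>a x) (at 0)"
    and \<psi>b: "AE x in lborel. ((\<lambda>t. \<psi> (x + t *\<^sub>R b)) has_real_derivative \<psi>b x) (at 0)"
    and \<psi>m: "\<psi>a \<in> borel_measurable borel" "\<psi>b \<in> borel_measurable borel"
    and u: "continuous_on UNIV u" "\<And>r. \<exists>K. K-lipschitz_on (cball 0 r) u"
    and ua: "\<And>x. ((\<lambda>t. u (x + t *\<^sub>R a)) has_real_derivative ua x) (at 0)"
    and ub: "\<And>x. ((\<lambda>t. u (x + t *\<^sub>R b)) has_real_derivative ub x) (at 0)"
    and um: "ua \<in> borel_measurable borel" "ub \<in> borel_measurable borel"
  shows "(\<integral>x. \<psi>b x * ua x \<partial>lborel) = (\<integral>x. \<psi>a x * ub x \<partial>lborel)"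
proof -
  define h where "h = (\<lambda>k. 1 / real (Suc k))"
  have h: "h \<longlonglongrightarrow> 0" "\<And>k. 0 < h k" "\<And>k. h k \<le> 1"
    using LIMSEQ_inverse_real_of_nat by (auto simp: h_def inverse_eq_divide)
  let ?J = "\<lambda>a b k. \<integral>x. (\<psi> x - \<psi> (x - h k *\<^sub>R b)) / h k * ((u (x + h k *\<^sub>R a) - u x) / h k) \<partial>lborel"
  have c: "continuous_on UNIV \<psi>" using \<psi> by (rule lipschitz_on_continuous_on)
  have J: "?J a b k = 1 / (h k * h k) *
      (\<integral>x. \<psi> x * (u (x + h k *\<^sub>R a) + u (x + h k *\<^sub>R b) - u x - u (x + h k *\<^sub>R a + h k *\<^sub>R b)) \<partial>lborel)"
    for a b k
    using integral_difference_mult_difference[OF c u(1) supp, of "h k *\<^sub>R b" "h k *\<^sub>R a"]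
    by (simp add: times_divide_times_eq)
  have sym: "?J a b = ?J b a"
  proof
    fix k
    have "(\<integral>x. \<psi> x * (u (x + h k *\<^sub>R a) + u (x + h k *\<^sub>R b) - u x - u (x + h k *\<^sub>R a + h k *\<^sub>R b)) \<partial>lborel)
        = (\<integral>x. \<psi> x * (u (x + h k *\<^sub>R b) + u (x + h k *\<^sub>R a) - u x - u (x + h k *\<^sub>R b + h k *\<^sub>R a)) \<partial>lborel)"
      by (simp only: add.commute[of "u (_ + h k *\<^sub>R a)"] add.commute[of "h k *\<^sub>R a"] add.assoc)
    then show "?J a b k = ?J b a k"
      unfolding J[where a=a and b=b] J[where a=b and b=a] by (rule arg_cong)
  qed
  have 1: "?J a b \<longlonglongrightarrow> (\<integral>x. \<psi>b x * ua x \<partial>lborel)"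
    by (rule difference_quotients_converge[OF \<psi> supp \<psi>b \<psi>m(2) u ua um(1) h])
  have 2: "?J b a \<longlonglongrightarrow> (\<integral>x. \<psi>a x * ub x \<partial>lborel)"
    by (rule difference_quotients_converge[OF \<psi> supp \<psi>a \<psi>m(1) u ub um(2) h])
  show ?thesis
    by (rule LIMSEQ_unique[OF 1[unfolded sym] 2])
qed

section \<open>Integrals over spheres and thin shells\<close>

lemma null_sets_sphere: "sphere (c::'a::euclidean_space) r \<in> null_sets lborel"
  using negligible_sphere[of c r]
  by (auto simp: null_sets_completion_iff negligible_iff_null_sets)

text \<open>
  The origin, where the radial projection leaves the sphere, is a null set.
\<close>

lemma integral_sphere_area:
  fixes h :: "real^'n::finite \<Rightarrow> real"
  assumes "r > 0" and h[measurable]: "h \<in> borel_measurable borel"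
  shows "(LINT x:sphere 0 r|sphere_area r. h x)
    = real CARD('n) / r * (\<integral>x. indicator (cball 0 r) x * h ((r / norm x) *\<^sub>R x) \<partial>lborel)"
proof -
  let ?c = "real CARD('n) / r" and ?p = "\<lambda>x::real^'n. (r / norm x) *\<^sub>R x"
  have c: "?c \<ge> 0" using assms(1) by simp
  have dens: "(\<lambda>x. ennreal ?c * indicator (cball (0::real^'n) r) x)
      = (\<lambda>x. ennreal (?c * indicator (cball 0 r) x))"
    by (rule ext) (simp split: split_indicator)
  have p[measurable]: "?p \<in> borel_measurable borel" by measurable
  have hs: "(\<lambda>x. indicator (sphere 0 r) x * h x) \<in> borel_measurable borel"
    by (intro borel_measurable_times borel_measurable_indicator h) simp
  have hp: "(\<lambda>x. indicator (sphere 0 r) (?p x) * h (?p x)) \<in> borel_measurable borel"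
    by (rule measurable_compose[OF p hs])
  have ci: "(\<lambda>x. ?c * indicator (cball 0 r) x) \<in> borel_measurable borel"
    by (intro borel_measurable_times borel_measurable_indicator) auto
  have "(LINT x:sphere 0 r|sphere_area r. h x)
      = (\<integral>x. (indicator (sphere 0 r) (?p x) * h (?p x))
           \<partial>density lborel (\<lambda>x. ennreal (?c * indicator (cball 0 r) x)))"
    unfolding set_lebesgue_integral_def sphere_area_def dens
    using hs by (subst integral_distr) auto
  also have "\<dots> = (\<integral>x. (?c * indicator (cball 0 r) x) *\<^sub>R (indicator (sphere 0 r) (?p x) * h (?p x)) \<partial>lborel)"
    by (rule integral_density) (use c hp ci in \<open>auto simp: indicator_def\<close>)
  also have "\<dots> = (\<integral>x. ?c * (indicator (cball 0 r) x * h (?p x)) \<partial>lborel)"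
  proof (rule integral_cong_AE)
    have "AE x in lborel. x \<noteq> (0::real^'n)"
      by (rule AE_lborel_singleton)
    then show "AE x in lborel. (?c * indicator (cball 0 r) x) *\<^sub>R (indicator (sphere 0 r) (?p x) * h (?p x))
        = ?c * (indicator (cball 0 r) x * h (?p x))"
      by eventually_elim (use assms(1) in \<open>simp add: indicator_def\<close>)
    show "(\<lambda>x. (?c * indicator (cball 0 r) x) *\<^sub>R (indicator (sphere 0 r) (?p x) * h (?p x))) \<in> borel_measurable lborel"
      unfolding measurable_lborel2 by (rule borel_measurable_scaleR[OF ci hp])
    have "(\<lambda>x. indicator (cball 0 r) x * h (?p x)) \<in> borel_measurable borel"
      by (intro borel_measurable_times borel_measurable_indicator measurable_compose[OF p h]) auto
    then show "(\<lambda>x. ?c * (indicator (cball 0 r) x * h (?p x))) \<in> borel_measurable lborel"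
      unfolding measurable_lborel2 by (rule borel_measurable_times[OF borel_measurable_const])
  qed
  finally show ?thesis by simp
qed

lemma lborel_integral_scaleR:
  fixes F :: "'a::euclidean_space \<Rightarrow> real"
  assumes F: "F \<in> borel_measurable borel" and "c > 0"
  shows "(\<integral>x. F x \<partial>lborel) = c ^ DIM('a) * (\<integral>x. F (c *\<^sub>R x) \<partial>lborel)"
proof -
  let ?T = "\<lambda>x::'a. 0 + c *\<^sub>R x"
  have T: "?T \<in> borel_measurable borel" by measurable
  have "(\<integral>x. F x \<partial>lborel) = (\<integral>x. F x \<partial>density (distr lborel borel ?T) (\<lambda>_. \<bar>c\<bar> ^ DIM('a)))"
    using lborel_affine[of c "0::'a"] assms(2) by simp
  also have "\<dots> = (\<integral>x. (c ^ DIM('a)) *\<^sub>R F x \<partial>distr lborel borel ?T)"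
    using F assms(2) by (subst integral_density) auto
  also have "\<dots> = (\<integral>x. (c ^ DIM('a)) *\<^sub>R F (c *\<^sub>R x) \<partial>lborel)"
    using F T by (subst integral_distr) auto
  finally show ?thesis by simp
qed

lemma radial_extension_integrable:
  fixes h :: "'a::euclidean_space \<Rightarrow> real"
  assumes h[measurable]: "h \<in> borel_measurable borel" and c: "continuous_on (- {0}) h" and "r > 0"
  shows "integrable lborel (\<lambda>x. indicator (cball 0 s) x * h ((r / norm x) *\<^sub>R x))"
proof -
  have "compact (h ` sphere 0 r)"
    using assms(3) by (intro compact_continuous_image continuous_on_subset[OF c]) auto
  then obtain M where M: "\<And>x. x \<in> sphere 0 r \<Longrightarrow> \<bar>h x\<bar> \<le> M"
    using compact_imp_bounded[of "h ` sphere 0 r"] unfolding bounded_iff by (metis imageI real_norm_def)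
  have p[measurable]: "(\<lambda>x::'a. (r / norm x) *\<^sub>R x) \<in> borel_measurable borel" by measurable
  have b: "\<bar>h ((r / norm x) *\<^sub>R x)\<bar> \<le> max M \<bar>h 0\<bar>" for x
    using M[of "(r / norm x) *\<^sub>R x"] assms(3) by (cases "x = 0") (auto simp: le_max_iff_disj)
  have "integrable lborel (\<lambda>x. indicator (cball 0 s) x *\<^sub>R h ((r / norm x) *\<^sub>R x))"
    by (rule integrableI_bounded_set_indicator[where B="max M \<bar>h 0\<bar>"])
       (use b emeasure_lborel_cball_finite in \<open>auto intro!: measurable_compose[OF p]\<close>)
  then show ?thesis by simp
qed

text \<open>
  The function \<open>\<lambda>x. h ((r / norm x) *\<^sub>R x)\<close> is constant along rays, so only the volume scales.
\<close>

lemma radial_extension_integral_cball: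
  fixes h :: "'a::euclidean_space \<Rightarrow> real"
  assumes h[measurable]: "h \<in> borel_measurable borel" and "r > 0" "s > 0"
  shows "(\<integral>x. indicator (cball 0 s) x * h ((r / norm x) *\<^sub>R x) \<partial>lborel)
    = (s / r) ^ DIM('a) * (\<integral>x. indicator (cball 0 r) x * h ((r / norm x) *\<^sub>R x) \<partial>lborel)"
proof -
  let ?F = "\<lambda>s x::'a. indicator (cball 0 s) x * h ((r / norm x) *\<^sub>R x)"
  have p[measurable]: "(\<lambda>x::'a. (r / norm x) *\<^sub>R x) \<in> borel_measurable borel" by measurable
  have "?F s \<in> borel_measurable borel"
    by (intro borel_measurable_times borel_measurable_indicator measurable_compose[OF p h]) auto
  moreover have "?F s ((s / r) *\<^sub>R x) = ?F r x" for x
  proof -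
    have 1: "(r / norm ((s / r) *\<^sub>R x)) *\<^sub>R ((s / r) *\<^sub>R x) = (r / norm x) *\<^sub>R x"
      using assms(2,3) by simp
    have "(s / r) *\<^sub>R x \<in> cball 0 s \<longleftrightarrow> x \<in> cball 0 r"
      using assms(2,3) by (simp add: field_simps)
    then have 2: "indicat_real (cball 0 s) ((s / r) *\<^sub>R x) = indicat_real (cball 0 r) x"
      by (simp only: indicator_def)
    show ?thesis by (simp only: 1 2)
  qed
  ultimately show ?thesis
    using lborel_integral_scaleR[of "?F s" "s / r"] assms(2,3) by (simp only: divide_pos_pos)
qed

lemma radial_extension_integral_shell:
  fixes h :: "'a::euclidean_space \<Rightarrow> real"
  assumes h[measurable]: "h \<in> borel_measurable borel" and c: "continuous_on (- {0}) h"
    and "r > 0" "\<delta> > 0"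
  shows "integrable lborel (\<lambda>x. indicator {x. r < norm x \<and> norm x \<le> r + \<delta>} x * h ((r / norm x) *\<^sub>R x))"
    and "(\<integral>x. indicator {x. r < norm x \<and> norm x \<le> r + \<delta>} x * h ((r / norm x) *\<^sub>R x) \<partial>lborel)
    = ((r + \<delta>) ^ DIM('a) - r ^ DIM('a)) / r ^ DIM('a)
       * (\<integral>x. indicator (cball 0 r) x * h ((r / norm x) *\<^sub>R x) \<partial>lborel)"
proof -
  let ?F = "\<lambda>s x::'a. indicator (cball 0 s) x * h ((r / norm x) *\<^sub>R x)"
  have split: "(\<lambda>x. indicator {x. r < norm x \<and> norm x \<le> r + \<delta>} x * h ((r / norm x) *\<^sub>R x))
      = (\<lambda>x. ?F (r + \<delta>) x - ?F r x)"
    using assms(4) by (auto simp: indicator_def)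
  note i = radial_extension_integrable[OF h c assms(3)]
  show "integrable lborel (\<lambda>x. indicator {x. r < norm x \<and> norm x \<le> r + \<delta>} x * h ((r / norm x) *\<^sub>R x))"
    unfolding split using i by (rule Bochner_Integration.integrable_diff) (rule i)
  have "(\<integral>x. indicator {x. r < norm x \<and> norm x \<le> r + \<delta>} x * h ((r / norm x) *\<^sub>R x) \<partial>lborel)
      = ((r + \<delta>) / r) ^ DIM('a) * (\<integral>x. ?F r x \<partial>lborel) - (\<integral>x. ?F r x \<partial>lborel)"
    unfolding split Bochner_Integration.integral_diff[OF i i]
    using radial_extension_integral_cball[OF h assms(3), of "r + \<delta>"] assms(3,4) by simp
  then show "(\<integral>x. indicator {x. r < norm x \<and> norm x \<le> r + \<delta>} x * h ((r / norm x) *\<^sub>R x) \<partial>lborel)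
    = ((r + \<delta>) ^ DIM('a) - r ^ DIM('a)) / r ^ DIM('a)
       * (\<integral>x. indicator (cball 0 r) x * h ((r / norm x) *\<^sub>R x) \<partial>lborel)"
    using assms(3) by (simp add: power_divide field_simps)
qed

text \<open>
  On a thin shell a continuous function is uniformly close to its constant extension along rays from
  the sphere of radius \<open>r\<close>.  For the extension the average is explicit, and the factor $n / r$ is the
  derivative at \<open>\<delta> = 0\<close> of $((r + \delta)^n - r^n) / r^n$.  This recovers the area integral without
  polar coordinates.
\<close>

lemma shell_average_tendsto:
  fixes h :: "'a::euclidean_space \<Rightarrow> real" and \<delta> :: "nat \<Rightarrow> real"
  assumes h[measurable]: "h \<in> borel_measurable borel" and c: "continuous_on (- {0}) h" and r: "r > 0"
    and \<delta>: "\<delta> \<longlonglongrightarrow> 0" "\<And>k. 0 < \<delta> k"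
  shows "(\<lambda>k. (\<integral>x. indicator {x. r < norm x \<and> norm x \<le> r + \<delta> k} x * h x \<partial>lborel) / \<delta> k)
    \<longlonglongrightarrow> real DIM('a) / r * (\<integral>x. indicator (cball 0 r) x * h ((r / norm x) *\<^sub>R x) \<partial>lborel)"
proof -
  let ?S = "\<lambda>k. {x::'a. r < norm x \<and> norm x \<le> r + \<delta> k}"
  let ?H = "\<lambda>x::'a. h ((r / norm x) *\<^sub>R x)"
  let ?n = "DIM('a)"
  define I where "I = (\<integral>x. indicator (cball 0 r) x * ?H x \<partial>lborel)"
  define q where "q = (\<lambda>k. ((r + \<delta> k) ^ ?n - r ^ ?n) / \<delta> k)"
  have p[measurable]: "(\<lambda>x::'a. (r / norm x) *\<^sub>R x) \<in> borel_measurable borel" by measurable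
  have Hm[measurable]: "?H \<in> borel_measurable borel" by (rule measurable_compose[OF p h])
  have q: "q \<longlonglongrightarrow> real ?n * r ^ (?n - 1)"
  proof -
    have "((\<lambda>t::real. (r + t) ^ ?n) has_real_derivative real ?n * r ^ (?n - 1)) (at 0)"
      by (auto intro!: derivative_eq_intros)
    then have "(\<lambda>t. ((r + t) ^ ?n - r ^ ?n) / t) \<midarrow>0\<rightarrow> real ?n * r ^ (?n - 1)"
      by (simp add: has_field_derivative_iff)
    moreover have "filterlim \<delta> (at 0) sequentially"
      using \<delta> by (simp add: filterlim_at less_imp_neq[THEN not_sym])
    ultimately show ?thesis unfolding q_def by (rule filterlim_compose)
  qed
  have S_set[measurable]: "?S k \<in> sets lborel" for k
    by measurable
  have S_sub: "?S k \<subseteq> cball 0 (r + \<delta> k)" for k by auto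
  have S_fin: "emeasure lborel (?S k) < \<infinity>" for k
    using emeasure_mono[OF S_sub[of k], of lborel] emeasure_lborel_cball_finite[of "0::'a" "r + \<delta> k"]
    by (auto intro: le_less_trans)
  have vol: "(\<integral>x. indicator (?S k) x \<partial>lborel) = q k * \<delta> k * unit_ball_vol (real ?n)" for k
  proof -
    have "(\<integral>x. indicator (?S k) x * (1::real) \<partial>lborel)
        = ((r + \<delta> k) ^ ?n - r ^ ?n) / r ^ ?n * (\<integral>x. indicator (cball (0::'a) r) x * 1 \<partial>lborel)"
      using radial_extension_integral_shell(2)[of "\<lambda>_. 1" r "\<delta> k"] r \<delta>(2)[of k] by simp
    moreover have "(\<integral>x. indicator (cball (0::'a) r) x * (1::real) \<partial>lborel) = unit_ball_vol (real ?n) * r ^ ?n"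
      using content_cball[of r "0::'a"] r by simp
    ultimately show ?thesis using r \<delta>(2)[of k] by (simp add: q_def)
  qed
  have H_shell: "integrable lborel (\<lambda>x. indicator (?S k) x * ?H x)"
    "(\<integral>x. indicator (?S k) x * ?H x \<partial>lborel) = q k * \<delta> k / r ^ ?n * I" for k
    using radial_extension_integral_shell[OF h c r \<delta>(2)[of k]] \<delta>(2)[of k] by (simp_all add: I_def q_def)
  have h_shell: "integrable lborel (\<lambda>x. indicator (?S k) x * h x)" for k
  proof -
    let ?K = "cball 0 (r + \<delta> k) - ball 0 r :: 'a set"
    have "compact ?K" by (intro compact_diff) auto
    then have "integrable lborel (\<lambda>x. indicator ?K x *\<^sub>R h x)"
      using r by (intro borel_integrable_compact continuous_on_subset[OF c]) auto
    then have "integrable lborel (\<lambda>x. indicator (?S k) x *\<^sub>R (indicator ?K x *\<^sub>R h x))"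
      by (rule integrable_mult_indicator[OF S_set])
    moreover have "(\<lambda>x. indicator (?S k) x *\<^sub>R (indicator ?K x *\<^sub>R h x)) = (\<lambda>x. indicator (?S k) x * h x)"
      by (auto simp: indicator_def)
    ultimately show ?thesis by simp
  qed
  \<comment> \<open>The error made by replacing h by its extension along rays.\<close>
  define e where "e = (\<lambda>k. ((\<integral>x. indicator (?S k) x * h x \<partial>lborel) - (\<integral>x. indicator (?S k) x * ?H x \<partial>lborel)) / \<delta> k)"
  have e: "e \<longlonglongrightarrow> 0"
  proof (rule LIMSEQ_I)
    fix \<epsilon> :: real assume "\<epsilon> > 0"
    define B where "B = unit_ball_vol (real ?n) * (real ?n * r ^ (?n - 1) + 1)"
    have B: "B > 0" using r by (auto simp: B_def intro!: mult_pos_pos add_nonneg_pos)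
    define \<epsilon>' where "\<epsilon>' = \<epsilon> / (2 * B)"
    have \<epsilon>': "\<epsilon>' > 0" using \<open>\<epsilon> > 0\<close> B by (simp add: \<epsilon>'_def)
    let ?K = "cball 0 (2 * r) - ball 0 r :: 'a set"
    have "compact ?K" by (intro compact_diff) auto
    then have "uniformly_continuous_on ?K h"
      using r by (intro compact_uniformly_continuous continuous_on_subset[OF c]) auto
    then obtain d where d: "d > 0" "\<And>x y. x \<in> ?K \<Longrightarrow> y \<in> ?K \<Longrightarrow> dist y x < d \<Longrightarrow> dist (h y) (h x) < \<epsilon>'"
      unfolding uniformly_continuous_on_def using \<epsilon>' by metis
    have "eventually (\<lambda>k. \<delta> k < min d r) sequentially"
      using \<delta>(1) d(1) r by (intro order_tendstoD(2)) auto
    moreover have "eventually (\<lambda>k. q k < real ?n * r ^ (?n - 1) + 1) sequentially"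
      by (rule order_tendstoD(2)[OF q]) simp
    ultimately have "eventually (\<lambda>k. norm (e k) < \<epsilon>) sequentially"
    proof eventually_elim
      case (elim k)
      have close: "norm (indicator (?S k) x * h x - indicator (?S k) x * ?H x) \<le> \<epsilon>' * indicator (?S k) x" for x
      proof (cases "x \<in> ?S k")
        case True
        then have x: "x \<noteq> 0" "r < norm x" "norm x \<le> 2 * r" "norm x - r < d" using r elim by auto
        have "dist ((r / norm x) *\<^sub>R x) x = norm ((r / norm x - 1) *\<^sub>R x)"
          by (simp add: dist_norm scaleR_left_diff_distrib)
        also have "\<dots> = norm x - r"
          using x r by (simp add: abs_if field_simps)
        finally have "dist (?H x) (h x) < \<epsilon>'"
          using x r by (intro d(2)) auto
        then show ?thesis using True by (simp add: dist_real_def)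
      qed simp
      have "norm ((\<integral>x. indicator (?S k) x * h x - indicator (?S k) x * ?H x \<partial>lborel))
          \<le> (\<integral>x. \<epsilon>' * indicator (?S k) x \<partial>lborel)"
      proof (rule Bochner_Integration.integral_norm_bound_integral)
        show "integrable lborel (\<lambda>x. indicator (?S k) x * h x - indicator (?S k) x * ?H x)"
          by (intro Bochner_Integration.integrable_diff h_shell H_shell(1))
        show "integrable lborel (\<lambda>x. \<epsilon>' * indicator (?S k) x)"
          using S_fin S_set by (intro integrable_mult_right) (simp add: integrable_indicator_iff)
      qed (use close in auto)
      also have "\<dots> = \<epsilon>' * (q k * \<delta> k * unit_ball_vol (real ?n))"
        using vol by simp
      finally have "norm (e k) \<le> \<epsilon>' * (q k * unit_ball_vol (real ?n))"
        using \<delta>(2)[of k] Bochner_Integration.integral_diff[OF h_shell H_shell(1), of k k]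
        by (simp add: e_def field_simps)
      also have "\<dots> \<le> \<epsilon>' * B"
        unfolding B_def using elim \<epsilon>' by (intro mult_left_mono) auto
      also have "\<dots> < \<epsilon>"
        using B \<open>\<epsilon> > 0\<close> by (simp add: \<epsilon>'_def)
      finally show ?case .
    qed
    then show "\<exists>N. \<forall>k\<ge>N. norm (e k - 0) < \<epsilon>" by (simp add: eventually_sequentially)
  qed
  have "(\<lambda>k. e k + q k / r ^ ?n * I) \<longlonglongrightarrow> 0 + real ?n * r ^ (?n - 1) / r ^ ?n * I"
    using r by (intro tendsto_intros e q) auto
  moreover have "e k + q k / r ^ ?n * I = (\<integral>x. indicator (?S k) x * h x \<partial>lborel) / \<delta> k" for k
    using \<delta>(2)[of k] by (simp add: e_def H_shell(2) diff_divide_distrib)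
  moreover have "r ^ ?n = r * r ^ (?n - 1)"
    by (metis DIM_positive Suc_pred' power_Suc)
  ultimately show ?thesis using r by (simp add: I_def)
qed

lemma sphere_integral_sum:
  fixes h :: "'k \<Rightarrow> real^'n::finite \<Rightarrow> real"
  assumes "r > 0" and h: "\<And>k. k \<in> K \<Longrightarrow> h k \<in> borel_measurable borel"
    "\<And>k. k \<in> K \<Longrightarrow> continuous_on (- {0}) (h k)"
  shows "(LINT x:sphere 0 r|sphere_area r. \<Sum>k\<in>K. h k x) = (\<Sum>k\<in>K. LINT x:sphere 0 r|sphere_area r. h k x)"
proof -
  have m: "(\<lambda>x. \<Sum>k\<in>K. h k x) \<in> borel_measurable borel"
    using h(1) by (rule borel_measurable_sum)
  show ?thesis
    using radial_extension_integrable[OF h assms(1)]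
    by (simp add: integral_sphere_area[OF assms(1)] m h sum_distrib_left)
qed

lemma sphere_integral_diff:
  fixes h :: "real^'n::finite \<Rightarrow> real"
  assumes "r > 0" and h: "h \<in> borel_measurable borel" "continuous_on (- {0}) h"
    and k: "k \<in> borel_measurable borel" "continuous_on (- {0}) k"
  shows "(LINT x:sphere 0 r|sphere_area r. h x - k x)
    = (LINT x:sphere 0 r|sphere_area r. h x) - (LINT x:sphere 0 r|sphere_area r. k x)"
proof -
  have m: "(\<lambda>x. h x - k x) \<in> borel_measurable borel"
    using h(1) k(1) by (rule borel_measurable_diff)
  show ?thesis
    using radial_extension_integrable[OF h assms(1)] radial_extension_integrable[OF k assms(1)]
    by (simp add: integral_sphere_area[OF assms(1)] m h k right_diff_distrib Bochner_Integration.integral_diff)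
qed

lemma sphere_integral_bound:
  fixes h :: "real^'n::finite \<Rightarrow> real"
  assumes r: "r > 0" and h: "h \<in> borel_measurable borel" "continuous_on (- {0}) h"
    and M: "\<And>x. norm x = r \<Longrightarrow> \<bar>h x\<bar> \<le> M"
  shows "\<bar>LINT x:sphere 0 r|sphere_area r. h x\<bar>
    \<le> real CARD('n) * unit_ball_vol (real CARD('n)) * M * r ^ (CARD('n) - 1)"
proof -
  let ?F = "\<lambda>x::real^'n. indicator (cball 0 r) x * h ((r / norm x) *\<^sub>R x)"
  note i = radial_extension_integrable[OF h r, of r]
  have "\<bar>\<integral>x. ?F x \<partial>lborel\<bar> \<le> (\<integral>x. \<bar>?F x\<bar> \<partial>lborel)"
    using integral_norm_bound[of lborel ?F] by simp
  also have "\<dots> \<le> (\<integral>x. indicator (cball (0::real^'n) r) x * M \<partial>lborel)"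
  proof (rule integral_mono_AE)
    show "integrable lborel (\<lambda>x. \<bar>?F x\<bar>)" using i by (rule integrable_abs)
    show "integrable lborel (\<lambda>x. indicator (cball (0::real^'n) r) x * M)"
      using emeasure_lborel_cball_finite[of "0::real^'n" r]
      by (intro integrable_mult_left) (simp add: integrable_indicator_iff)
    have "AE x in lborel. x \<noteq> (0::real^'n)" by (rule AE_lborel_singleton)
    then show "AE x in lborel. \<bar>?F x\<bar> \<le> indicator (cball (0::real^'n) r) x * M"
      by eventually_elim (use M r in \<open>simp add: indicator_def\<close>)
  qed
  also have "\<dots> = unit_ball_vol (real CARD('n)) * r ^ CARD('n) * M"
    using content_cball[of r "0::real^'n"] r by simp
  finally have "real CARD('n) / r * \<bar>\<integral>x. ?F x \<partial>lborel\<bar>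
      \<le> real CARD('n) / r * (unit_ball_vol (real CARD('n)) * r ^ CARD('n) * M)"
    using r by (intro mult_left_mono) auto
  also have "\<dots> = real CARD('n) * unit_ball_vol (real CARD('n)) * M * (r ^ CARD('n) / r)"
    by simp
  also have "r ^ CARD('n) / r = r ^ (CARD('n) - 1)"
    using r by (simp add: power_diff)
  finally show ?thesis
    using r by (simp add: integral_sphere_area[OF r h(1)] abs_mult)
qed

section \<open>Calculus of continuously differentiable maps\<close>

lemma C1_mapD:
  assumes "C1_map w"
  shows "w differentiable (at x)" "continuous_on UNIV w" "continuous_on UNIV (partial i w)"
  using assms differentiable_imp_continuous_on[of w UNIV]
  by (auto simp: C1_map_def differentiable_on_def)

lemma frechet_derivative_eq_sum_partial:
  fixes w :: "real^'n::finite \<Rightarrow> real"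
  assumes "w differentiable (at x)"
  shows "frechet_derivative w (at x) v = (\<Sum>i\<in>UNIV. v $ i * partial i w x)"
proof -
  have "linear (frechet_derivative w (at x))"
    using has_derivative_partial[OF assms] has_derivative_linear by blast
  then have "frechet_derivative w (at x) (\<Sum>i\<in>UNIV. v $ i *s axis i 1) = (\<Sum>i\<in>UNIV. v $ i * partial i w x)"
    by (simp add: linear_sum linear_scale scalar_mult_eq_scaleR partial_def)
  then show ?thesis by (simp add: basis_expansion)
qed

lemma C1_map_lipschitz_on_cball:
  fixes w :: "real^'n::finite \<Rightarrow> real"
  assumes "C1_map w"
  shows "\<exists>K. K-lipschitz_on (cball 0 R) w"
proof -
  have "\<exists>B. \<forall>x\<in>cball 0 R. \<bar>partial i w x\<bar> \<le> B" for i
  proof -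
    have "compact (partial i w ` cball 0 R)"
      using C1_mapD(3)[OF assms] by (intro compact_continuous_image) (auto intro: continuous_on_subset)
    from compact_imp_bounded[OF this] show ?thesis unfolding bounded_iff by (metis imageI real_norm_def)
  qed
  then obtain B where B: "\<And>i x. x \<in> cball 0 R \<Longrightarrow> \<bar>partial i w x\<bar> \<le> B i" by metis
  define K where "K = (\<Sum>i\<in>UNIV. \<bar>B i\<bar>)"
  have "norm (frechet_derivative w (at x) v) \<le> K * norm v" if "x \<in> cball 0 R" for x v
  proof -
    have "norm (frechet_derivative w (at x) v) \<le> (\<Sum>i\<in>UNIV. \<bar>v $ i\<bar> * \<bar>partial i w x\<bar>)"
      unfolding frechet_derivative_eq_sum_partial[OF C1_mapD(1)[OF assms]] abs_mult[symmetric]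
      by (simp add: sum_abs)
    also have "\<dots> \<le> (\<Sum>i\<in>UNIV. norm v * \<bar>B i\<bar>)"
      using B[OF that] by (intro sum_mono mult_mono) (auto simp: component_le_norm_cart intro: order_trans[OF _ abs_ge_self])
    finally show ?thesis by (simp add: K_def sum_distrib_left mult.commute)
  qed
  then have "onorm (frechet_derivative w (at x)) \<le> K" if "x \<in> cball 0 R" for x
    using that by (intro onorm_bound) (auto simp: K_def intro: sum_nonneg)
  then have "norm (w x - w y) \<le> K * norm (x - y)" if "x \<in> cball 0 R" "y \<in> cball 0 R" for x y
    using that C1_mapD(1)[OF assms]
    by (intro differentiable_bound[of "cball 0 R" w "\<lambda>x. frechet_derivative w (at x)"])
       (auto intro: has_derivative_at_withinI has_derivative_partial)
  then have "K-lipschitz_on (cball 0 R) w"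
    by (intro lipschitz_onI) (auto simp: dist_norm K_def intro: sum_nonneg)
  then show ?thesis by blast
qed

lemma partial_mult:
  fixes v w :: "real^'n::finite \<Rightarrow> real"
  assumes "v differentiable (at x)" "w differentiable (at x)"
  shows "partial i (\<lambda>y. v y * w y) x = v x * partial i w x + partial i v x * w x"
  using partial_sum_mult[of "\<lambda>_::unit. v" x "\<lambda>_. w" i UNIV] assms by simp

lemma partial_sum:
  assumes "\<And>k. w k differentiable (at x)"
  shows "partial i (\<lambda>y. \<Sum>k\<in>K. w k y) x = (\<Sum>k\<in>K. partial i (w k) x)"
  by (subst partial_eqI[OF has_derivative_sum[OF has_derivative_partial[OF assms]]])
     (simp add: partial_def)

lemma partial_diff:
  assumes "v differentiable (at x)" "w differentiable (at x)"
  shows "partial i (\<lambda>y. v y - w y) x = partial i v x - partial i w x"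
  by (subst partial_eqI[OF has_derivative_diff[OF has_derivative_partial[OF assms(1)] has_derivative_partial[OF assms(2)]]])
     (simp add: partial_def)

lemma partial_add_const:
  assumes "w differentiable (at x)"
  shows "partial i (\<lambda>y. c + w y) x = partial i w x"
  by (subst partial_eqI[OF has_derivative_add[OF has_derivative_const has_derivative_partial[OF assms]]])
     (simp add: partial_def)

lemma C1_mapI:
  assumes "\<And>x. w differentiable (at x)" and "\<And>i x. partial i w x = w' i x"
    and "\<And>i. continuous_on UNIV (w' i)"
  shows "C1_map w"
proof -
  have "partial i w = w' i" for i using assms(2) by blast
  then show ?thesis using assms(1,3) by (simp add: C1_map_def)
qed

lemma C1_map_mult:
  fixes v w :: "real^'n::finite \<Rightarrow> real"
  assumes "C1_map v" "C1_map w"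
  shows "C1_map (\<lambda>x. v x * w x)"
  by (rule C1_mapI[OF _ partial_mult])
     (intro differentiable_mult C1_mapD[OF assms(1)] C1_mapD[OF assms(2)] continuous_intros)+

lemma C1_map_diff:
  assumes "C1_map v" "C1_map w"
  shows "C1_map (\<lambda>x. v x - w x)"
  by (rule C1_mapI[OF _ partial_diff])
     (intro differentiable_diff C1_mapD[OF assms(1)] C1_mapD[OF assms(2)] continuous_intros)+

lemma C1_map_sum:
  fixes w :: "'k::finite \<Rightarrow> real^'n::finite \<Rightarrow> real"
  assumes "\<And>k. C1_map (w k)"
  shows "C1_map (\<lambda>x. \<Sum>k\<in>UNIV. w k x)"
  by (rule C1_mapI[OF _ partial_sum])
     (intro differentiable_sum finite ballI C1_mapD[OF assms] continuous_intros)+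

section \<open>Flux of a field with antisymmetric coefficients\<close>

text \<open>
  If both points lie in the support of \<open>\<phi>\<close>, this is the product rule for increments.  If only one
  does, the increment of the product is that of \<open>\<phi>\<close> times the value of \<open>w\<close> at that point, so \<open>w\<close> is
  never compared with its values outside the ball.
\<close>

lemma lipschitz_compact_support_mult:
  fixes \<phi> w :: "'a::real_normed_vector \<Rightarrow> real"
  assumes \<phi>: "L-lipschitz_on UNIV \<phi>" "\<And>x. \<bar>\<phi> x\<bar> \<le> 1" and supp: "\<And>x. \<phi> x \<noteq> 0 \<Longrightarrow> norm x \<le> R"
    and w: "K-lipschitz_on (cball 0 R) w"
  shows "\<exists>M. M-lipschitz_on UNIV (\<lambda>x. \<phi> x * w x)"
proof -
  define B where "B = \<bar>w 0\<bar> + K * \<bar>R\<bar>"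
  have K: "0 \<le> K" and L: "0 \<le> L" using w \<phi> by (auto simp: lipschitz_on_def)
  have B0: "0 \<le> B" using K by (simp add: B_def)
  have B: "\<bar>w x\<bar> \<le> B" if "norm x \<le> R" for x
  proof -
    have "dist (w x) (w 0) \<le> K * dist x 0"
      using that order_trans[OF norm_ge_zero that] by (intro lipschitz_onD[OF w]) auto
    also have "\<dots> \<le> K * \<bar>R\<bar>" using that K by (intro mult_left_mono) auto
    finally show ?thesis by (simp add: B_def dist_real_def)
  qed
  have one: "dist (\<phi> x * w x) (\<phi> y * w y) \<le> (K + L * B) * dist x y" if "\<phi> x \<noteq> 0" for x y
  proof -
    have x: "norm x \<le> R" using supp that by blast
    have \<phi>d: "\<bar>\<phi> x - \<phi> y\<bar> \<le> L * dist x y" using lipschitz_onD[OF \<phi>(1), of x y] by (simp add: dist_real_def)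
    have wd: "\<bar>\<phi> y * (w x - w y)\<bar> \<le> K * dist x y"
    proof (cases "\<phi> y = 0")
      case False
      then have "\<bar>w x - w y\<bar> \<le> K * dist x y"
        using lipschitz_onD[OF w, of x y] x supp[of y] by (simp add: dist_real_def)
      then have "\<bar>\<phi> y\<bar> * \<bar>w x - w y\<bar> \<le> 1 * (K * dist x y)"
        using \<phi>(2) K by (intro mult_mono) auto
      then show ?thesis by (simp add: abs_mult)
    qed (use K in simp)
    have "\<phi> x * w x - \<phi> y * w y = (\<phi> x - \<phi> y) * w x + \<phi> y * (w x - w y)"
      by (simp add: algebra_simps)
    then have "\<bar>\<phi> x * w x - \<phi> y * w y\<bar> \<le> \<bar>\<phi> x - \<phi> y\<bar> * \<bar>w x\<bar> + \<bar>\<phi> y * (w x - w y)\<bar>"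
      by (metis abs_mult abs_triangle_ineq)
    also have "\<dots> \<le> (L * dist x y) * B + K * dist x y"
      using \<phi>d B[OF x] wd L by (intro add_mono mult_mono) auto
    finally show ?thesis by (simp add: dist_real_def algebra_simps)
  qed
  have "dist (\<phi> x * w x) (\<phi> y * w y) \<le> (K + L * B) * dist x y" for x y
    using one[of x y] one[of y x] K L B0 by (cases "\<phi> x = 0"; cases "\<phi> y = 0") (auto simp: dist_commute)
  then show ?thesis
    using K L B0 by (intro exI[of _ "K + L * B"] lipschitz_onI) auto
qed

definition cutoff :: "real \<Rightarrow> real \<Rightarrow> 'a::real_normed_vector \<Rightarrow> real" where
  "cutoff r \<delta> x = max 0 (min 1 ((r + \<delta> - norm x) / \<delta>))"

context
  fixes r \<delta> :: real
  assumes r: "r > 0" and \<delta>: "\<delta> > 0"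
begin

lemma cutoff_bounds: "0 \<le> cutoff r \<delta> x" "cutoff r \<delta> x \<le> 1"
  by (auto simp: cutoff_def)

lemma cutoff_inside: "norm x \<le> r \<Longrightarrow> cutoff r \<delta> x = 1"
  using \<delta> by (simp add: cutoff_def)

lemma cutoff_outside: "r + \<delta> \<le> norm x \<Longrightarrow> cutoff r \<delta> x = 0"
  using \<delta> divide_nonpos_pos[of "r + \<delta> - norm x" \<delta>] by (simp add: cutoff_def)

lemma cutoff_shell: "r \<le> norm x \<Longrightarrow> norm x \<le> r + \<delta> \<Longrightarrow> cutoff r \<delta> x = (r + \<delta> - norm x) / \<delta>"
  using \<delta> by (simp add: cutoff_def)

lemma cutoff_lipschitz: "(1 / \<delta>)-lipschitz_on UNIV (cutoff r \<delta> :: 'a::real_normed_vector \<Rightarrow> real)"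
proof (rule lipschitz_onI)
  fix x y :: 'a
  have "dist (cutoff r \<delta> x) (cutoff r \<delta> y) \<le> \<bar>(r + \<delta> - norm x) / \<delta> - (r + \<delta> - norm y) / \<delta>\<bar>"
    unfolding cutoff_def dist_real_def by linarith
  also have "\<dots> = \<bar>norm y - norm x\<bar> / \<delta>"
    using \<delta> by (simp add: diff_divide_distrib[symmetric])
  also have "\<dots> \<le> dist x y / \<delta>"
    using \<delta> norm_triangle_ineq3[of y x] by (intro divide_right_mono) (auto simp: dist_norm norm_minus_commute)
  finally show "dist (cutoff r \<delta> x) (cutoff r \<delta> y) \<le> 1 / \<delta> * dist x y" by simp
qed (use \<delta> in simp)

lemma cutoff_derivative:
  fixes x :: "real^'n::finite"
  assumes "norm x \<noteq> r" "norm x \<noteq> r + \<delta>"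
  shows "((\<lambda>t. cutoff r \<delta> (x + t *\<^sub>R axis i 1)) has_real_derivative
     - (indicator {x. r < norm x \<and> norm x \<le> r + \<delta>} x * (x $ i / norm x) / \<delta>)) (at 0)"
proof -
  let ?l = "\<lambda>t. x + t *\<^sub>R axis i 1"
  have cont: "isCont (\<lambda>t. norm (?l t)) 0" by (intro continuous_intros)
  have "((\<lambda>t. norm (?l t)) \<longlongrightarrow> norm (?l 0)) (nhds 0)"
    by (rule tendsto_at_iff_tendsto_nhds[THEN iffD1, OF cont[unfolded isCont_def]])
  then have lim: "((\<lambda>t. norm (?l t)) \<longlongrightarrow> norm x) (nhds 0)" by simp
  consider "norm x < r" | "r < norm x" "norm x < r + \<delta>" | "r + \<delta> < norm x"
    using assms by linarith
  then show ?thesis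
  proof cases
    case 1
    have "eventually (\<lambda>t. cutoff r \<delta> (?l t) = 1) (nhds 0)"
      using order_tendstoD(2)[OF lim 1] by eventually_elim (simp add: cutoff_inside)
    then show ?thesis using 1 by (subst DERIV_cong_ev[OF refl _ refl]) auto
  next
    case 2
    have "eventually (\<lambda>t. cutoff r \<delta> (?l t) = (r + \<delta> - norm (?l t)) / \<delta>) (nhds 0)"
      using order_tendstoD(1)[OF lim 2(1)] order_tendstoD(2)[OF lim 2(2)]
      by eventually_elim (simp add: cutoff_shell)
    moreover have "((\<lambda>t. (r + \<delta> - norm (?l t)) / \<delta>) has_real_derivative - ((x $ i / norm x) / \<delta>)) (at 0)"
    proof -
      have x0: "x \<noteq> 0" using 2 r by auto
      have line: "(?l has_derivative (\<lambda>h. h *\<^sub>R axis i 1)) (at 0)"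
        by (auto intro!: derivative_eq_intros)
      have "(norm has_derivative (\<lambda>h. h \<bullet> sgn x)) (at (?l 0))"
        using has_derivative_norm[OF x0] by simp
      from has_derivative_compose[OF line this]
      have "((\<lambda>t. norm (?l t)) has_derivative (\<lambda>h. (h *\<^sub>R axis i 1) \<bullet> sgn x)) (at 0)" .
      then have "((\<lambda>t. norm (?l t)) has_real_derivative x $ i / norm x) (at 0)"
        by (simp add: has_field_derivative_def inner_axis sgn_div_norm divide_inverse inner_axis' mult_commute_abs mult_ac)
      from DERIV_cdivide[OF DERIV_diff[OF DERIV_const[of "r + \<delta>"] this], of \<delta>]
      show ?thesis by simp
    qed
    ultimately show ?thesis using 2 by (subst DERIV_cong_ev[OF refl _ refl]) auto
  next
    case 3
    have "eventually (\<lambda>t. cutoff r \<delta> (?l t) = 0) (nhds 0)"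
      using order_tendstoD(1)[OF lim 3] by eventually_elim (simp add: cutoff_outside)
    then show ?thesis using 3 by (subst DERIV_cong_ev[OF refl _ refl]) auto
  qed
qed

end

lemma partial_uminus:
  assumes "w differentiable (at x)"
  shows "partial i (\<lambda>y. - w y) x = - partial i w x"
  by (subst partial_eqI[OF has_derivative_minus[OF has_derivative_partial[OF assms]]])
     (simp add: partial_def)

text \<open>
  With \<open>\<psi>\<close> the cutoff times \<open>c i j\<close>, the derivatives of \<open>\<psi>\<close> in direction \<open>j\<close> and of \<open>u\<close> in direction
  \<open>i\<close> may be exchanged under the integral.  As \<open>c\<close> is antisymmetric, the exchange reverses the sign of
  the double sum, which therefore vanishes.  The product rule splits it into the two sides below.
\<close>

lemma cutoff_weak_divergence:
  fixes u :: "real^'n::finite \<Rightarrow> real" and c :: "'n \<Rightarrow> 'n \<Rightarrow> real^'n \<Rightarrow> real"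
  assumes u: "C1_map u" and c: "\<And>i j. C1_map (c i j)" and anti: "\<And>i j x. c i j x = - c j i x"
    and r: "r > 0" and \<delta>: "\<delta> > 0"
  shows "(\<integral>x. cutoff r \<delta> x * (\<Sum>i\<in>UNIV. \<Sum>j\<in>UNIV. partial j (c i j) x * partial i u x) \<partial>lborel)
    = (\<integral>x. indicator {x. r < norm x \<and> norm x \<le> r + \<delta>} x
         * (\<Sum>i\<in>UNIV. \<Sum>j\<in>UNIV. c i j x * partial i u x * (x $ j / norm x)) \<partial>lborel) / \<delta>"
proof -
  let ?\<phi> = "cutoff r \<delta> :: real^'n \<Rightarrow> real" and ?S = "{x::real^'n. r < norm x \<and> norm x \<le> r + \<delta>}"
  \<comment> \<open>The derivative of the cutoff in direction j, off the two spheres that bound the shell.\<close>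
  define D where "D = (\<lambda>j x. - (indicator ?S x * (x $ j / norm x) / \<delta>))"
  have supp: "norm x \<le> r + \<delta>" if "?\<phi> x \<noteq> 0" for x
    using that cutoff_outside[OF r \<delta>, of x] by linarith
  have contu: "continuous_on UNIV (partial i u)" for i using C1_mapD(3)[OF u] .
  have contc: "continuous_on UNIV (c i j)" "continuous_on UNIV (partial k (c i j))" for i j k
    using C1_mapD(2,3)[OF c] by auto
  have cont\<phi>: "continuous_on UNIV ?\<phi>"
    using cutoff_lipschitz[OF r \<delta>] by (rule lipschitz_on_continuous_on)
  have meas: "?\<phi> \<in> borel_measurable borel" "partial i u \<in> borel_measurable borel"
     "c i j \<in> borel_measurable borel" "partial k (c i j) \<in> borel_measurable borel" for i j k
    using cont\<phi> contu contc by (auto intro: borel_measurable_continuous_onI)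
  have S[measurable]: "?S \<in> sets borel" by measurable
  have Dm: "D j \<in> borel_measurable borel" for j
    unfolding D_def by measurable
  define P where "P = (\<lambda>i j k x. ?\<phi> x * partial k (c i j) x + D k x * c i j x)"
  have Pm: "P i j k \<in> borel_measurable borel" for i j k
    unfolding P_def by (intro borel_measurable_add borel_measurable_times meas Dm)
  have PD: "AE x in lborel. ((\<lambda>t. ?\<phi> (x + t *\<^sub>R axis k 1) * c i j (x + t *\<^sub>R axis k 1)) has_real_derivative P i j k x) (at 0)"
    for i j k
  proof -
    have "AE x in lborel. x \<notin> sphere (0::real^'n) r" "AE x in lborel. x \<notin> sphere (0::real^'n) (r + \<delta>)"
      by (rule AE_not_in[OF null_sets_sphere])+
    then show ?thesis
    proof eventually_elim
      case (elim x)
      then have "((\<lambda>t. ?\<phi> (x + t *\<^sub>R axis k 1)) has_real_derivative D k x) (at 0)"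
        unfolding D_def by (intro cutoff_derivative r \<delta>) auto
      moreover have "((\<lambda>t. c i j (x + t *\<^sub>R axis k 1)) has_real_derivative partial k (c i j) x) (at 0)"
        using has_real_derivative_along_axis[OF C1_mapD(1)[OF c], of i j x k 0] by simp
      ultimately show ?case
        using DERIV_mult[of "\<lambda>t. ?\<phi> (x + t *\<^sub>R axis k 1)" "D k x" 0 UNIV "\<lambda>t. c i j (x + t *\<^sub>R axis k 1)" "partial k (c i j) x"]
        by (simp add: P_def mult_ac add_ac)
    qed
  qed
  \<comment> \<open>The pairing of the derivative of the product in direction j with the derivative of u in direction i.\<close>
  define T where "T = (\<lambda>i j. \<integral>x. P i j j x * partial i u x \<partial>lborel)"
  have uD: "((\<lambda>t. u (x + t *\<^sub>R axis k 1)) has_real_derivative partial k u x) (at 0)" for x k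
    using has_real_derivative_along_axis[OF C1_mapD(1)[OF u], of x k 0] by simp
  have T_anti: "T i j = - T j i" for i j
  proof -
    obtain K where K: "K-lipschitz_on (cball 0 (r + \<delta>)) (c i j)"
      using C1_map_lipschitz_on_cball[OF c] by blast
    have "\<exists>M. M-lipschitz_on UNIV (\<lambda>x. ?\<phi> x * c i j x)"
      by (rule lipschitz_compact_support_mult[OF cutoff_lipschitz[OF r \<delta>] _ supp K])
         (simp add: abs_of_nonneg cutoff_bounds[OF r \<delta>])
    then obtain M where M: "M-lipschitz_on UNIV (\<lambda>x. ?\<phi> x * c i j x)" by blast
    have "T i j = (\<integral>x. P i j i x * partial j u x \<partial>lborel)"
      unfolding T_def
      by (rule weak_cross_derivatives_eq[OF M _ PD PD Pm Pm C1_mapD(2)[OF u] C1_map_lipschitz_on_cball[OF u] uD uD meas(2) meas(2)])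
         (use supp in auto)
    also have "\<dots> = (\<integral>x. - (P j i i x * partial j u x) \<partial>lborel)"
    proof -
      have "c i j = (\<lambda>x. - c j i x)" using anti by blast
      then have "partial i (c i j) x = - partial i (c j i) x" for x
        using partial_uminus[OF C1_mapD(1)[OF c]] by metis
      then show ?thesis
        using anti[of i j]
        by (intro Bochner_Integration.integral_cong refl) (simp add: P_def algebra_simps)
    qed
    finally show ?thesis by (simp add: T_def)
  qed
  have "(\<Sum>i\<in>UNIV. \<Sum>j\<in>UNIV. T i j) = (\<Sum>i\<in>UNIV. \<Sum>j\<in>UNIV. - T j i)"
    by (intro sum.cong refl T_anti)
  also have "\<dots> = - (\<Sum>j\<in>UNIV. \<Sum>i\<in>UNIV. T j i)"
    by (subst sum.swap) (simp add: sum_negf)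
  finally have T0: "(\<Sum>i\<in>UNIV. \<Sum>j\<in>UNIV. T i j) = 0" by simp
  have i1: "integrable lborel (\<lambda>x. ?\<phi> x * (partial j (c i j) x * partial i u x))" for i j
    by (rule integrable_compact_support[of _ "r + \<delta>"])
       (use supp in \<open>auto intro!: continuous_on_mult cont\<phi> contc contu\<close>)
  have i2: "integrable lborel (\<lambda>x. indicator ?S x * (c i j x * partial i u x * (x $ j / norm x)))" for i j
  proof -
    let ?K = "cball 0 (r + \<delta>) - ball 0 r :: (real^'n) set"
    have K0: "\<forall>x\<in>?K. norm x \<noteq> 0" using r by auto
    have "compact ?K" by (intro compact_diff) auto
    then have "integrable lborel (\<lambda>x. indicator ?K x *\<^sub>R (c i j x * partial i u x * (x $ j / norm x)))"
      using K0 by (intro borel_integrable_compact continuous_intros continuous_on_subset[OF contc(1)]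
         continuous_on_subset[OF contu]) auto
    then have "integrable lborel (\<lambda>x. indicator ?S x *\<^sub>R (indicator ?K x *\<^sub>R (c i j x * partial i u x * (x $ j / norm x))))"
      by (rule integrable_mult_indicator[rotated]) simp
    moreover have "(\<lambda>x. indicator ?S x *\<^sub>R (indicator ?K x *\<^sub>R (c i j x * partial i u x * (x $ j / norm x))))
        = (\<lambda>x. indicator ?S x * (c i j x * partial i u x * (x $ j / norm x)))"
      by (auto simp: indicator_def)
    ultimately show ?thesis by simp
  qed
  have Tij: "T i j = (\<integral>x. ?\<phi> x * (partial j (c i j) x * partial i u x) \<partial>lborel)
      - (\<integral>x. indicator ?S x * (c i j x * partial i u x * (x $ j / norm x)) \<partial>lborel) / \<delta>" for i j
  proof -
    have "T i j = (\<integral>x. ?\<phi> x * (partial j (c i j) x * partial i u x)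
        - indicator ?S x * (c i j x * partial i u x * (x $ j / norm x)) / \<delta> \<partial>lborel)"
      unfolding T_def P_def D_def by (intro Bochner_Integration.integral_cong refl) (simp add: algebra_simps)
    also have "\<dots> = (\<integral>x. ?\<phi> x * (partial j (c i j) x * partial i u x) \<partial>lborel)
      - (\<integral>x. indicator ?S x * (c i j x * partial i u x * (x $ j / norm x)) / \<delta> \<partial>lborel)"
      by (rule Bochner_Integration.integral_diff[OF i1 integrable_divide[OF i2]])
    finally show ?thesis by (simp only: integral_divide_zero)
  qed
  have double_sum: "(\<integral>x. (\<Sum>i\<in>UNIV. \<Sum>j\<in>UNIV. F i j x) \<partial>lborel)
      = (\<Sum>i\<in>UNIV. \<Sum>j\<in>UNIV. \<integral>x. F i j x \<partial>lborel)"
    if "\<And>i j. integrable lborel (F i j)" for F :: "'n \<Rightarrow> 'n \<Rightarrow> real^'n \<Rightarrow> real"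
    using that by (simp add: Bochner_Integration.integral_sum Bochner_Integration.integrable_sum)
  have "(\<integral>x. ?\<phi> x * (\<Sum>i\<in>UNIV. \<Sum>j\<in>UNIV. partial j (c i j) x * partial i u x) \<partial>lborel)
      = (\<Sum>i\<in>UNIV. \<Sum>j\<in>UNIV. \<integral>x. ?\<phi> x * (partial j (c i j) x * partial i u x) \<partial>lborel)"
    unfolding sum_distrib_left by (rule double_sum[OF i1])
  moreover have "(\<integral>x. indicator ?S x * (\<Sum>i\<in>UNIV. \<Sum>j\<in>UNIV. c i j x * partial i u x * (x $ j / norm x)) \<partial>lborel)
      = (\<Sum>i\<in>UNIV. \<Sum>j\<in>UNIV. \<integral>x. indicator ?S x * (c i j x * partial i u x * (x $ j / norm x)) \<partial>lborel)"
    unfolding sum_distrib_left by (rule double_sum[OF i2])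
  ultimately show ?thesis
    using T0 by (simp only: Tij sum_subtractf sum_divide_distrib)
qed

text \<open>
  The divergence theorem for the field $Y_j = \sum_i c_{ij} \partial_i u$.  For smooth data the right-hand
  integrand is the divergence of $Y$, because $\sum_{ij} c_{ij} \partial_j\partial_i u = 0$.  Here $Y$ is only continuous,
  and the formula arises as the limit of \<open>cutoff_weak_divergence\<close> as the shell shrinks to the sphere.
\<close>

lemma flux_antisymmetric_eq_integral_cball:
  fixes u :: "real^'n::finite \<Rightarrow> real" and c :: "'n \<Rightarrow> 'n \<Rightarrow> real^'n \<Rightarrow> real"
  assumes u: "C1_map u" and c: "\<And>i j. C1_map (c i j)" and anti: "\<And>i j x. c i j x = - c j i x"
    and r: "r > 0"
  shows "(LINT x:sphere 0 r|sphere_area r. \<Sum>i\<in>UNIV. \<Sum>j\<in>UNIV. c i j x * partial i u x * (x $ j / norm x))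
    = (LINT x:cball 0 r|lborel. \<Sum>i\<in>UNIV. \<Sum>j\<in>UNIV. partial j (c i j) x * partial i u x)"
proof -
  let ?Q = "\<lambda>x. \<Sum>i\<in>UNIV. \<Sum>j\<in>UNIV. partial j (c i j) x * partial i u x"
  define h where "h = (\<lambda>x. \<Sum>i\<in>UNIV. \<Sum>j\<in>UNIV. c i j x * partial i u x * (x $ j / norm x))"
  have contu: "continuous_on UNIV (partial i u)" for i using C1_mapD(3)[OF u] .
  have contc: "continuous_on UNIV (c i j)" "continuous_on UNIV (partial k (c i j))" for i j k
    using C1_mapD(2,3)[OF c] by auto
  have meas[measurable]: "partial i u \<in> borel_measurable borel"
     "c i j \<in> borel_measurable borel" for i j
    using contu contc by (auto intro: borel_measurable_continuous_onI)
  have hm: "h \<in> borel_measurable borel" unfolding h_def by measurable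
  have hc: "continuous_on (- {0}) h"
    unfolding h_def
    by (intro continuous_intros continuous_on_subset[OF contc(1)] continuous_on_subset[OF contu]) auto
  have Qc: "continuous_on UNIV ?Q" by (intro continuous_intros contc contu)
  then have Qm: "?Q \<in> borel_measurable borel" by (rule borel_measurable_continuous_onI)
  define \<delta> where "\<delta> = (\<lambda>k. 1 / real (Suc k))"
  have \<delta>: "\<delta> \<longlonglongrightarrow> 0" "\<And>k. 0 < \<delta> k" "\<And>k. \<delta> k \<le> 1"
    using LIMSEQ_inverse_real_of_nat by (auto simp: \<delta>_def inverse_eq_divide)
  have shell: "(\<lambda>k. (\<integral>x. indicator {x. r < norm x \<and> norm x \<le> r + \<delta> k} x * h x \<partial>lborel) / \<delta> k)
    \<longlonglongrightarrow> (LINT x:sphere 0 r|sphere_area r. h x)"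
    using shell_average_tendsto[OF hm hc r \<delta>(1,2)] integral_sphere_area[OF r hm] by simp
  have ball: "(\<lambda>k. \<integral>x. cutoff r (\<delta> k) x * ?Q x \<partial>lborel) \<longlonglongrightarrow> (LINT x:cball 0 r|lborel. ?Q x)"
    unfolding set_lebesgue_integral_def
  proof (rule integral_dominated_convergence)
    show "integrable lborel (\<lambda>x. norm (indicator (cball 0 (r + 1)) x *\<^sub>R ?Q x))"
      by (intro integrable_norm borel_integrable_compact continuous_on_subset[OF Qc]) auto
    show "(\<lambda>x. indicator (cball 0 r) x *\<^sub>R ?Q x) \<in> borel_measurable lborel"
      using Qm by (intro borel_measurable_scaleR borel_measurable_indicator) auto
    show "(\<lambda>x. cutoff r (\<delta> k) x * ?Q x) \<in> borel_measurable lborel" for k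
      using Qm lipschitz_on_continuous_on[OF cutoff_lipschitz[OF r \<delta>(2), of k]]
      by (intro borel_measurable_times) (auto intro: borel_measurable_continuous_onI)
    show "AE x in lborel. norm (cutoff r (\<delta> k) x * ?Q x) \<le> norm (indicator (cball 0 (r + 1)) x *\<^sub>R ?Q x)" for k
    proof (intro always_eventually allI)
      fix x :: "real^'n"
      show "norm (cutoff r (\<delta> k) x * ?Q x) \<le> norm (indicator (cball 0 (r + 1)) x *\<^sub>R ?Q x)"
      proof (cases "norm x \<le> r + 1")
        case True
        then show ?thesis
          using cutoff_bounds[OF r \<delta>(2)[of k], of x] by (simp add: abs_mult mult_left_le_one_le)
      next
        case False
        then show ?thesis using cutoff_outside[OF r \<delta>(2)[of k], of x] \<delta>(3)[of k] by simp
      qed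
    qed
    show "AE x in lborel. (\<lambda>k. cutoff r (\<delta> k) x * ?Q x) \<longlonglongrightarrow> indicator (cball 0 r) x *\<^sub>R ?Q x"
    proof (intro always_eventually allI)
      fix x :: "real^'n"
      have "(\<lambda>k. cutoff r (\<delta> k) x) \<longlonglongrightarrow> indicator (cball 0 r) x"
      proof (cases "norm x \<le> r")
        case True
        then show ?thesis by (simp add: cutoff_inside[OF r \<delta>(2)])
      next
        case False
        then have "eventually (\<lambda>k. \<delta> k < norm x - r) sequentially"
          by (intro order_tendstoD(2)[OF \<delta>(1)]) simp
        then have "eventually (\<lambda>k. cutoff r (\<delta> k) x = indicator (cball 0 r) x) sequentially"
          by eventually_elim (use False in \<open>simp add: cutoff_outside[OF r \<delta>(2)]\<close>)
        then show ?thesis by (rule tendsto_eventually)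
      qed
      then show "(\<lambda>k. cutoff r (\<delta> k) x * ?Q x) \<longlonglongrightarrow> indicator (cball 0 r) x *\<^sub>R ?Q x"
        unfolding real_scaleR_def by (rule tendsto_mult_right)
    qed
  qed
  have eq: "(\<integral>x. cutoff r (\<delta> k) x * ?Q x \<partial>lborel)
      = (\<integral>x. indicator {x. r < norm x \<and> norm x \<le> r + \<delta> k} x * h x \<partial>lborel) / \<delta> k" for k
    unfolding h_def by (rule cutoff_weak_divergence[OF u c anti r \<delta>(2)])
  show ?thesis
    using LIMSEQ_unique[OF shell ball[unfolded eq]] by (simp only: h_def)
qed

section \<open>The divergence identity in linear algebra\<close>

text \<open>
  The identity behind the mass formula, at one point.  In the application \<open>v \<beta>\<close> is the gradient of
  $f^\beta$ in the metric, \<open>A \<beta>\<close> its shape operator, \<open>W \<beta> \<alpha>\<close> the pairing of \<open>v \<beta>\<close> with $Df^\alpha$, and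
  \<open>dG j i k\<close>, \<open>dv \<alpha> j l\<close> are the derivatives in direction \<open>j\<close> of \<open>G $ i $ k\<close> and of \<open>v \<alpha> $ l\<close>.  The
  first double sum on the right is the scalar curvature and the second one is $S^\perp$.

  The four kinds of terms on the left are computed separately in \<open>T1\<close> to \<open>T4\<close>.  \<open>T2\<close> and \<open>T3\<close> each
  produce a term with a trace and one Hessian evaluated on gradients; these two cancel after summation
  over \<open>\<alpha>\<close> and \<open>\<beta>\<close> (\<open>cancel\<close>).  The products \<open>N \<alpha> \<beta>\<close> come with coefficient $-2$ from \<open>T1\<close> and $+1$
  from \<open>T4\<close>.
\<close>

lemma divergence_algebra:
  fixes G :: "real^'n::finite^'n" and H :: "'m::finite \<Rightarrow> real^'n^'n" and v :: "'m \<Rightarrow> real^'n"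
    and W :: "'m \<Rightarrow> 'm \<Rightarrow> real"
  assumes Gs: "\<And>i j. G $ i $ j = G $ j $ i" and Hs: "\<And>\<alpha> i j. H \<alpha> $ i $ j = H \<alpha> $ j $ i"
  defines "A \<equiv> \<lambda>\<beta>. G ** H \<beta>" and "w \<equiv> \<lambda>\<beta> \<alpha>. H \<beta> *v v \<alpha>"
  defines "dG \<equiv> \<lambda>j i k. - (\<Sum>\<beta>\<in>UNIV. A \<beta> $ i $ j * v \<beta> $ k + v \<beta> $ i * A \<beta> $ k $ j)"
    and "dv \<equiv> \<lambda>\<alpha> j l. A \<alpha> $ l $ j - (\<Sum>\<beta>\<in>UNIV. A \<beta> $ l $ j * W \<beta> \<alpha> + v \<beta> $ l * w \<beta> \<alpha> $ j)"
  shows "(\<Sum>\<alpha>\<in>UNIV. \<Sum>k\<in>UNIV. \<Sum>i\<in>UNIV. \<Sum>j\<in>UNIV.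
       (dG j i k * v \<alpha> $ j + G $ i $ k * dv \<alpha> j j - (dG j j k * v \<alpha> $ i + G $ j $ k * dv \<alpha> j i)) * H \<alpha> $ i $ k)
    = (\<Sum>\<alpha>\<in>UNIV. \<Sum>\<beta>\<in>UNIV. ((if \<alpha> = \<beta> then 1 else 0) - W \<beta> \<alpha>) *
         ((\<Sum>i\<in>UNIV. A \<alpha> $ i $ i) * (\<Sum>i\<in>UNIV. A \<beta> $ i $ i) - (\<Sum>i\<in>UNIV. \<Sum>j\<in>UNIV. A \<alpha> $ j $ i * A \<beta> $ i $ j)))
      + (\<Sum>\<alpha>\<in>UNIV. \<Sum>\<beta>\<in>UNIV. w \<alpha> \<alpha> \<bullet> (G *v w \<beta> \<beta>) - w \<alpha> \<beta> \<bullet> (G *v w \<beta> \<alpha>))"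
proof -
  define t where "t = (\<lambda>\<alpha>. \<Sum>i\<in>UNIV. A \<alpha> $ i $ i)"
  define q where "q = (\<lambda>\<alpha> \<beta>. \<Sum>i\<in>UNIV. \<Sum>j\<in>UNIV. A \<alpha> $ j $ i * A \<beta> $ i $ j)"
  define N where "N = (\<lambda>\<alpha> \<beta>. w \<alpha> \<beta> \<bullet> (G *v w \<beta> \<alpha>))"
  have Gsym: "x \<bullet> (G *v y) = y \<bullet> (G *v x)" for x y
    using Gs
    by (simp add: inner_vec_def matrix_vector_mult_def sum_distrib_left mult_ac) (subst sum.swap, simp add: mult_ac)
  have Hsym: "x \<bullet> (H \<alpha> *v y) = y \<bullet> (H \<alpha> *v x)" for x y \<alpha>
    using Hs
    by (simp add: inner_vec_def matrix_vector_mult_def sum_distrib_left mult_ac) (subst sum.swap, simp add: mult_ac)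
  have Av: "A \<beta> *v v \<alpha> = G *v w \<beta> \<alpha>" for \<alpha> \<beta>
    by (simp add: A_def w_def matrix_vector_mul_assoc)
  have GH: "(\<Sum>k\<in>UNIV. G $ j $ k * H \<alpha> $ i $ k) = A \<alpha> $ j $ i" for \<alpha> i j
    by (simp add: A_def matrix_matrix_mult_def Hs[of \<alpha> i])
  have Hv: "(\<Sum>k\<in>UNIV. H \<alpha> $ i $ k * v \<beta> $ k) = w \<alpha> \<beta> $ i" for \<alpha> \<beta> i
    by (simp add: w_def matrix_vector_mult_def)
  have Av': "(\<Sum>k\<in>UNIV. A \<alpha> $ i $ k * v \<beta> $ k) = (G *v w \<alpha> \<beta>) $ i" for \<alpha> \<beta> i
    using arg_cong[OF Av, of "\<lambda>x. x $ i"] by (simp add: matrix_vector_mult_def)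
  have T1: "(\<Sum>k\<in>UNIV. \<Sum>i\<in>UNIV. \<Sum>j\<in>UNIV. dG j i k * v \<alpha> $ j * H \<alpha> $ i $ k) = - (\<Sum>\<beta>\<in>UNIV. 2 * N \<alpha> \<beta>)" for \<alpha>
  proof -
    have a: "(\<Sum>i\<in>UNIV. \<Sum>k\<in>UNIV. \<Sum>j\<in>UNIV. A \<beta> $ i $ j * v \<beta> $ k * v \<alpha> $ j * H \<alpha> $ i $ k) = N \<alpha> \<beta>" for \<beta>
    proof -
      have "(\<Sum>i\<in>UNIV. \<Sum>k\<in>UNIV. \<Sum>j\<in>UNIV. A \<beta> $ i $ j * v \<beta> $ k * v \<alpha> $ j * H \<alpha> $ i $ k)
          = (\<Sum>i\<in>UNIV. (\<Sum>k\<in>UNIV. H \<alpha> $ i $ k * v \<beta> $ k) * (\<Sum>j\<in>UNIV. A \<beta> $ i $ j * v \<alpha> $ j))"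
        unfolding sum_product by (simp add: mult_ac)
      then show ?thesis by (simp add: Hv Av' N_def inner_vec_def)
    qed
    have b: "(\<Sum>k\<in>UNIV. \<Sum>i\<in>UNIV. \<Sum>j\<in>UNIV. v \<beta> $ i * A \<beta> $ k $ j * v \<alpha> $ j * H \<alpha> $ i $ k) = N \<alpha> \<beta>" for \<beta>
      unfolding a[of \<beta>, symmetric] by (simp add: mult_ac Hs[of \<alpha>])
    have "(\<Sum>k\<in>UNIV. \<Sum>i\<in>UNIV. \<Sum>j\<in>UNIV. dG j i k * v \<alpha> $ j * H \<alpha> $ i $ k)
        = - (\<Sum>k\<in>UNIV. \<Sum>i\<in>UNIV. \<Sum>j\<in>UNIV. \<Sum>\<beta>\<in>UNIV. A \<beta> $ i $ j * v \<beta> $ k * v \<alpha> $ j * H \<alpha> $ i $ k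
            + v \<beta> $ i * A \<beta> $ k $ j * v \<alpha> $ j * H \<alpha> $ i $ k)"
      by (simp add: dG_def sum_negf sum_distrib_right distrib_right)
    also have "\<dots> = - (\<Sum>\<beta>\<in>UNIV. \<Sum>k\<in>UNIV. \<Sum>i\<in>UNIV. \<Sum>j\<in>UNIV. A \<beta> $ i $ j * v \<beta> $ k * v \<alpha> $ j * H \<alpha> $ i $ k
            + v \<beta> $ i * A \<beta> $ k $ j * v \<alpha> $ j * H \<alpha> $ i $ k)"
      by (simp only: sum.swap[where B="UNIV::'m set"])
    also have "\<dots> = - (\<Sum>\<beta>\<in>UNIV. (\<Sum>i\<in>UNIV. \<Sum>k\<in>UNIV. \<Sum>j\<in>UNIV. A \<beta> $ i $ j * v \<beta> $ k * v \<alpha> $ j * H \<alpha> $ i $ k)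
            + (\<Sum>k\<in>UNIV. \<Sum>i\<in>UNIV. \<Sum>j\<in>UNIV. v \<beta> $ i * A \<beta> $ k $ j * v \<alpha> $ j * H \<alpha> $ i $ k))"
      unfolding sum.distrib by (subst (2) sum.swap) (rule refl)
    finally show ?thesis by (simp add: a b)
  qed
  have T2: "(\<Sum>k\<in>UNIV. \<Sum>i\<in>UNIV. \<Sum>j\<in>UNIV. G $ i $ k * dv \<alpha> j j * H \<alpha> $ i $ k)
      = t \<alpha> * (t \<alpha> - (\<Sum>\<beta>\<in>UNIV. t \<beta> * W \<beta> \<alpha> + v \<beta> \<bullet> w \<beta> \<alpha>))" for \<alpha>
  proof -
    have "(\<Sum>k\<in>UNIV. \<Sum>i\<in>UNIV. \<Sum>j\<in>UNIV. G $ i $ k * dv \<alpha> j j * H \<alpha> $ i $ k)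
        = (\<Sum>i\<in>UNIV. \<Sum>k\<in>UNIV. G $ i $ k * H \<alpha> $ i $ k) * (\<Sum>j\<in>UNIV. dv \<alpha> j j)"
      by (subst sum.swap) (simp add: sum_distrib_left sum_distrib_right mult_ac)
    also have "(\<Sum>i\<in>UNIV. \<Sum>k\<in>UNIV. G $ i $ k * H \<alpha> $ i $ k) = t \<alpha>"
      by (simp add: GH t_def)
    also have "(\<Sum>j\<in>UNIV. dv \<alpha> j j) = t \<alpha> - (\<Sum>\<beta>\<in>UNIV. t \<beta> * W \<beta> \<alpha> + v \<beta> \<bullet> w \<beta> \<alpha>)"
      unfolding dv_def sum_subtractf by (subst sum.swap) (simp add: t_def sum.distrib sum_distrib_right inner_vec_def)
    finally show ?thesis .
  qed
  have T3: "(\<Sum>k\<in>UNIV. \<Sum>i\<in>UNIV. \<Sum>j\<in>UNIV. dG j j k * v \<alpha> $ i * H \<alpha> $ i $ k)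
      = - (\<Sum>\<beta>\<in>UNIV. t \<beta> * (v \<beta> \<bullet> w \<alpha> \<alpha>) + w \<alpha> \<alpha> \<bullet> (G *v w \<beta> \<beta>))" for \<alpha>
  proof -
    have dGs: "(\<Sum>j\<in>UNIV. dG j j k) = - (\<Sum>\<beta>\<in>UNIV. t \<beta> * v \<beta> $ k + (G *v w \<beta> \<beta>) $ k)" for k
      unfolding dG_def sum_negf
      by (subst sum.swap) (simp add: t_def sum.distrib sum_distrib_left sum_distrib_right Av'[symmetric] mult.commute)
    have "(\<Sum>k\<in>UNIV. \<Sum>i\<in>UNIV. \<Sum>j\<in>UNIV. dG j j k * v \<alpha> $ i * H \<alpha> $ i $ k)
        = (\<Sum>k\<in>UNIV. (\<Sum>i\<in>UNIV. H \<alpha> $ i $ k * v \<alpha> $ i) * (\<Sum>j\<in>UNIV. dG j j k))"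
      unfolding sum_product by (simp add: mult_ac)
    also have "\<dots> = (\<Sum>k\<in>UNIV. w \<alpha> \<alpha> $ k * (\<Sum>j\<in>UNIV. dG j j k))"
      using Hs[of \<alpha>] by (simp add: Hv[symmetric])
    also have "\<dots> = - (\<Sum>k\<in>UNIV. \<Sum>\<beta>\<in>UNIV. t \<beta> * (v \<beta> $ k * w \<alpha> \<alpha> $ k) + (G *v w \<beta> \<beta>) $ k * w \<alpha> \<alpha> $ k)"
      unfolding dGs by (simp add: sum_distrib_left sum_negf distrib_left mult_ac)
    also have "\<dots> = - (\<Sum>\<beta>\<in>UNIV. t \<beta> * (v \<beta> \<bullet> w \<alpha> \<alpha>) + w \<alpha> \<alpha> \<bullet> (G *v w \<beta> \<beta>))"
      by (subst sum.swap) (simp add: inner_vec_def sum.distrib sum_distrib_left mult.commute)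
    finally show ?thesis .
  qed
  have T4: "(\<Sum>k\<in>UNIV. \<Sum>i\<in>UNIV. \<Sum>j\<in>UNIV. G $ j $ k * dv \<alpha> j i * H \<alpha> $ i $ k)
      = q \<alpha> \<alpha> - (\<Sum>\<beta>\<in>UNIV. W \<beta> \<alpha> * q \<alpha> \<beta> + N \<alpha> \<beta>)" for \<alpha>
  proof -
    have "(\<Sum>k\<in>UNIV. \<Sum>i\<in>UNIV. \<Sum>j\<in>UNIV. G $ j $ k * dv \<alpha> j i * H \<alpha> $ i $ k)
        = (\<Sum>i\<in>UNIV. \<Sum>j\<in>UNIV. \<Sum>k\<in>UNIV. G $ j $ k * dv \<alpha> j i * H \<alpha> $ i $ k)"
      by (subst sum.swap) (intro sum.cong refl sum.swap)
    also have "\<dots> = (\<Sum>i\<in>UNIV. \<Sum>j\<in>UNIV. A \<alpha> $ j $ i * dv \<alpha> j i)"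
      unfolding GH[symmetric] by (simp add: sum_distrib_left sum_distrib_right mult_ac)
    also have "\<dots> = q \<alpha> \<alpha> - (\<Sum>i\<in>UNIV. \<Sum>j\<in>UNIV. \<Sum>\<beta>\<in>UNIV.
         W \<beta> \<alpha> * (A \<alpha> $ j $ i * A \<beta> $ i $ j) + A \<alpha> $ j $ i * v \<beta> $ i * w \<beta> \<alpha> $ j)"
      by (simp add: dv_def q_def right_diff_distrib sum_subtractf sum_distrib_left distrib_left mult_ac)
    also have "(\<Sum>i\<in>UNIV. \<Sum>j\<in>UNIV. \<Sum>\<beta>\<in>UNIV.
         W \<beta> \<alpha> * (A \<alpha> $ j $ i * A \<beta> $ i $ j) + A \<alpha> $ j $ i * v \<beta> $ i * w \<beta> \<alpha> $ j)
       = (\<Sum>\<beta>\<in>UNIV. \<Sum>i\<in>UNIV. \<Sum>j\<in>UNIV.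
         W \<beta> \<alpha> * (A \<alpha> $ j $ i * A \<beta> $ i $ j) + A \<alpha> $ j $ i * v \<beta> $ i * w \<beta> \<alpha> $ j)"
      by (simp only: sum.swap[where B="UNIV::'m set"])
    also have "\<dots> = (\<Sum>\<beta>\<in>UNIV. W \<beta> \<alpha> * q \<alpha> \<beta> + N \<alpha> \<beta>)"
    proof (intro sum.cong refl)
      fix \<beta>
      have "(\<Sum>i\<in>UNIV. \<Sum>j\<in>UNIV. A \<alpha> $ j $ i * v \<beta> $ i * w \<beta> \<alpha> $ j) = (\<Sum>j\<in>UNIV. (G *v w \<alpha> \<beta>) $ j * w \<beta> \<alpha> $ j)"
        by (subst sum.swap) (simp add: Av'[symmetric] sum_distrib_right)
      also have "\<dots> = N \<alpha> \<beta>"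
        unfolding N_def Gsym[of "w \<alpha> \<beta>"] by (simp add: inner_vec_def mult.commute)
      finally show "(\<Sum>i\<in>UNIV. \<Sum>j\<in>UNIV. W \<beta> \<alpha> * (A \<alpha> $ j $ i * A \<beta> $ i $ j) + A \<alpha> $ j $ i * v \<beta> $ i * w \<beta> \<alpha> $ j)
          = W \<beta> \<alpha> * q \<alpha> \<beta> + N \<alpha> \<beta>"
        by (simp add: sum.distrib q_def sum_distrib_left)
    qed
    finally show ?thesis .
  qed
  have cancel: "(\<Sum>\<alpha>\<in>UNIV. \<Sum>\<beta>\<in>UNIV. t \<alpha> * (v \<beta> \<bullet> w \<beta> \<alpha>)) = (\<Sum>\<alpha>\<in>UNIV. \<Sum>\<beta>\<in>UNIV. t \<beta> * (v \<beta> \<bullet> w \<alpha> \<alpha>))"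
    by (subst sum.swap) (intro sum.cong refl arg_cong2[of _ _ _ _ "(*)"], simp add: w_def Hsym)
  have "(\<Sum>\<alpha>\<in>UNIV. \<Sum>k\<in>UNIV. \<Sum>i\<in>UNIV. \<Sum>j\<in>UNIV.
       (dG j i k * v \<alpha> $ j + G $ i $ k * dv \<alpha> j j - (dG j j k * v \<alpha> $ i + G $ j $ k * dv \<alpha> j i)) * H \<alpha> $ i $ k)
    = (\<Sum>\<alpha>\<in>UNIV. - (\<Sum>\<beta>\<in>UNIV. 2 * N \<alpha> \<beta>) + t \<alpha> * (t \<alpha> - (\<Sum>\<beta>\<in>UNIV. t \<beta> * W \<beta> \<alpha> + v \<beta> \<bullet> w \<beta> \<alpha>))
       - (- (\<Sum>\<beta>\<in>UNIV. t \<beta> * (v \<beta> \<bullet> w \<alpha> \<alpha>) + w \<alpha> \<alpha> \<bullet> (G *v w \<beta> \<beta>))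
          + (q \<alpha> \<alpha> - (\<Sum>\<beta>\<in>UNIV. W \<beta> \<alpha> * q \<alpha> \<beta> + N \<alpha> \<beta>))))"
    unfolding T1[symmetric] T2[symmetric] T3[symmetric] T4[symmetric]
    by (simp only: left_diff_distrib distrib_right sum.distrib sum_subtractf)
  also have "\<dots> = (\<Sum>\<alpha>\<in>UNIV. t \<alpha> * t \<alpha> - q \<alpha> \<alpha>) - (\<Sum>\<alpha>\<in>UNIV. \<Sum>\<beta>\<in>UNIV. W \<beta> \<alpha> * (t \<alpha> * t \<beta> - q \<alpha> \<beta>))
      + (\<Sum>\<alpha>\<in>UNIV. \<Sum>\<beta>\<in>UNIV. w \<alpha> \<alpha> \<bullet> (G *v w \<beta> \<beta>) - N \<alpha> \<beta>)"
    using cancel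
    by (simp add: sum.distrib sum_subtractf sum_negf sum_distrib_left[symmetric] right_diff_distrib distrib_left)
       (simp add: sum_distrib_left mult_ac)
  also have "(\<Sum>\<alpha>\<in>UNIV. t \<alpha> * t \<alpha> - q \<alpha> \<alpha>) - (\<Sum>\<alpha>\<in>UNIV. \<Sum>\<beta>\<in>UNIV. W \<beta> \<alpha> * (t \<alpha> * t \<beta> - q \<alpha> \<beta>))
     = (\<Sum>\<alpha>\<in>UNIV. \<Sum>\<beta>\<in>UNIV. ((if \<alpha> = \<beta> then 1 else 0) - W \<beta> \<alpha>) * (t \<alpha> * t \<beta> - q \<alpha> \<beta>))"
    by (simp only: left_diff_distrib sum_subtractf)
       (simp add: if_distrib[of "\<lambda>c. c * _"] sum_subtractf cong: if_cong)
  finally show ?thesis unfolding t_def q_def N_def .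
qed

section \<open>First derivatives of the inverse metric and of the gradients\<close>

locale C2_graph =
  fixes f :: "real^'n::finite \<Rightarrow> real^'m::finite"
  assumes C2: "C2_map f"
begin

abbreviation g :: "real^'n \<Rightarrow> real^'n^'n" where "g \<equiv> induced_metric f"

definition ginv :: "real^'n \<Rightarrow> real^'n^'n" where "ginv x = matrix_inv (g x)"

definition Df :: "'m \<Rightarrow> real^'n \<Rightarrow> real^'n" where "Df \<alpha> x = (\<chi> i. partial i f x $ \<alpha>)"

definition hess :: "'m \<Rightarrow> real^'n \<Rightarrow> real^'n^'n" where
  "hess \<alpha> x = (\<chi> i j. partial i (partial j f) x $ \<alpha>)"

definition grad :: "'m \<Rightarrow> real^'n \<Rightarrow> real^'n" where "grad \<alpha> x = ginv x *v Df \<alpha> x"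

lemma C1_f: "C1_map f" and C1_partial_f: "C1_map (partial i f)"
  using C2 by (auto simp: C2_map_def)

lemmas f_differentiable = C1_mapD(1)[OF C1_f] and partial_f_differentiable = C1_mapD(1)[OF C1_partial_f]

lemma C1_Df: "C1_map (\<lambda>x. Df \<alpha> x $ i)"
  using C1_map_inner_const[OF C1_partial_f, of i "axis \<alpha> 1"] by (simp add: Df_def inner_axis)

lemma partial_Df: "partial k (\<lambda>x. Df \<alpha> x $ i) x = hess \<alpha> x $ k $ i"
  using partial_inner_const[OF partial_f_differentiable, of k i "axis \<alpha> 1" x]
  by (simp add: Df_def hess_def inner_axis)

lemma hess_sym: "hess \<alpha> x $ i $ j = hess \<alpha> x $ j $ i"
  using partial_commute[OF C2, of i j x] by (simp add: hess_def)

lemma hess_cont: "continuous_on UNIV (\<lambda>x. hess \<alpha> x $ i $ j)"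
proof -
  have "partial i (\<lambda>x. Df \<alpha> x $ j) = (\<lambda>x. hess \<alpha> x $ i $ j)" using partial_Df by blast
  then show ?thesis using C1_mapD(3)[OF C1_Df, of i \<alpha> j] by simp
qed

lemma g_eq: "g x $ i $ j = (if i = j then 1 else 0) + (\<Sum>\<alpha>\<in>UNIV. Df \<alpha> x $ i * Df \<alpha> x $ j)"
  using induced_metric_eq[OF f_differentiable] by (simp add: Df_def)

lemma g_sym: "g x $ i $ j = g x $ j $ i"
  unfolding g_eq by (simp add: mult.commute)

lemma g_differentiable: "(\<lambda>x. g x $ i $ j) differentiable (at x)"
  unfolding g_eq
  by (intro differentiable_add differentiable_sum ballI differentiable_mult C1_mapD(1)[OF C1_Df]) auto

lemma partial_g: "partial k (\<lambda>x. g x $ i $ j) x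
  = (\<Sum>\<alpha>\<in>UNIV. hess \<alpha> x $ i $ k * Df \<alpha> x $ j + Df \<alpha> x $ i * hess \<alpha> x $ j $ k)"
proof -
  have "partial k (\<lambda>x. g x $ i $ j) x = partial k (\<lambda>x. \<Sum>\<alpha>\<in>UNIV. Df \<alpha> x $ i * Df \<alpha> x $ j) x"
    unfolding g_eq
    by (rule partial_add_const) (intro differentiable_sum finite ballI differentiable_mult C1_mapD(1)[OF C1_Df])
  also have "\<dots> = (\<Sum>\<alpha>\<in>UNIV. Df \<alpha> x $ i * hess \<alpha> x $ k $ j + hess \<alpha> x $ k $ i * Df \<alpha> x $ j)"
    by (subst partial_sum_mult) (simp_all add: C1_mapD(1)[OF C1_Df] partial_Df)
  finally show ?thesis
    by (simp add: hess_sym[of _ x k] add.commute)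
qed

lemma g_invertible: "invertible (g x)"
  using invertible_induced_metric[OF f_differentiable] .

lemma ginv_left: "(\<Sum>k\<in>UNIV. ginv x $ i $ k * g x $ k $ j) = (if i = j then 1 else 0)"
  using arg_cong[OF matrix_inv_props(2)[OF g_invertible, of x], of "\<lambda>A. A $ i $ j"]
  by (simp add: matrix_matrix_mult_def mat_def ginv_def)

lemma ginv_right: "(\<Sum>k\<in>UNIV. g x $ i $ k * ginv x $ k $ j) = (if i = j then 1 else 0)"
  using arg_cong[OF matrix_inv_props(1)[OF g_invertible, of x], of "\<lambda>A. A $ i $ j"]
  by (simp add: matrix_matrix_mult_def mat_def ginv_def)

lemma ginv_sym: "ginv x $ i $ j = ginv x $ j $ i"
proof -
  have "ginv x $ i $ j = (\<Sum>k\<in>UNIV. (\<Sum>l\<in>UNIV. g x $ k $ l * ginv x $ l $ i) * ginv x $ k $ j)"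
    by (simp add: ginv_right if_distrib[of "\<lambda>c. c * _"] cong: if_cong)
  also have "\<dots> = (\<Sum>l\<in>UNIV. \<Sum>k\<in>UNIV. g x $ k $ l * ginv x $ l $ i * ginv x $ k $ j)"
    by (subst sum.swap) (simp add: sum_distrib_right)
  also have "\<dots> = (\<Sum>l\<in>UNIV. ginv x $ l $ i * (\<Sum>k\<in>UNIV. g x $ l $ k * ginv x $ k $ j))"
    by (simp add: sum_distrib_left mult_ac g_sym)
  also have "\<dots> = ginv x $ j $ i"
    by (simp add: ginv_right if_distrib[of "\<lambda>c. _ * c"] cong: if_cong)
  finally show ?thesis .
qed

text \<open>
  By Cramer's rule the entries of the inverse matrix are quotients of determinants.
\<close>

lemma ginv_differentiable: "(\<lambda>x. ginv x $ i $ j) differentiable (at x)"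
proof -
  have det: "det (g x) \<noteq> 0" for x using g_invertible invertible_det_nz by blast
  define N where "N = (\<lambda>x. (\<chi> a b. if b = i then axis j 1 $ a else g x $ a $ b) :: real^'n^'n)"
  have "ginv x $ i $ j = det (N x) / det (g x)" for x
  proof -
    have "g x *v (\<chi> k. ginv x $ k $ j) = axis j 1"
      using ginv_right by (simp add: matrix_vector_mult_def vec_eq_iff axis_def)
    from iffD1[OF cramer[OF det] this] show ?thesis by (simp add: vec_eq_iff N_def)
  qed
  moreover have "(\<lambda>x. N x $ k $ l) differentiable (at x)" for k l x
    using g_differentiable by (cases "l = i") (simp_all add: N_def)
  ultimately show ?thesis
    by (simp add: det_differentiable g_differentiable det)
qed

lemma ginv_hess: "(\<Sum>l\<in>UNIV. ginv x $ i $ l * hess \<alpha> x $ l $ k) = (ginv x ** hess \<alpha> x) $ i $ k"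
  by (simp add: matrix_matrix_mult_def)

lemma ginv_Df: "(\<Sum>l\<in>UNIV. ginv x $ i $ l * Df \<alpha> x $ l) = grad \<alpha> x $ i"
  by (simp add: grad_def matrix_vector_mult_def)

text \<open>
  The rule $\partial_k G = - G (\partial_k g) G$, obtained by differentiating $G g = 1$.
\<close>

lemma partial_ginv: "partial k (\<lambda>x. ginv x $ i $ j) x =
   - (\<Sum>\<beta>\<in>UNIV. (ginv x ** hess \<beta> x) $ i $ k * grad \<beta> x $ j + grad \<beta> x $ i * (ginv x ** hess \<beta> x) $ j $ k)"
proof -
  let ?d = "\<lambda>l. partial k (\<lambda>x. ginv x $ i $ l) x" and ?e = "\<lambda>l a. partial k (\<lambda>x. g x $ l $ a) x"
  have 0: "(\<Sum>l\<in>UNIV. ?d l * g x $ l $ a) = - (\<Sum>l\<in>UNIV. ginv x $ i $ l * ?e l a)" for a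
  proof -
    have "partial k (\<lambda>x. \<Sum>l\<in>UNIV. ginv x $ i $ l * g x $ l $ a) x = 0"
      unfolding ginv_left by (subst partial_eqI[OF has_derivative_const]) simp
    moreover have "partial k (\<lambda>x. \<Sum>l\<in>UNIV. ginv x $ i $ l * g x $ l $ a) x
        = (\<Sum>l\<in>UNIV. ginv x $ i $ l * ?e l a + ?d l * g x $ l $ a)"
      by (rule partial_sum_mult) (intro ginv_differentiable g_differentiable)+
    ultimately show ?thesis by (simp add: sum.distrib)
  qed
  have "?d j = (\<Sum>l\<in>UNIV. ?d l * (\<Sum>a\<in>UNIV. g x $ l $ a * ginv x $ a $ j))"
    by (simp add: ginv_right if_distrib[of "\<lambda>c. _ * c"] cong: if_cong)
  also have "\<dots> = (\<Sum>a\<in>UNIV. (\<Sum>l\<in>UNIV. ?d l * g x $ l $ a) * ginv x $ a $ j)"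
    by (simp only: sum_distrib_left sum_distrib_right mult.assoc) (rule sum.swap)
  also have "\<dots> = - (\<Sum>a\<in>UNIV. \<Sum>l\<in>UNIV. \<Sum>\<beta>\<in>UNIV. (ginv x $ i $ l * hess \<beta> x $ l $ k) * (ginv x $ j $ a * Df \<beta> x $ a)
         + (ginv x $ i $ l * Df \<beta> x $ l) * (ginv x $ j $ a * hess \<beta> x $ a $ k))"
    unfolding 0 partial_g ginv_sym[of x _ j]
    by (simp add: sum_distrib_left sum_distrib_right sum_negf distrib_left distrib_right mult_ac)
  also have "\<dots> = - (\<Sum>\<beta>\<in>UNIV. \<Sum>a\<in>UNIV. \<Sum>l\<in>UNIV. (ginv x $ i $ l * hess \<beta> x $ l $ k) * (ginv x $ j $ a * Df \<beta> x $ a)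
         + (ginv x $ i $ l * Df \<beta> x $ l) * (ginv x $ j $ a * hess \<beta> x $ a $ k))"
    by (simp only: sum.swap[where B="UNIV::'m set"])
  also have "\<dots> = - (\<Sum>\<beta>\<in>UNIV. (ginv x ** hess \<beta> x) $ i $ k * grad \<beta> x $ j + grad \<beta> x $ i * (ginv x ** hess \<beta> x) $ j $ k)"
    unfolding ginv_hess[symmetric] ginv_Df[symmetric] sum_product sum.distrib
    by (subst (1 2) sum.swap) (rule refl)
  finally show ?thesis .
qed

lemma ginv_cont: "continuous_on UNIV (\<lambda>x. ginv x $ i $ j)"
  using ginv_differentiable by (intro differentiable_imp_continuous_on) (simp add: differentiable_on_def)

lemma Df_cont: "continuous_on UNIV (\<lambda>x. Df \<alpha> x $ i)"
  using C1_mapD(2)[OF C1_Df] .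

lemma shape_cont: "continuous_on UNIV (\<lambda>x. (ginv x ** hess \<alpha> x) $ i $ j)"
  unfolding ginv_hess[symmetric] by (intro continuous_intros ginv_cont hess_cont)

lemma C1_ginv: "C1_map (\<lambda>x. ginv x $ i $ j)"
  by (rule C1_mapI[OF ginv_differentiable partial_ginv])
     (unfold ginv_Df[symmetric], intro continuous_intros ginv_cont Df_cont shape_cont)

lemma C1_grad: "C1_map (\<lambda>x. grad \<alpha> x $ i)"
  unfolding ginv_Df[symmetric] by (intro C1_map_sum C1_map_mult C1_ginv C1_Df)

lemma ginv_hess_Df:
  "(\<Sum>j\<in>UNIV. (ginv x ** hess \<beta> x) $ j $ k * Df \<alpha> x $ j) = (hess \<beta> x *v grad \<alpha> x) $ k"
proof -
  have "(\<Sum>j\<in>UNIV. (ginv x ** hess \<beta> x) $ j $ k * Df \<alpha> x $ j)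
      = (\<Sum>l\<in>UNIV. \<Sum>j\<in>UNIV. hess \<beta> x $ k $ l * (ginv x $ l $ j * Df \<alpha> x $ j))"
    unfolding ginv_hess[symmetric] sum_distrib_right
    by (subst sum.swap) (simp add: ginv_sym hess_sym mult_ac)
  then show ?thesis
    by (simp add: sum_distrib_left[symmetric] ginv_Df matrix_vector_mult_def)
qed

lemma grad_g: "(\<Sum>k\<in>UNIV. grad \<alpha> x $ k * g x $ k $ a) = Df \<alpha> x $ a"
proof -
  have "(\<Sum>k\<in>UNIV. grad \<alpha> x $ k * g x $ k $ a) = (\<Sum>l\<in>UNIV. (\<Sum>k\<in>UNIV. g x $ a $ k * ginv x $ k $ l) * Df \<alpha> x $ l)"
    unfolding ginv_Df[symmetric] g_sym[of x _ a] sum_distrib_left sum_distrib_right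
    by (subst sum.swap) (simp add: mult_ac)
  then show ?thesis by (simp add: ginv_right if_distrib[of "\<lambda>c. c * _"] cong: if_cong)
qed

lemma partial_grad: "partial k (\<lambda>x. grad \<alpha> x $ i) x = (ginv x ** hess \<alpha> x) $ i $ k
   - (\<Sum>\<beta>\<in>UNIV. (ginv x ** hess \<beta> x) $ i $ k * (grad \<beta> x \<bullet> Df \<alpha> x) + grad \<beta> x $ i * (hess \<beta> x *v grad \<alpha> x) $ k)"
proof -
  have "partial k (\<lambda>x. grad \<alpha> x $ i) x = (\<Sum>j\<in>UNIV. ginv x $ i $ j * hess \<alpha> x $ k $ j
        + partial k (\<lambda>x. ginv x $ i $ j) x * Df \<alpha> x $ j)"
    unfolding ginv_Df[symmetric]
    by (subst partial_sum_mult) (simp_all add: ginv_differentiable C1_mapD(1)[OF C1_Df] partial_Df)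
  also have "\<dots> = (ginv x ** hess \<alpha> x) $ i $ k - (\<Sum>j\<in>UNIV. \<Sum>\<beta>\<in>UNIV.
       (ginv x ** hess \<beta> x) $ i $ k * (grad \<beta> x $ j * Df \<alpha> x $ j)
        + grad \<beta> x $ i * ((ginv x ** hess \<beta> x) $ j $ k * Df \<alpha> x $ j))"
    unfolding partial_ginv hess_sym[of \<alpha> x k] sum.distrib ginv_hess
    by (simp add: sum_distrib_right sum_distrib_left sum.distrib sum_negf sum_subtractf
        right_diff_distrib distrib_right mult_ac)
  also have "(\<Sum>j\<in>UNIV. \<Sum>\<beta>\<in>UNIV.
       (ginv x ** hess \<beta> x) $ i $ k * (grad \<beta> x $ j * Df \<alpha> x $ j)
        + grad \<beta> x $ i * ((ginv x ** hess \<beta> x) $ j $ k * Df \<alpha> x $ j))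
     = (\<Sum>\<beta>\<in>UNIV. (ginv x ** hess \<beta> x) $ i $ k * (grad \<beta> x \<bullet> Df \<alpha> x)
         + grad \<beta> x $ i * (\<Sum>j\<in>UNIV. (ginv x ** hess \<beta> x) $ j $ k * Df \<alpha> x $ j))"
    by (subst sum.swap) (simp add: sum.distrib sum_distrib_left inner_vec_def)
  finally show ?thesis by (simp only: ginv_hess_Df)
qed

section \<open>Curvature of the graph as a divergence\<close>

lemma inverse_metric_eq: "inverse_metric g i j x = ginv x $ i $ j"
  by (simp add: inverse_metric_def ginv_def)

lemma tangent_frame_eq: "tangent_frame f j = (\<lambda>y. (axis j 1, partial j f y))"
  using partial_graph_map[OF f_differentiable] by (auto simp: tangent_frame_def)

lemma partial_tangent_frame: "partial i (tangent_frame f j) x = (0, partial i (partial j f) x)"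
  unfolding tangent_frame_eq by (rule partial_Pair_const[OF partial_f_differentiable])

lemma second_derivative_inner_tangent:
  "partial i (tangent_frame f j) x \<bullet> tangent_frame f l x = (\<Sum>\<alpha>\<in>UNIV. hess \<alpha> x $ i $ j * Df \<alpha> x $ l)"
  unfolding partial_tangent_frame by (simp add: tangent_frame_eq hess_def Df_def inner_vec_def)

lemma second_derivative_inner:
  "partial i (tangent_frame f j) x \<bullet> partial k (tangent_frame f l) x
    = (\<Sum>\<alpha>\<in>UNIV. hess \<alpha> x $ i $ j * hess \<alpha> x $ k $ l)"
  unfolding partial_tangent_frame by (simp add: hess_def inner_vec_def)

lemma second_fundamental_form_eq:
  "second_fundamental_form f i j x = partial i (tangent_frame f j) x
    - (\<Sum>k\<in>UNIV. (\<Sum>\<alpha>\<in>UNIV. hess \<alpha> x $ i $ j * grad \<alpha> x $ k) *\<^sub>R tangent_frame f k x)"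
proof -
  have "(\<Sum>l\<in>UNIV. ginv x $ k $ l * (\<Sum>\<alpha>\<in>UNIV. hess \<alpha> x $ i $ j * Df \<alpha> x $ l))
      = (\<Sum>\<alpha>\<in>UNIV. hess \<alpha> x $ i $ j * grad \<alpha> x $ k)" for k
    unfolding ginv_Df[symmetric] sum_distrib_left by (subst sum.swap) (simp add: mult_ac)
  then show ?thesis
    unfolding second_fundamental_form_def inverse_metric_eq second_derivative_inner_tangent scaleR_sum_left[symmetric]
    by simp
qed

lemma second_fundamental_form_normal: "second_fundamental_form f i j x \<bullet> tangent_frame f a x = 0"
proof -
  have inner_g: "tangent_frame f k x \<bullet> tangent_frame f a x = g x $ k $ a" for k
    by (simp add: induced_metric_def)
  have "(\<Sum>k\<in>UNIV. (\<Sum>\<alpha>\<in>UNIV. hess \<alpha> x $ i $ j * grad \<alpha> x $ k) * g x $ k $ a)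
      = (\<Sum>\<alpha>\<in>UNIV. hess \<alpha> x $ i $ j * (\<Sum>k\<in>UNIV. grad \<alpha> x $ k * g x $ k $ a))"
    unfolding sum_distrib_left sum_distrib_right by (subst sum.swap) (simp add: mult_ac)
  then show ?thesis
    by (simp add: grad_g second_fundamental_form_eq inner_diff_left inner_sum_left second_derivative_inner_tangent
        inner_g)
qed

lemma second_fundamental_form_inner_normal_frame:
  "second_fundamental_form f i j x \<bullet> normal_frame f \<alpha> x = hess \<alpha> x $ i $ j"
proof -
  have "tangent_frame f k x \<bullet> normal_frame f \<alpha> x = 0" for k
    by (simp add: tangent_frame_eq normal_frame_def inner_axis inner_axis')
  then show ?thesis
    by (simp add: second_fundamental_form_eq inner_diff_left inner_sum_left partial_tangent_frame)
       (simp add: normal_frame_def inner_axis hess_def)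
qed

lemma grad_inner_Df_sym: "grad \<alpha> x \<bullet> Df \<beta> x = grad \<beta> x \<bullet> Df \<alpha> x"
  unfolding inner_vec_def ginv_Df[symmetric] sum_distrib_right inner_real_def
  by (subst sum.swap) (simp add: ginv_sym mult_ac)

text \<open>
  Only one of the two factors needs to be projected, the other one being normal already.  The matrix
  $\delta_{\alpha\beta} - \langle \nabla f^\beta, Df^\alpha \rangle$ is the inverse of the Gram matrix of the normal frame.
\<close>

lemma second_fundamental_form_inner:
  "second_fundamental_form f i j x \<bullet> second_fundamental_form f k l x
    = (\<Sum>\<alpha>\<in>UNIV. \<Sum>\<beta>\<in>UNIV. ((if \<alpha> = \<beta> then 1 else 0) - grad \<beta> x \<bullet> Df \<alpha> x) * (hess \<alpha> x $ i $ j * hess \<beta> x $ k $ l))"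
proof -
  have "second_fundamental_form f i j x \<bullet> second_fundamental_form f k l x
      = second_fundamental_form f i j x \<bullet> partial k (tangent_frame f l) x"
    unfolding second_fundamental_form_eq[of k]
    by (simp add: inner_diff_right inner_sum_right second_fundamental_form_normal)
  also have "\<dots> = (\<Sum>\<alpha>\<in>UNIV. hess \<alpha> x $ i $ j * hess \<alpha> x $ k $ l)
      - (\<Sum>a\<in>UNIV. (\<Sum>\<alpha>\<in>UNIV. hess \<alpha> x $ i $ j * grad \<alpha> x $ a) * (\<Sum>\<beta>\<in>UNIV. hess \<beta> x $ k $ l * Df \<beta> x $ a))"
    unfolding second_fundamental_form_eq[of i]
    by (simp add: inner_diff_left inner_sum_left second_derivative_inner second_derivative_inner_tangent
        inner_commute[of "tangent_frame f _ x"])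
  also have "(\<Sum>a\<in>UNIV. (\<Sum>\<alpha>\<in>UNIV. hess \<alpha> x $ i $ j * grad \<alpha> x $ a) * (\<Sum>\<beta>\<in>UNIV. hess \<beta> x $ k $ l * Df \<beta> x $ a))
     = (\<Sum>\<alpha>\<in>UNIV. \<Sum>\<beta>\<in>UNIV. (grad \<alpha> x \<bullet> Df \<beta> x) * (hess \<alpha> x $ i $ j * hess \<beta> x $ k $ l))"
    unfolding sum_product
    by (simp only: sum.swap[where B="UNIV::'m set" and A="UNIV::'n set"])
       (simp add: inner_vec_def sum_distrib_left sum_distrib_right mult_ac)
  finally show ?thesis
    by (simp add: grad_inner_Df_sym left_diff_distrib sum_subtractf if_distrib[of "\<lambda>c. c * _"] cong: if_cong)
qed

lemma scalar_curvature_eq: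
  "scalar_curvature f x = (\<Sum>\<alpha>\<in>UNIV. \<Sum>\<beta>\<in>UNIV. ((if \<alpha> = \<beta> then 1 else 0) - grad \<beta> x \<bullet> Df \<alpha> x) *
     ((\<Sum>i\<in>UNIV. (ginv x ** hess \<alpha> x) $ i $ i) * (\<Sum>i\<in>UNIV. (ginv x ** hess \<beta> x) $ i $ i)
       - (\<Sum>i\<in>UNIV. \<Sum>j\<in>UNIV. (ginv x ** hess \<alpha> x) $ j $ i * (ginv x ** hess \<beta> x) $ i $ j)))"
proof -
  define U where "U = (\<lambda>\<alpha> \<beta>. (if \<alpha> = \<beta> then 1 else 0) - grad \<beta> x \<bullet> Df \<alpha> x)"
  let ?A = "\<lambda>\<alpha>. ginv x ** hess \<alpha> x"
  have c: "curvature_tensor f i j k l x = (\<Sum>\<alpha>\<in>UNIV. \<Sum>\<beta>\<in>UNIV. U \<alpha> \<beta> *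
      (hess \<alpha> x $ i $ l * hess \<beta> x $ j $ k - hess \<alpha> x $ i $ k * hess \<beta> x $ j $ l))" for i j k l
    unfolding curvature_tensor_def second_fundamental_form_inner U_def
    by (simp add: right_diff_distrib sum_subtractf)
  have "scalar_curvature f x = (\<Sum>i\<in>UNIV. \<Sum>j\<in>UNIV. \<Sum>k\<in>UNIV. \<Sum>l\<in>UNIV. \<Sum>\<alpha>\<in>UNIV. \<Sum>\<beta>\<in>UNIV.
      U \<alpha> \<beta> * (ginv x $ i $ l * ginv x $ j $ k *
      (hess \<alpha> x $ i $ l * hess \<beta> x $ j $ k - hess \<alpha> x $ i $ k * hess \<beta> x $ j $ l)))"
    unfolding scalar_curvature_def inverse_metric_eq c by (simp add: sum_distrib_left mult_ac)
  also have "\<dots> = (\<Sum>\<alpha>\<in>UNIV. \<Sum>\<beta>\<in>UNIV. \<Sum>i\<in>UNIV. \<Sum>j\<in>UNIV. \<Sum>k\<in>UNIV. \<Sum>l\<in>UNIV.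
      U \<alpha> \<beta> * (ginv x $ i $ l * ginv x $ j $ k *
      (hess \<alpha> x $ i $ l * hess \<beta> x $ j $ k - hess \<alpha> x $ i $ k * hess \<beta> x $ j $ l)))"
    by (simp only: sum.swap[where B="UNIV::'m set" and A="UNIV::'n set"])
  also have "\<dots> = (\<Sum>\<alpha>\<in>UNIV. \<Sum>\<beta>\<in>UNIV. U \<alpha> \<beta> * (
      (\<Sum>i\<in>UNIV. \<Sum>j\<in>UNIV. (\<Sum>k\<in>UNIV. ginv x $ j $ k * hess \<beta> x $ k $ j) * (\<Sum>l\<in>UNIV. ginv x $ i $ l * hess \<alpha> x $ l $ i))
    - (\<Sum>i\<in>UNIV. \<Sum>j\<in>UNIV. (\<Sum>k\<in>UNIV. ginv x $ j $ k * hess \<alpha> x $ k $ i) * (\<Sum>l\<in>UNIV. ginv x $ i $ l * hess \<beta> x $ l $ j))))"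
    unfolding sum_product by (simp add: hess_sym right_diff_distrib sum_subtractf sum_distrib_left mult_ac)
  also have "\<dots> = (\<Sum>\<alpha>\<in>UNIV. \<Sum>\<beta>\<in>UNIV. U \<alpha> \<beta> * (
      (\<Sum>i\<in>UNIV. ?A \<alpha> $ i $ i) * (\<Sum>i\<in>UNIV. ?A \<beta> $ i $ i)
    - (\<Sum>i\<in>UNIV. \<Sum>j\<in>UNIV. ?A \<alpha> $ j $ i * ?A \<beta> $ i $ j)))"
    unfolding ginv_hess sum_product by (simp add: mult.commute)
  finally show ?thesis unfolding U_def .
qed

lemma shape_operator_eq: "shape_operator f \<alpha> x = ginv x ** hess \<alpha> x"
  by (simp add: shape_operator_def inverse_metric_eq second_fundamental_form_inner_normal_frame
      vec_eq_iff matrix_matrix_mult_def)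

lemma metric_gradient_eq: "metric_gradient f \<alpha> x = grad \<alpha> x"
  by (simp add: metric_gradient_def inverse_metric_eq vec_eq_iff ginv_Df[symmetric] Df_def)

lemma metric_inner_ginv: "metric_inner g x (ginv x *v a) (ginv x *v b) = a \<bullet> (ginv x *v b)"
proof -
  have "metric_inner g x (ginv x *v a) (ginv x *v b) = (ginv x *v b) \<bullet> (g x *v (ginv x *v a))"
    unfolding metric_inner_def inner_vec_def matrix_vector_mult_def[of "g x"] vec_lambda_beta inner_real_def
    by (subst sum.swap) (simp add: sum_distrib_left g_sym mult_ac)
  also have "g x *v (ginv x *v a) = a"
    using matrix_inv_props(1)[OF g_invertible, of x] by (simp add: matrix_vector_mul_assoc ginv_def)
  finally show ?thesis by (simp add: inner_commute)
qed

lemma S_perp_eq: "S_perp f x = (\<Sum>\<alpha>\<in>UNIV. \<Sum>\<beta>\<in>UNIV.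
    (hess \<alpha> x *v grad \<alpha> x) \<bullet> (ginv x *v (hess \<beta> x *v grad \<beta> x))
  - (hess \<alpha> x *v grad \<beta> x) \<bullet> (ginv x *v (hess \<beta> x *v grad \<alpha> x)))"
  unfolding S_perp_def shape_operator_eq metric_gradient_eq matrix_vector_mul_assoc[symmetric] metric_inner_ginv ..

text \<open>
  The coefficient of $f^\alpha_{ik}$ in the component $Y^j$ of the field whose divergence is $S + S^\perp$.
\<close>

definition flux_coeff :: "'m \<Rightarrow> 'n \<Rightarrow> 'n \<Rightarrow> 'n \<Rightarrow> real^'n \<Rightarrow> real" where
  "flux_coeff \<alpha> k i j x = ginv x $ i $ k * grad \<alpha> x $ j - ginv x $ j $ k * grad \<alpha> x $ i"

lemma C1_flux_coeff: "C1_map (flux_coeff \<alpha> k i j)"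
  unfolding flux_coeff_def[abs_def] by (intro C1_map_diff C1_map_mult C1_ginv C1_grad)

lemma partial_flux_coeff: "partial l (flux_coeff \<alpha> k i j) x =
     partial l (\<lambda>x. ginv x $ i $ k) x * grad \<alpha> x $ j + ginv x $ i $ k * partial l (\<lambda>x. grad \<alpha> x $ j) x
   - (partial l (\<lambda>x. ginv x $ j $ k) x * grad \<alpha> x $ i + ginv x $ j $ k * partial l (\<lambda>x. grad \<alpha> x $ i) x)"
  unfolding flux_coeff_def[abs_def]
  by (subst partial_diff; (intro differentiable_mult C1_mapD(1)[OF C1_ginv] C1_mapD(1)[OF C1_grad])?)
     (simp add: partial_mult C1_mapD(1)[OF C1_ginv] C1_mapD(1)[OF C1_grad] add.commute)

lemma divergence_eq_curvatures:
  "(\<Sum>\<alpha>\<in>UNIV. \<Sum>k\<in>UNIV. \<Sum>i\<in>UNIV. \<Sum>j\<in>UNIV. partial j (flux_coeff \<alpha> k i j) x * hess \<alpha> x $ i $ k)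
    = scalar_curvature f x + S_perp f x"
  unfolding partial_flux_coeff partial_ginv partial_grad scalar_curvature_eq S_perp_eq
  by (rule divergence_algebra) (rule ginv_sym hess_sym)+

text \<open>
  The divergence theorem is applied separately for each \<open>\<alpha>\<close> and \<open>k\<close>, to the function $f^\alpha_k$, whose
  first derivatives are the Hessian entries $f^\alpha_{ik}$.
\<close>

lemma integral_curvatures_eq_flux:
  assumes "r > 0"
  shows "(LINT x:cball 0 r|lborel. scalar_curvature f x + S_perp f x)
    = (\<Sum>\<alpha>\<in>UNIV. \<Sum>k\<in>UNIV. LINT x:sphere 0 r|sphere_area r.
         \<Sum>i\<in>UNIV. \<Sum>j\<in>UNIV. flux_coeff \<alpha> k i j x * hess \<alpha> x $ i $ k * (x $ j / norm x))"
proof -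
  have u: "C1_map (\<lambda>x. Df \<alpha> x $ k)" for \<alpha> k by (rule C1_Df)
  have anti: "flux_coeff \<alpha> k i j x = - flux_coeff \<alpha> k j i x" for \<alpha> k i j x by (simp add: flux_coeff_def)
  have int: "set_integrable lborel (cball 0 r) (\<lambda>x. \<Sum>i\<in>UNIV. \<Sum>j\<in>UNIV. partial j (flux_coeff \<alpha> k i j) x * hess \<alpha> x $ i $ k)" for \<alpha> k
  proof -
    have "continuous_on UNIV (\<lambda>x. \<Sum>i\<in>UNIV. \<Sum>j\<in>UNIV. partial j (flux_coeff \<alpha> k i j) x * hess \<alpha> x $ i $ k)"
      by (intro continuous_on_sum continuous_on_mult C1_mapD(3)[OF C1_flux_coeff] hess_cont)
    then show ?thesis
      unfolding set_integrable_def
      by (rule borel_integrable_compact[OF compact_cball continuous_on_subset[OF _ subset_UNIV]])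
  qed
  have "(LINT x:cball 0 r|lborel. scalar_curvature f x + S_perp f x)
    = (\<Sum>\<alpha>\<in>UNIV. \<Sum>k\<in>UNIV. LINT x:cball 0 r|lborel.
         \<Sum>i\<in>UNIV. \<Sum>j\<in>UNIV. partial j (flux_coeff \<alpha> k i j) x * hess \<alpha> x $ i $ k)"
    using int
    unfolding divergence_eq_curvatures[symmetric] set_lebesgue_integral_def set_integrable_def
      scaleR_sum_right[of _ _ "UNIV::'m set"] scaleR_sum_right[of _ "\<lambda>k. \<Sum>i\<in>UNIV. _ k i" "UNIV::'n set"]
    by (simp only: Bochner_Integration.integral_sum Bochner_Integration.integrable_sum)
  then show ?thesis
    using flux_antisymmetric_eq_integral_cball[OF u C1_flux_coeff anti assms]
    by (simp only: partial_Df)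
qed

end

section \<open>The flux of the metric compared with that of the curvature field\<close>

context C2_graph
begin

lemma g_vector: "g x *v z = z + (\<Sum>\<alpha>\<in>UNIV. (Df \<alpha> x \<bullet> z) *\<^sub>R Df \<alpha> x)"
proof -
  have "(\<Sum>j\<in>UNIV. \<Sum>\<alpha>\<in>UNIV. Df \<alpha> x $ i * Df \<alpha> x $ j * z $ j) = (\<Sum>\<alpha>\<in>UNIV. (Df \<alpha> x \<bullet> z) * Df \<alpha> x $ i)" for i
    by (subst sum.swap) (simp add: inner_vec_def sum_distrib_left sum_distrib_right mult_ac)
  then show ?thesis
    by (simp add: vec_eq_iff matrix_vector_mult_def g_eq distrib_right sum.distrib sum_distrib_right
        if_distrib[of "\<lambda>c. c * _"] cong: if_cong)
qed

text \<open>
  The metric dominates the Euclidean one, as $g - 1$ is a sum of squares.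
\<close>

lemma ginv_nonexpansive: "norm (ginv x *v z) \<le> norm z"
proof -
  let ?y = "ginv x *v z"
  have "g x *v ?y = z"
    using matrix_inv_props(1)[OF g_invertible, of x] by (simp add: matrix_vector_mul_assoc ginv_def)
  then have "?y \<bullet> z = ?y \<bullet> (?y + (\<Sum>\<alpha>\<in>UNIV. (Df \<alpha> x \<bullet> ?y) *\<^sub>R Df \<alpha> x))"
    by (simp only: g_vector)
  also have "\<dots> = ?y \<bullet> ?y + (\<Sum>\<alpha>\<in>UNIV. (Df \<alpha> x \<bullet> ?y)\<^sup>2)"
    by (simp add: inner_add_right inner_sum_right power2_eq_square inner_commute)
  finally have "?y \<bullet> z = ?y \<bullet> ?y + (\<Sum>\<alpha>\<in>UNIV. (Df \<alpha> x \<bullet> ?y)\<^sup>2)" .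
  then have "norm ?y * norm ?y \<le> ?y \<bullet> z"
    by (simp add: power2_norm_eq_inner[symmetric] power2_eq_square sum_nonneg)
  also have "\<dots> \<le> norm ?y * norm z" by (rule norm_cauchy_schwarz)
  finally show ?thesis by (cases "norm ?y = 0") simp_all
qed

lemma abs_ginv_le: "\<bar>ginv x $ i $ j\<bar> \<le> 1"
proof -
  have "\<bar>(ginv x *v axis j 1) $ i\<bar> \<le> norm (ginv x *v axis j 1)" by (rule component_le_norm_cart)
  also have "\<dots> \<le> 1" using ginv_nonexpansive[of x "axis j 1"] by simp
  finally show ?thesis by (simp add: matrix_vector_mult_basis column_def)
qed

text \<open>
  What \<open>flux_coeff\<close> becomes when the inverse metric is replaced by the identity.
\<close>

definition flat_flux_coeff :: "'m \<Rightarrow> 'n \<Rightarrow> 'n \<Rightarrow> 'n \<Rightarrow> real^'n \<Rightarrow> real" where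
  "flat_flux_coeff \<alpha> k i j x = (if i = k then Df \<alpha> x $ j else 0) - (if j = k then Df \<alpha> x $ i else 0)"

lemma flux_density_metric:
  "(\<Sum>i\<in>UNIV. \<Sum>j\<in>UNIV. (partial i (\<lambda>y. g y $ i $ j) x - partial j (\<lambda>y. g y $ i $ i) x) * c j)
   = (\<Sum>\<alpha>\<in>UNIV. \<Sum>k\<in>UNIV. \<Sum>i\<in>UNIV. \<Sum>j\<in>UNIV. flat_flux_coeff \<alpha> k i j x * hess \<alpha> x $ i $ k * c j)"
proof -
  have "(\<Sum>k\<in>UNIV. flat_flux_coeff \<alpha> k i j x * hess \<alpha> x $ i $ k * c j)
      = (hess \<alpha> x $ i $ i * Df \<alpha> x $ j - Df \<alpha> x $ i * hess \<alpha> x $ i $ j) * c j" for \<alpha> i j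
  proof -
    have eq: "flat_flux_coeff \<alpha> k i j x * hess \<alpha> x $ i $ k * c j = (if i = k then Df \<alpha> x $ j * hess \<alpha> x $ i $ i * c j else 0)
        - (if j = k then Df \<alpha> x $ i * hess \<alpha> x $ i $ j * c j else 0)" for k
      by (simp add: flat_flux_coeff_def algebra_simps)
    show ?thesis unfolding eq sum_subtractf by (simp add: algebra_simps)
  qed
  moreover have "(\<Sum>\<alpha>\<in>UNIV. \<Sum>k\<in>UNIV. \<Sum>i\<in>UNIV. \<Sum>j\<in>UNIV. flat_flux_coeff \<alpha> k i j x * hess \<alpha> x $ i $ k * c j)
      = (\<Sum>i\<in>UNIV. \<Sum>j\<in>UNIV. \<Sum>\<alpha>\<in>UNIV. \<Sum>k\<in>UNIV. flat_flux_coeff \<alpha> k i j x * hess \<alpha> x $ i $ k * c j)"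
  proof -
    have "(\<Sum>\<alpha>\<in>UNIV. \<Sum>k\<in>UNIV. \<Sum>i\<in>UNIV. \<Sum>j\<in>UNIV. flat_flux_coeff \<alpha> k i j x * hess \<alpha> x $ i $ k * c j)
        = (\<Sum>\<alpha>\<in>UNIV. \<Sum>i\<in>UNIV. \<Sum>j\<in>UNIV. \<Sum>k\<in>UNIV. flat_flux_coeff \<alpha> k i j x * hess \<alpha> x $ i $ k * c j)"
      by (subst sum.swap) (intro sum.cong refl sum.swap)
    then show ?thesis by (simp only: sum.swap[where A="UNIV::'m set" and B="UNIV::'n set"])
  qed
  ultimately show ?thesis
    by (simp add: partial_g sum_subtractf[symmetric] sum_distrib_right)
       (simp add: hess_sym left_diff_distrib right_diff_distrib mult_ac)
qed

text \<open>
  From $G g = 1$ one gets $G - 1 = - G (g - 1)$, which is of second order in $Df$ because the entries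
  of $G$ are at most 1.  So $G$ and $\nabla f$ differ from $1$ and $Df$ by terms of order 2 and 3.
\<close>

lemma flux_coefficient_bounds:
  assumes a: "\<And>\<alpha> i. \<bar>Df \<alpha> x $ i\<bar> \<le> a"
  shows "\<bar>grad \<alpha> x $ i\<bar> \<le> real CARD('n) * a"
    and "\<bar>flux_coeff \<alpha> k i j x - flat_flux_coeff \<alpha> k i j x\<bar> \<le> 4 * (real CARD('n))\<^sup>2 * real CARD('m) * a ^ 3"
proof -
  let ?n = "real CARD('n)" and ?m = "real CARD('m)"
  have a0: "0 \<le> a" using a[of undefined undefined] by linarith
  have grad: "\<bar>grad \<alpha> x $ i\<bar> \<le> ?n * a" for i
  proof -
    have "\<bar>grad \<alpha> x $ i\<bar> \<le> (\<Sum>l\<in>UNIV. \<bar>ginv x $ i $ l\<bar> * \<bar>Df \<alpha> x $ l\<bar>)"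
      unfolding ginv_Df[symmetric] abs_mult[symmetric] by (rule sum_abs)
    also have "\<dots> \<le> (\<Sum>l\<in>(UNIV::'n set). 1 * a)"
      using a0 by (intro sum_mono mult_mono abs_ginv_le a) auto
    finally show ?thesis by simp
  qed
  then show "\<bar>grad \<alpha> x $ i\<bar> \<le> ?n * a" .
  let ?d = "\<lambda>i k. if i = k then 1 else (0::real)"
  have ginv: "\<bar>ginv x $ i $ k - ?d i k\<bar> \<le> ?n * (?m * a\<^sup>2)" for i k
  proof -
    have "?d i k = (\<Sum>l\<in>UNIV. ginv x $ i $ l * (?d l k + (\<Sum>\<alpha>\<in>UNIV. Df \<alpha> x $ l * Df \<alpha> x $ k)))"
      using ginv_left[of x i k] by (simp add: g_eq)
    also have "\<dots> = ginv x $ i $ k + (\<Sum>l\<in>UNIV. ginv x $ i $ l * (\<Sum>\<alpha>\<in>UNIV. Df \<alpha> x $ l * Df \<alpha> x $ k))"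
      by (simp add: distrib_left sum.distrib if_distrib[of "\<lambda>c. _ * c"] cong: if_cong)
    finally have "\<bar>ginv x $ i $ k - ?d i k\<bar> = \<bar>\<Sum>l\<in>UNIV. ginv x $ i $ l * (\<Sum>\<alpha>\<in>UNIV. Df \<alpha> x $ l * Df \<alpha> x $ k)\<bar>"
      by linarith
    also have "\<dots> \<le> (\<Sum>l\<in>UNIV. \<bar>ginv x $ i $ l\<bar> * \<bar>\<Sum>\<alpha>\<in>UNIV. Df \<alpha> x $ l * Df \<alpha> x $ k\<bar>)"
      unfolding abs_mult[symmetric] by (rule sum_abs)
    also have "\<dots> \<le> (\<Sum>l\<in>(UNIV::'n set). 1 * (?m * a\<^sup>2))"
    proof (intro sum_mono mult_mono abs_ginv_le)
      fix l
      have "\<bar>\<Sum>\<alpha>\<in>UNIV. Df \<alpha> x $ l * Df \<alpha> x $ k\<bar> \<le> (\<Sum>\<alpha>\<in>UNIV. \<bar>Df \<alpha> x $ l\<bar> * \<bar>Df \<alpha> x $ k\<bar>)"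
        unfolding abs_mult[symmetric] by (rule sum_abs)
      also have "\<dots> \<le> (\<Sum>\<alpha>\<in>(UNIV::'m set). a * a)"
        using a0 by (intro sum_mono mult_mono a) auto
      finally show "\<bar>\<Sum>\<alpha>\<in>UNIV. Df \<alpha> x $ l * Df \<alpha> x $ k\<bar> \<le> ?m * a\<^sup>2" by (simp add: power2_eq_square)
    qed auto
    finally show ?thesis by simp
  qed
  have graddiff: "\<bar>grad \<alpha> x $ j - Df \<alpha> x $ j\<bar> \<le> ?n * (?n * (?m * a\<^sup>2) * a)" for j
  proof -
    have "grad \<alpha> x $ j - Df \<alpha> x $ j = (\<Sum>k\<in>UNIV. (ginv x $ j $ k - ?d j k) * Df \<alpha> x $ k)"
      unfolding ginv_Df[symmetric] by (simp add: left_diff_distrib sum_subtractf if_distrib[of "\<lambda>c. c * _"] cong: if_cong)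
    also have "\<bar>\<dots>\<bar> \<le> (\<Sum>k\<in>UNIV. \<bar>ginv x $ j $ k - ?d j k\<bar> * \<bar>Df \<alpha> x $ k\<bar>)"
      unfolding abs_mult[symmetric] by (rule sum_abs)
    also have "\<dots> \<le> (\<Sum>k\<in>(UNIV::'n set). ?n * (?m * a\<^sup>2) * a)"
      using a0 by (intro sum_mono mult_mono ginv a) auto
    finally show ?thesis by simp
  qed
  have half: "\<bar>ginv x $ i $ k * grad \<alpha> x $ j - (if i = k then Df \<alpha> x $ j else 0)\<bar> \<le> 2 * ?n\<^sup>2 * ?m * a ^ 3" for i j k
  proof -
    have "ginv x $ i $ k * grad \<alpha> x $ j - (if i = k then Df \<alpha> x $ j else 0)
        = (ginv x $ i $ k - ?d i k) * grad \<alpha> x $ j + ?d i k * (grad \<alpha> x $ j - Df \<alpha> x $ j)"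
      by (simp add: algebra_simps)
    also have "\<bar>\<dots>\<bar> \<le> \<bar>ginv x $ i $ k - ?d i k\<bar> * \<bar>grad \<alpha> x $ j\<bar> + \<bar>?d i k\<bar> * \<bar>grad \<alpha> x $ j - Df \<alpha> x $ j\<bar>"
      unfolding abs_mult[symmetric] by (rule abs_triangle_ineq)
    also have "\<dots> \<le> (?n * (?m * a\<^sup>2)) * (?n * a) + 1 * (?n * (?n * (?m * a\<^sup>2) * a))"
      using a0 by (intro add_mono mult_mono ginv grad graddiff) auto
    also have "\<dots> = 2 * ?n\<^sup>2 * ?m * a ^ 3" by (simp add: power2_eq_square power3_eq_cube)
    finally show ?thesis .
  qed
  show "\<bar>flux_coeff \<alpha> k i j x - flat_flux_coeff \<alpha> k i j x\<bar> \<le> 4 * ?n\<^sup>2 * ?m * a ^ 3"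
    using half[of i k j] half[of j k i] unfolding flux_coeff_def flat_flux_coeff_def by linarith
qed

lemma S_perp_bound:
  assumes a: "\<And>\<alpha> i. \<bar>Df \<alpha> x $ i\<bar> \<le> a" and b: "\<And>\<alpha> i j. \<bar>hess \<alpha> x $ i $ j\<bar> \<le> b"
  shows "\<bar>S_perp f x\<bar> \<le> (real CARD('m))\<^sup>2 * (2 * ((real CARD('n)) ^ 3 * b * a)\<^sup>2)"
proof -
  let ?n = "real CARD('n)" and ?m = "real CARD('m)"
  have a0: "0 \<le> a" using a[of undefined undefined] by linarith
  have b0: "0 \<le> b" using b[of undefined undefined undefined] by linarith
  define N where "N = ?n ^ 3 * b * a"
  have w: "norm (hess \<alpha> x *v grad \<beta> x) \<le> N" for \<alpha> \<beta>
  proof -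
    have "\<bar>(hess \<alpha> x *v grad \<beta> x) $ i\<bar> \<le> ?n * (b * (?n * a))" for i
    proof -
      have "\<bar>(hess \<alpha> x *v grad \<beta> x) $ i\<bar> \<le> (\<Sum>j\<in>UNIV. \<bar>hess \<alpha> x $ i $ j\<bar> * \<bar>grad \<beta> x $ j\<bar>)"
        unfolding matrix_vector_mult_def vec_lambda_beta abs_mult[symmetric] by (rule sum_abs)
      also have "\<dots> \<le> (\<Sum>j\<in>(UNIV::'n set). b * (?n * a))"
        using b0 by (intro sum_mono mult_mono b flux_coefficient_bounds(1) a) auto
      finally show ?thesis by simp
    qed
    then have "(\<Sum>i\<in>UNIV. \<bar>(hess \<alpha> x *v grad \<beta> x) $ i\<bar>) \<le> (\<Sum>i\<in>(UNIV::'n set). ?n * (b * (?n * a)))"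
      by (intro sum_mono)
    then show ?thesis
      using norm_le_l1_cart[of "hess \<alpha> x *v grad \<beta> x"] by (simp add: N_def power3_eq_cube mult_ac)
  qed
  have N0: "0 \<le> N" using a0 b0 by (simp add: N_def)
  have ip: "\<bar>(hess \<alpha> x *v grad \<beta> x) \<bullet> (ginv x *v (hess \<gamma> x *v grad \<delta> x))\<bar> \<le> N\<^sup>2" for \<alpha> \<beta> \<gamma> \<delta>
  proof -
    have "\<bar>(hess \<alpha> x *v grad \<beta> x) \<bullet> (ginv x *v (hess \<gamma> x *v grad \<delta> x))\<bar>
       \<le> norm (hess \<alpha> x *v grad \<beta> x) * norm (ginv x *v (hess \<gamma> x *v grad \<delta> x))"
      by (rule Cauchy_Schwarz_ineq2)
    also have "\<dots> \<le> N * N"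
      using N0 by (intro mult_mono w order_trans[OF ginv_nonexpansive w]) auto
    finally show ?thesis by (simp add: power2_eq_square)
  qed
  have "\<bar>S_perp f x\<bar> \<le> (\<Sum>\<alpha>\<in>(UNIV::'m set). \<Sum>\<beta>\<in>(UNIV::'m set). 2 * N\<^sup>2)"
    unfolding S_perp_eq
  proof (intro order_trans[OF sum_abs] sum_mono)
    fix \<alpha> \<beta>
    show "\<bar>(hess \<alpha> x *v grad \<alpha> x) \<bullet> (ginv x *v (hess \<beta> x *v grad \<beta> x))
        - (hess \<alpha> x *v grad \<beta> x) \<bullet> (ginv x *v (hess \<beta> x *v grad \<alpha> x))\<bar> \<le> 2 * N\<^sup>2"
      using ip[of \<alpha> \<alpha> \<beta> \<beta>] ip[of \<alpha> \<beta> \<beta> \<alpha>] by linarith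
  qed
  then show ?thesis by (simp add: N_def power2_eq_square mult_ac)
qed

lemma grad_cont: "continuous_on UNIV (\<lambda>x. grad \<alpha> x $ i)"
  using C1_mapD(2)[OF C1_grad] .

lemma S_perp_cont: "continuous_on UNIV (S_perp f)"
proof -
  have w: "continuous_on UNIV (\<lambda>x. (hess \<alpha> x *v grad \<beta> x) $ i)" for \<alpha> \<beta> i
    unfolding matrix_vector_mult_def vec_lambda_beta by (intro continuous_on_sum continuous_on_mult hess_cont grad_cont)
  have "continuous_on UNIV (\<lambda>x. (hess \<alpha> x *v grad \<beta> x) \<bullet> (ginv x *v (hess \<gamma> x *v grad \<delta> x)))" for \<alpha> \<beta> \<gamma> \<delta>
    unfolding inner_vec_def inner_real_def matrix_vector_mult_def[of "ginv _"] vec_lambda_beta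
    by (intro continuous_on_sum continuous_on_mult w ginv_cont)
  then show ?thesis
    unfolding S_perp_eq[abs_def] by (intro continuous_on_sum continuous_on_diff)
qed

end

section \<open>Positivity of the volume density\<close>

text \<open>
  The determinant never vanishes for the maps $s f$, $0 \le s \le 1$; it depends continuously on $s$ and
  is 1 at $s = 0$.
\<close>

lemma det_induced_metric_pos:
  fixes f :: "real^'n::finite \<Rightarrow> real^'m::finite"
  assumes "f differentiable (at x)"
  shows "det (induced_metric f x) > 0"
proof (rule ccontr)
  assume "\<not> det (induced_metric f x) > 0"
  define F where "F = (\<lambda>s. (\<chi> i j. (if i = j then 1 else 0) + s * s * (\<Sum>\<alpha>\<in>UNIV. partial i f x $ \<alpha> * partial j f x $ \<alpha>)) :: real^'n^'n)"
  have F: "F s = induced_metric (\<lambda>y. s *\<^sub>R f y) x" for s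
  proof -
    have d: "((\<lambda>y. s *\<^sub>R f y) has_derivative (\<lambda>h. s *\<^sub>R frechet_derivative f (at x) h)) (at x)"
      by (rule has_derivative_scaleR_right[OF has_derivative_partial[OF assms]])
    then have "(\<lambda>y. s *\<^sub>R f y) differentiable (at x)" unfolding differentiable_def by blast
    moreover have "partial i (\<lambda>y. s *\<^sub>R f y) x = s *\<^sub>R partial i f x" for i
      using partial_eqI[OF d] by (simp add: partial_def)
    ultimately show ?thesis
      by (simp add: vec_eq_iff F_def induced_metric_eq sum_distrib_left mult_ac)
  qed
  have nz: "det (F s) \<noteq> 0" for s
  proof -
    have "(\<lambda>y. s *\<^sub>R f y) differentiable (at x)"
      using has_derivative_scaleR_right[OF has_derivative_partial[OF assms]] differentiable_def by blast
    then show ?thesis using invertible_induced_metric invertible_det_nz unfolding F by blast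
  qed
  have "continuous_on {0..1} (\<lambda>s. det (F s))"
    unfolding det_def F_def vec_lambda_beta by (intro continuous_intros)
  moreover have "F 0 = mat 1" by (simp add: F_def mat_def)
  moreover have "F 1 = induced_metric f x" using F[of 1] by simp
  ultimately have "\<exists>s\<ge>0. s \<le> 1 \<and> det (F s) = 0"
    using \<open>\<not> det (induced_metric f x) > 0\<close> by (intro IVT2') auto
  then show False using nz by blast
qed

section \<open>Decay at infinity\<close>

text \<open>
  On the dyadic shell between the radii $2^k$ and $2^{k+1}$ the function is at most $2^{-qk}$, and the
  volume is at most a constant times $2^{nk}$.  So the integral is dominated by a geometric series of
  ratio $2^{n-q}$.
\<close>

lemma integrable_norm_powr_outside_ball:
  assumes q: "q > real DIM('a::euclidean_space)"
  shows "integrable lborel (\<lambda>x::'a. indicator {x. 1 \<le> norm x} x * norm x powr (- q))"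
proof (rule integrableI_nonneg)
  let ?n = "DIM('a)" and ?F = "\<lambda>x::'a. indicator {x. 1 \<le> norm x} x * norm x powr (- q)"
  show "?F \<in> borel_measurable lborel" by measurable
  show "AE x in lborel. 0 \<le> ?F x" by simp
  define w where "w = (\<lambda>k::nat. 2 powr (- q * real k))"
  define s where "s = 2 powr (real ?n - q)"
  have s: "0 \<le> s" "s < 1" using q by (auto simp: s_def powr_less_one)
  have "ennreal (?F x) \<le> (\<Sum>k. ennreal (w k) * indicator (cball 0 (2 ^ Suc k)) x)" for x :: 'a
  proof (cases "1 \<le> norm x")
    case True
    then have "0 < norm x" by linarith
    then have "log 2 (norm x) \<ge> 0" using True zero_le_log_cancel_iff[of 2 "norm x"] by simp
    define k where "k = nat \<lfloor>log 2 (norm x)\<rfloor>"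
    have k: "real k \<le> log 2 (norm x)" "log 2 (norm x) < real k + 1"
      using \<open>log 2 (norm x) \<ge> 0\<close> by (auto simp: k_def)
    have x: "2 powr real k \<le> norm x" "norm x \<le> 2 powr (real (Suc k))"
      using k \<open>0 < norm x\<close> le_log_iff[of 2 "norm x" "real k"] log_le_iff[of 2 "norm x" "real (Suc k)"] by auto
    have "norm x powr (- q) \<le> (2 powr real k) powr (- q)"
      using x q by (intro powr_mono2') auto
    then have "ennreal (?F x) \<le> ennreal (w k) * indicator (cball 0 (2 ^ Suc k)) x"
      using True x by (simp add: w_def powr_powr mult.commute powr_realpow[symmetric] del: power_Suc of_nat_Suc)
    also have "\<dots> \<le> (\<Sum>k. ennreal (w k) * indicator (cball 0 (2 ^ Suc k)) x)"
    proof -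
      have "\<phi> k \<le> (\<Sum>k. \<phi> k)" for \<phi> :: "nat \<Rightarrow> ennreal"
        using sum_le_suminf[of \<phi> "{k}"] by simp
      then show ?thesis .
    qed
    finally show ?thesis .
  qed simp
  then have "(\<integral>\<^sup>+x. ennreal (?F x) \<partial>lborel) \<le> (\<integral>\<^sup>+x. (\<Sum>k. ennreal (w k) * indicator (cball (0::'a) (2 ^ Suc k)) x) \<partial>lborel)"
    by (intro nn_integral_mono)
  also have "\<dots> = (\<Sum>k. \<integral>\<^sup>+x. ennreal (w k) * indicator (cball (0::'a) (2 ^ Suc k)) x \<partial>lborel)"
    by (rule nn_integral_suminf) (simp add: borel_measurable_times_ennreal borel_measurable_indicator)
  also have "\<dots> = (\<Sum>k. ennreal (unit_ball_vol (real ?n) * 2 ^ ?n * s ^ k))"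
  proof (intro suminf_cong)
    fix k
    have "w k * (2 ^ Suc k) ^ ?n = 2 ^ ?n * s ^ k"
    proof -
      have "(2 ^ Suc k) ^ ?n = (2::real) ^ ?n * 2 powr (real k * real ?n)"
        by (simp add: power_mult_distrib powr_realpow[symmetric]) (simp add: powr_powr)
      moreover have "s ^ k = 2 powr ((real ?n - q) * real k)"
        by (simp add: s_def powr_realpow[symmetric] powr_powr)
      ultimately show ?thesis
        by (simp add: w_def powr_add[symmetric] algebra_simps)
    qed
    then have W: "unit_ball_vol (real ?n) * 2 ^ ?n * s ^ k = w k * (unit_ball_vol (real ?n) * (2 ^ Suc k) ^ ?n)"
      by (simp only: mult.assoc mult.left_commute[of "w k"])
    have "0 \<le> w k" by (simp add: w_def)
    then show "(\<integral>\<^sup>+x. ennreal (w k) * indicator (cball (0::'a) (2 ^ Suc k)) x \<partial>lborel)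
        = ennreal (unit_ball_vol (real ?n) * 2 ^ ?n * s ^ k)"
      unfolding W by (simp add: nn_integral_cmult_indicator emeasure_cball ennreal_mult del: power_Suc)
  qed
  also have "\<dots> < \<infinity>"
    using s by (simp add: suminf_ennreal2 summable_mult summable_geometric less_top[symmetric])
  finally show "(\<integral>\<^sup>+x. ennreal (?F x) \<partial>lborel) < \<infinity>" .
qed

lemma uniform_bigo_finite:
  fixes F :: "'k::finite \<Rightarrow> 'a \<Rightarrow> real"
  assumes "\<And>k. F k \<in> O[net](q)"
  shows "\<exists>c\<ge>0. eventually (\<lambda>x. \<forall>k. \<bar>F k x\<bar> \<le> c * \<bar>q x\<bar>) net"
proof -
  have "\<exists>c>0. eventually (\<lambda>x. \<bar>F k x\<bar> \<le> c * \<bar>q x\<bar>) net" for k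
  proof -
    obtain c where "c > 0" "eventually (\<lambda>x. norm (F k x) \<le> c * norm (q x)) net"
      using landau_o.bigE[OF assms[of k]] by blast
    then show ?thesis by auto
  qed
  then obtain c where c: "\<And>k. c k > 0" "\<And>k. eventually (\<lambda>x. \<bar>F k x\<bar> \<le> c k * \<bar>q x\<bar>) net"
    by metis
  have "eventually (\<lambda>x. \<forall>k. \<bar>F k x\<bar> \<le> c k * \<bar>q x\<bar>) net"
    by (rule eventually_all_finite) (rule c)
  then have "eventually (\<lambda>x. \<forall>k. \<bar>F k x\<bar> \<le> (\<Sum>k\<in>UNIV. c k) * \<bar>q x\<bar>) net"
  proof eventually_elim
    case (elim x)
    have "c k * \<bar>q x\<bar> \<le> (\<Sum>k\<in>UNIV. c k) * \<bar>q x\<bar>" for k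
      using c(1) by (intro mult_right_mono member_le_sum) (auto intro: less_imp_le)
    with elim show ?case by (meson order_trans)
  qed
  moreover have "0 \<le> (\<Sum>k\<in>UNIV. c k)"
    using c(1) by (intro sum_nonneg) (auto intro: less_imp_le)
  ultimately show ?thesis by blast
qed

locale asymptotically_flat_graph =
  fixes f :: "real^'n::finite \<Rightarrow> real^'m::finite"
  assumes dim: "CARD('n) \<ge> 2" and flat: "asymptotically_flat f"

sublocale asymptotically_flat_graph \<subseteq> C2_graph f
  using flat by unfold_locales (simp add: asymptotically_flat_def)

context asymptotically_flat_graph
begin

lemma decay:
  obtains p c R where "real CARD('n) < 2 * p + 2" "0 \<le> c" "1 \<le> R"
    "\<And>x \<alpha> i. R \<le> norm x \<Longrightarrow> \<bar>Df \<alpha> x $ i\<bar> \<le> c * norm x powr (- p / 2)"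
    "\<And>x \<alpha> i j. R \<le> norm x \<Longrightarrow> \<bar>hess \<alpha> x $ i $ j\<bar> \<le> c * norm x powr (- p / 2 - 1)"
proof -
  obtain p where p: "p > (real CARD('n) - 2) / 2"
    and p1: "\<And>\<alpha> i. (\<lambda>x. Df \<alpha> x $ i) \<in> O[at_infinity](\<lambda>x. norm x powr (- p / 2))"
    and p2: "\<And>\<alpha> i j. (\<lambda>x. hess \<alpha> x $ i $ j) \<in> O[at_infinity](\<lambda>x. norm x powr (- p / 2 - 1))"
    using flat by (auto simp: asymptotically_flat_def Df_def hess_def)
  obtain c1 where c1: "0 \<le> c1"
    "eventually (\<lambda>x. \<forall>k. \<bar>Df (fst k) x $ snd k\<bar> \<le> c1 * \<bar>norm x powr (- p / 2)\<bar>) at_infinity"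
    using uniform_bigo_finite[of "\<lambda>k x. Df (fst k) x $ snd k" at_infinity "\<lambda>x. norm x powr (- p / 2)"] p1 by auto
  obtain c2 where c2: "0 \<le> c2"
    "eventually (\<lambda>x. \<forall>k. \<bar>hess (fst k) x $ fst (snd k) $ snd (snd k)\<bar> \<le> c2 * \<bar>norm x powr (- p / 2 - 1)\<bar>) at_infinity"
    using uniform_bigo_finite[of "\<lambda>k x. hess (fst k) x $ fst (snd k) $ snd (snd k)" at_infinity "\<lambda>x. norm x powr (- p / 2 - 1)"] p2
    by auto
  obtain R1 where R1: "\<And>x k. R1 \<le> norm x \<Longrightarrow> \<bar>Df (fst k) x $ snd k\<bar> \<le> c1 * \<bar>norm x powr (- p / 2)\<bar>"
    using c1(2) unfolding eventually_at_infinity by blast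
  obtain R2 where R2: "\<And>x k. R2 \<le> norm x \<Longrightarrow> \<bar>hess (fst k) x $ fst (snd k) $ snd (snd k)\<bar> \<le> c2 * \<bar>norm x powr (- p / 2 - 1)\<bar>"
    using c2(2) unfolding eventually_at_infinity by blast
  show ?thesis
  proof (rule that[of p "c1 + c2" "max 1 (max R1 R2)"])
    show "real CARD('n) < 2 * p + 2" using p by (simp add: field_simps)
    show "\<bar>Df \<alpha> x $ i\<bar> \<le> (c1 + c2) * norm x powr (- p / 2)" if "max 1 (max R1 R2) \<le> norm x" for x \<alpha> i
    proof -
      have "\<bar>Df \<alpha> x $ i\<bar> \<le> c1 * norm x powr (- p / 2)" using R1[of x "(\<alpha>, i)"] that by simp
      also have "\<dots> \<le> (c1 + c2) * norm x powr (- p / 2)" using c2(1) by (intro mult_right_mono) auto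
      finally show ?thesis .
    qed
    show "\<bar>hess \<alpha> x $ i $ j\<bar> \<le> (c1 + c2) * norm x powr (- p / 2 - 1)" if "max 1 (max R1 R2) \<le> norm x" for x \<alpha> i j
    proof -
      have "\<bar>hess \<alpha> x $ i $ j\<bar> \<le> c2 * norm x powr (- p / 2 - 1)" using R2[of x "(\<alpha>, i, j)"] that by simp
      also have "\<dots> \<le> (c1 + c2) * norm x powr (- p / 2 - 1)" using c1(1) by (intro mult_right_mono) auto
      finally show ?thesis .
    qed
  qed (use c1(1) c2(1) in auto)
qed

lemma S_perp_integrable: "integrable lborel (S_perp f)"
proof -
  obtain p c R where p: "real CARD('n) < 2 * p + 2" and c: "0 \<le> c" and R: "1 \<le> R"
    and D: "\<And>x \<alpha> i. R \<le> norm x \<Longrightarrow> \<bar>Df \<alpha> x $ i\<bar> \<le> c * norm x powr (- p / 2)"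
    and H: "\<And>x \<alpha> i j. R \<le> norm x \<Longrightarrow> \<bar>hess \<alpha> x $ i $ j\<bar> \<le> c * norm x powr (- p / 2 - 1)"
    by (rule decay) blast
  define K where "K = (real CARD('m))\<^sup>2 * (2 * ((real CARD('n)) ^ 3 * c * c)\<^sup>2)"
  have far: "\<bar>S_perp f x\<bar> \<le> K * norm x powr (- (2 * p + 2))" if "R \<le> norm x" for x
  proof -
    have "\<bar>S_perp f x\<bar> \<le> (real CARD('m))\<^sup>2 * (2 * ((real CARD('n)) ^ 3
        * (c * norm x powr (- p / 2 - 1)) * (c * norm x powr (- p / 2)))\<^sup>2)"
      using that by (intro S_perp_bound D H)
    also have "\<dots> = K * (norm x powr (- p / 2 - 1) * norm x powr (- p / 2))\<^sup>2"
      by (simp add: K_def power_mult_distrib mult_ac)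
    also have "(norm x powr (- p / 2 - 1) * norm x powr (- p / 2))\<^sup>2 = norm x powr (- (2 * p + 2))"
      by (simp add: powr_add[symmetric] power2_eq_square)
    finally show ?thesis .
  qed
  have 1: "integrable lborel (\<lambda>x. indicator (cball 0 R) x *\<^sub>R S_perp f x)"
    by (intro borel_integrable_compact continuous_on_subset[OF S_perp_cont]) auto
  have 2: "integrable lborel (\<lambda>x::real^'n. K * (indicator {x. 1 \<le> norm x} x * norm x powr (- (2 * p + 2))))"
    using integrable_norm_powr_outside_ball[where 'a="real^'n", of "2 * p + 2"] p by (intro integrable_mult_right) simp
  have "S_perp f \<in> borel_measurable lborel"
    using borel_measurable_continuous_onI[OF S_perp_cont] by simp
  moreover have "norm (S_perp f x) \<le> norm (norm (indicator (cball 0 R) x *\<^sub>R S_perp f x)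
      + K * (indicator {x. 1 \<le> norm x} x * norm x powr (- (2 * p + 2))))" for x
  proof (cases "norm x \<le> R")
    case True
    have "0 \<le> K" by (simp add: K_def)
    then show ?thesis using True by simp
  next
    case False
    then show ?thesis using far[of x] R by simp
  qed
  ultimately show ?thesis
    by (intro Bochner_Integration.integrable_bound[OF Bochner_Integration.integrable_add[OF integrable_norm[OF 1] 2]] AE_I2)
qed

text \<open>
  The two flux densities differ by $O(r^{-3p/2}\, r^{-p/2-1}) = O(r^{-2p-1})$ on the sphere of radius
  \<open>r\<close>, whose area is of order $r^{n-1}$.
\<close>

lemma flux_difference_bound:
  obtains p K R where "real CARD('n) < 2 * p + 2"
    "\<And>r. R \<le> r \<Longrightarrow> \<bar>(LINT x:sphere 0 r|sphere_area r.
        \<Sum>i\<in>UNIV. \<Sum>j\<in>UNIV. (partial i (\<lambda>y. g y $ i $ j) x - partial j (\<lambda>y. g y $ i $ i) x) * (x $ j / r))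
      - (LINT x:cball 0 r|lborel. scalar_curvature f x + S_perp f x)\<bar> \<le> K * r powr (real CARD('n) - 2 - 2 * p)"
proof -
  obtain p c R where p: "real CARD('n) < 2 * p + 2" and c: "0 \<le> c" and R: "1 \<le> R"
    and D: "\<And>x \<alpha> i. R \<le> norm x \<Longrightarrow> \<bar>Df \<alpha> x $ i\<bar> \<le> c * norm x powr (- p / 2)"
    and H: "\<And>x \<alpha> i j. R \<le> norm x \<Longrightarrow> \<bar>hess \<alpha> x $ i $ j\<bar> \<le> c * norm x powr (- p / 2 - 1)"
    by (rule decay) blast
  let ?n = "real CARD('n)" and ?m = "real CARD('m)"
  define h0 where "h0 = (\<lambda>x. \<Sum>\<alpha>\<in>UNIV. \<Sum>k\<in>UNIV. \<Sum>i\<in>UNIV. \<Sum>j\<in>UNIV. flat_flux_coeff \<alpha> k i j x * hess \<alpha> x $ i $ k * (x $ j / norm x))"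
  define hk where "hk = (\<lambda>\<alpha> k x. \<Sum>i\<in>UNIV. \<Sum>j\<in>UNIV. flux_coeff \<alpha> k i j x * hess \<alpha> x $ i $ k * (x $ j / norm x))"
  define h where "h = (\<lambda>x. \<Sum>\<alpha>\<in>UNIV. \<Sum>k\<in>UNIV. hk \<alpha> k x)"
  have unit: "continuous_on (- {0}) (\<lambda>x::real^'n. x $ j / norm x)" for j
    by (intro continuous_intros) auto
  have flat_flux_coeff_cont: "continuous_on UNIV (flat_flux_coeff \<alpha> k i j)" for \<alpha> k i j
    unfolding flat_flux_coeff_def[abs_def] by (cases "i = k"; cases "j = k") (auto intro!: continuous_intros Df_cont)
  have cont: "continuous_on (- {0}) h0" "continuous_on (- {0}) (hk \<alpha> k)" "continuous_on (- {0}) h" for \<alpha> k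
    unfolding h0_def hk_def h_def
    by (intro continuous_on_sum continuous_on_mult unit continuous_on_subset[OF flat_flux_coeff_cont]
         continuous_on_subset[OF C1_mapD(2)[OF C1_flux_coeff]] continuous_on_subset[OF hess_cont] subset_UNIV)+
  have m: "(\<lambda>x. hess \<alpha> x $ i $ j) \<in> borel_measurable borel" "flux_coeff \<alpha> k i j \<in> borel_measurable borel"
    "flat_flux_coeff \<alpha> k i j \<in> borel_measurable borel" "(\<lambda>x::real^'n. x $ j / norm x) \<in> borel_measurable borel" for \<alpha> k i j
    by (rule borel_measurable_continuous_onI, rule hess_cont C1_mapD(2)[OF C1_flux_coeff] flat_flux_coeff_cont)+ measurable
  have meas: "h0 \<in> borel_measurable borel" "hk \<alpha> k \<in> borel_measurable borel" "h \<in> borel_measurable borel" for \<alpha> k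
    unfolding h0_def hk_def h_def
    by (intro borel_measurable_sum borel_measurable_times m)+
  define K1 where "K1 = ?m * (?n * (?n * (?n * (4 * ?n\<^sup>2 * ?m * c ^ 3 * c))))"
  have diff: "\<bar>h0 x - h x\<bar> \<le> K1 * norm x powr (- 2 * p - 1)" if x: "R \<le> norm x" for x
  proof -
    let ?a = "c * norm x powr (- p / 2)" and ?b = "c * norm x powr (- p / 2 - 1)"
    have "\<bar>h0 x - h x\<bar> = \<bar>\<Sum>\<alpha>\<in>UNIV. \<Sum>k\<in>UNIV. \<Sum>i\<in>UNIV. \<Sum>j\<in>UNIV. (flux_coeff \<alpha> k i j x - flat_flux_coeff \<alpha> k i j x) * hess \<alpha> x $ i $ k * (x $ j / norm x)\<bar>"
      unfolding h0_def h_def hk_def left_diff_distrib sum_subtractf by (rule abs_minus_commute)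
    also have "\<dots> \<le> (\<Sum>\<alpha>\<in>(UNIV::'m set). \<Sum>k\<in>(UNIV::'n set). \<Sum>i\<in>(UNIV::'n set). \<Sum>j\<in>(UNIV::'n set). 4 * ?n\<^sup>2 * ?m * ?a ^ 3 * ?b * 1)"
    proof (intro order_trans[OF sum_abs] sum_mono)
      fix \<alpha> k i j
      have "\<bar>x $ j / norm x\<bar> \<le> 1"
        using component_le_norm_cart[of x j] by (simp add: divide_le_eq_1)
      then show "\<bar>(flux_coeff \<alpha> k i j x - flat_flux_coeff \<alpha> k i j x) * hess \<alpha> x $ i $ k * (x $ j / norm x)\<bar> \<le> 4 * ?n\<^sup>2 * ?m * ?a ^ 3 * ?b * 1"
        unfolding abs_mult using x c by (intro mult_mono flux_coefficient_bounds(2) D H) auto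
    qed
    also have "\<dots> = K1 * ((norm x powr (- p / 2)) ^ 3 * norm x powr (- p / 2 - 1))"
    proof -
      have "?m * (?n * (?n * (?n * (4 * ?n\<^sup>2 * ?m * (c * s) ^ 3 * (c * t) * 1)))) = K1 * (s ^ 3 * t)" for s t
        by (simp add: K1_def power_mult_distrib)
      then show ?thesis by (simp only: sum_constant)
    qed
    also have "(norm x powr (- p / 2)) ^ 3 * norm x powr (- p / 2 - 1) = norm x powr (- 2 * p - 1)"
      by (simp add: powr_add[symmetric] power3_eq_cube)
    finally show ?thesis .
  qed
  have "\<bar>(LINT x:sphere 0 r|sphere_area r.
        \<Sum>i\<in>UNIV. \<Sum>j\<in>UNIV. (partial i (\<lambda>y. g y $ i $ j) x - partial j (\<lambda>y. g y $ i $ i) x) * (x $ j / r))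
      - (LINT x:cball 0 r|lborel. scalar_curvature f x + S_perp f x)\<bar>
      \<le> (?n * unit_ball_vol ?n * K1) * r powr (?n - 2 - 2 * p)" if r: "R \<le> r" for r
  proof -
    have r0: "r > 0" using r R by linarith
    have "(LINT x:sphere 0 r|sphere_area r.
        \<Sum>i\<in>UNIV. \<Sum>j\<in>UNIV. (partial i (\<lambda>y. g y $ i $ j) x - partial j (\<lambda>y. g y $ i $ i) x) * (x $ j / r))
      = (LINT x:sphere 0 r|sphere_area r. h0 x)"
      unfolding h0_def flux_density_metric
      by (rule set_lebesgue_integral_cong) (auto simp: sphere_area_def)
    moreover have "(LINT x:cball 0 r|lborel. scalar_curvature f x + S_perp f x) = (LINT x:sphere 0 r|sphere_area r. h x)"
    proof -
      have "(LINT x:sphere 0 r|sphere_area r. h x)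
          = (\<Sum>\<alpha>\<in>UNIV. LINT x:sphere 0 r|sphere_area r. \<Sum>k\<in>UNIV. hk \<alpha> k x)"
        unfolding h_def
        by (rule sphere_integral_sum[OF r0]) (intro borel_measurable_sum meas continuous_on_sum cont)+
      also have "\<dots> = (\<Sum>\<alpha>\<in>UNIV. \<Sum>k\<in>UNIV. LINT x:sphere 0 r|sphere_area r. hk \<alpha> k x)"
        by (intro sum.cong refl sphere_integral_sum[OF r0] meas cont)
      finally show ?thesis unfolding hk_def integral_curvatures_eq_flux[OF r0] by simp
    qed
    moreover have "\<bar>LINT x:sphere 0 r|sphere_area r. h0 x - h x\<bar>
       \<le> ?n * unit_ball_vol ?n * (K1 * r powr (- 2 * p - 1)) * r ^ (CARD('n) - 1)"
      using diff r
      by (intro sphere_integral_bound[OF r0] borel_measurable_diff continuous_on_diff meas cont) auto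
    moreover have "r powr (- 2 * p - 1) * r ^ (CARD('n) - 1) = r powr (?n - 2 - 2 * p)"
    proof -
      have "r ^ (CARD('n) - 1) = r powr (?n - 1)"
        using r0 dim by (simp add: powr_realpow[symmetric] of_nat_diff)
      then have "r powr (- 2 * p - 1) * r ^ (CARD('n) - 1) = r powr ((- 2 * p - 1) + (?n - 1))"
        by (simp only: powr_add)
      also have "(- 2 * p - 1) + (?n - 1) = ?n - 2 - 2 * p" by simp
      finally show ?thesis .
    qed
    ultimately show ?thesis
      unfolding sphere_integral_diff[OF r0 meas(1) cont(1) meas(3) cont(3)] by (simp add: mult.assoc)
  qed
  then show ?thesis using that[of p R] p by blast
qed

lemma curvatures_integrable: "integrable lborel (\<lambda>x. scalar_curvature f x + S_perp f x)"
  using flat S_perp_integrable by (auto simp: asymptotically_flat_def)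

text \<open>
  The flux of the curvature field is the integral of $S + S^\perp$ over a ball, hence it converges, and
  the exponent in \<open>flux_difference_bound\<close> is negative.
\<close>

lemma flux_tendsto:
  "((\<lambda>r. LINT x:sphere 0 r|sphere_area r.
        \<Sum>i\<in>UNIV. \<Sum>j\<in>UNIV. (partial i (\<lambda>y. g y $ i $ j) x - partial j (\<lambda>y. g y $ i $ i) x) * (x $ j / r))
    \<longlongrightarrow> (\<integral>x. scalar_curvature f x + S_perp f x \<partial>lborel)) at_top"
proof -
  let ?Q = "\<lambda>x. scalar_curvature f x + S_perp f x"
  let ?F = "\<lambda>r. LINT x:sphere 0 r|sphere_area r.
        \<Sum>i\<in>UNIV. \<Sum>j\<in>UNIV. (partial i (\<lambda>y. g y $ i $ j) x - partial j (\<lambda>y. g y $ i $ i) x) * (x $ j / r)"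
  obtain p K R where p: "real CARD('n) < 2 * p + 2"
    and b: "\<And>r. R \<le> r \<Longrightarrow> \<bar>?F r - (LINT x:cball 0 r|lborel. ?Q x)\<bar> \<le> K * r powr (real CARD('n) - 2 - 2 * p)"
    by (rule flux_difference_bound) blast
  have "((\<lambda>r. K * r powr (real CARD('n) - 2 - 2 * p)) \<longlongrightarrow> 0) at_top"
    using p by (intro tendsto_mult_right_zero tendsto_neg_powr filterlim_ident) simp
  then have 1: "((\<lambda>r. ?F r - (LINT x:cball 0 r|lborel. ?Q x)) \<longlongrightarrow> 0) at_top"
    by (rule Lim_null_comparison[rotated]) (use b in \<open>auto simp: eventually_at_top_linorder\<close>)
  have m: "?Q \<in> borel_measurable lborel"
    using curvatures_integrable by (rule borel_measurable_integrable)
  have 2: "((\<lambda>r. LINT x:cball 0 r|lborel. ?Q x) \<longlongrightarrow> (\<integral>x. ?Q x \<partial>lborel)) at_top"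
    unfolding set_lebesgue_integral_def
  proof (rule integral_dominated_convergence_at_top)
    show "?Q \<in> borel_measurable lborel" by (rule m)
    show "(\<lambda>x. indicator (cball 0 r) x *\<^sub>R ?Q x) \<in> borel_measurable lborel" for r
      using m by (intro borel_measurable_scaleR borel_measurable_indicator) auto
    show "integrable lborel (\<lambda>x. norm (?Q x))" using curvatures_integrable by (rule integrable_norm)
    show "\<forall>\<^sub>F r in at_top. AE x in lborel. norm (indicator (cball 0 r) x *\<^sub>R ?Q x) \<le> norm (?Q x)"
      by (intro always_eventually allI AE_I2) (simp split: split_indicator)
    show "AE x in lborel. ((\<lambda>r. indicator (cball 0 r) x *\<^sub>R ?Q x) \<longlongrightarrow> ?Q x) at_top"
    proof (intro AE_I2 tendsto_eventually)
      fix x :: "real^'n"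
      show "\<forall>\<^sub>F r in at_top. indicator (cball 0 r) x *\<^sub>R ?Q x = ?Q x"
        using eventually_ge_at_top[of "norm x"] by eventually_elim simp
    qed
  qed
  from tendsto_add[OF 1 2] show ?thesis by simp
qed

end

section \<open>The mass formula\<close>

theorem theorem1p1:
  fixes f :: "real^'n::finite \<Rightarrow> real^'m::finite"
  assumes "CARD('n) \<ge> 2"
    and "asymptotically_flat f"
  shows "(adm_flux (induced_metric f) \<longlongrightarrow> adm_mass (induced_metric f)) at_top \<and>
    integrable (graph_volume f)
      (\<lambda>x. (scalar_curvature f x + S_perp f x) * (1 / sqrt (det (induced_metric f x)))) \<and>
    adm_mass (induced_metric f) =
      1 / (2 * (real CARD('n) - 1) * unit_sphere_vol TYPE('n)) *
      (LINT x|graph_volume f.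
         (scalar_curvature f x + S_perp f x) * (1 / sqrt (det (induced_metric f x))))"
proof -
  interpret asymptotically_flat_graph f using assms by unfold_locales
  let ?Q = "\<lambda>x. scalar_curvature f x + S_perp f x" and ?s = "\<lambda>x. sqrt (det (g x))"
  let ?\<kappa> = "1 / (2 * (real CARD('n) - 1) * unit_sphere_vol TYPE('n))"
  have flux: "(adm_flux g \<longlongrightarrow> ?\<kappa> * (\<integral>x. ?Q x \<partial>lborel)) at_top"
    unfolding adm_flux_def[abs_def] by (intro tendsto_mult_left flux_tendsto)
  then have mass: "adm_mass g = ?\<kappa> * (\<integral>x. ?Q x \<partial>lborel)"
    unfolding adm_mass_def by (intro tendsto_Lim) auto
  have s: "?s x > 0" for x using det_induced_metric_pos[OF f_differentiable] by simp
  have "continuous_on UNIV (\<lambda>x. det (g x))"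
    using g_differentiable
    by (intro differentiable_imp_continuous_on) (auto simp: differentiable_on_def intro: det_differentiable)
  then have sm: "?s \<in> borel_measurable lborel"
    using borel_measurable_continuous_onI[OF continuous_on_real_sqrt] by simp
  have Qm: "?Q \<in> borel_measurable lborel"
    using curvatures_integrable by (rule borel_measurable_integrable)
  have qm: "(\<lambda>x. ?Q x * (1 / ?s x)) \<in> borel_measurable lborel"
    using Qm sm by (intro borel_measurable_times borel_measurable_divide borel_measurable_const)
  have s_AE: "AE x in lborel. 0 \<le> ?s x" using s by (intro AE_I2) (simp add: less_imp_le)
  have eq: "(\<lambda>x. ?s x *\<^sub>R (?Q x * (1 / ?s x))) = ?Q"
    using s by (auto simp: less_imp_neq[THEN not_sym])
  have "integrable (graph_volume f) (\<lambda>x. ?Q x * (1 / ?s x))"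
    unfolding graph_volume_def integrable_density[OF qm sm s_AE] eq by (rule curvatures_integrable)
  moreover have "(LINT x|graph_volume f. ?Q x * (1 / ?s x)) = (\<integral>x. ?Q x \<partial>lborel)"
    unfolding graph_volume_def integral_density[OF qm sm s_AE] eq ..
  ultimately show ?thesis
    using flux mass by simp
qed

end
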